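(* Let $M$ be a smooth connected closed Riemannian manifold of positive dimension. Let $c:(a,b)\to P^\infty(M)$ be a smooth curve and let $\phi(t)\in C^\infty(M)$, defined up to the addition of a spatially constant function (a function of $t$ alone), be such that $\frac{dc}{dt}=V_{\phi(t)}$. Then the geodesic equation for $c$ is $$\frac{\partial\phi}{\partial t}+\frac12|\nabla\phi|^2=0,$$ modulo the addition of a spatially constant function to $\phi$. That is, $c$ is a geodesic of $P^\infty(M)$ (with respect to Otto's Riemannian metric) if and only if, after adding to $\phi$ a suitable function of $t$ alone, this equation holds.
   Context: $\mathrm{dvol}_M$ is the Riemannian density of $M$; the Einstein summation convention is used; $\nabla$ is the Levi-Civita connection of $M$. $P^\infty(M) = \{\rho\,\mathrm{dvol}_M : \rho \in C^\infty(M),\ \rho>0,\ \int_M \rho\,\mathrm{dvol}_M = 1\}$, with the smooth topology. It is an infinite-dimensional smooth manifold (in the sense of Kriegl–Michor), being an open subset of an affine space modelled on the space of smooth functions with integral zero. For $\phi \in C^\infty(M)$, the vector field $V_\phi$ on $P^\infty(M)$ is defined by $(V_\phi F)(\rho\,\mathrm{dvol}_M) = \frac{d}{d\epsilon}\big|_{\epsilon=0} F(\rho\,\mathrm{dvol}_M - \epsilon \nabla^i(\rho\nabla_i\phi)\,\mathrm{dvol}_M)$ for $F \in C^\infty(P^\infty(M))$. The map $\phi \mapsto V_\phi$ induces an isomorphism $C^\infty(M)/\mathbb{R} \to T_{\rho\,\mathrm{dvol}_M}P^\infty(M)$. Thus, with $c(t)=\rho(t)\,\mathrm{dvol}_M$,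 the relation $\frac{dc}{dt}=V_{\phi(t)}$ means $\frac{\partial\rho}{\partial t}=-\nabla^i(\rho\nabla_i\phi)$; $\phi(t)$ is taken to depend smoothly on $t$. Otto's Riemannian metric is $\langle V_{\phi_1}, V_{\phi_2}\rangle(\rho\,\mathrm{dvol}_M) = \int_M \langle\nabla\phi_1,\nabla\phi_2\rangle\,\rho\,\mathrm{dvol}_M$, and $\overline{\nabla}$ is its Levi-Civita connection (the torsion-free metric-compatible connection). A vector field $V_{\eta(t)}$ along $c$ (with $\eta(t)\in C^\infty(M)$ smooth in $t$) is parallel along $c$ if $V_{\frac{\partial\eta}{\partial t}}+\overline{\nabla}_{V_{\phi(t)}}V_{\eta(t)}=0$ at $c(t)$ for all $t$, where for fixed $t$ the vector fields in the second term are regarded as globally defined on $P^\infty(M)$. The curve $c$ is a geodesic if its velocity field $\frac{dc}{dt}=V_{\phi(t)}$ is parallel along $c$. *)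

theory Defs
  imports "HOL-Analysis.Analysis"
begin

section \<open>Smooth functions on open subsets of normed spaces\<close>

text \<open>Only meant for open \<open>S\<close>; the derivatives are two-sided Frechet derivatives.\<close>

primrec Ck_on :: "nat \<Rightarrow> 'a::real_normed_vector set \<Rightarrow> ('a \<Rightarrow> 'b::real_normed_vector) \<Rightarrow> bool" where
  "Ck_on 0 S f \<longleftrightarrow> continuous_on S f"
| "Ck_on (Suc k) S f \<longleftrightarrow>
     (\<forall>x\<in>S. f differentiable (at x)) \<and> (\<forall>v. Ck_on k S (\<lambda>x. frechet_derivative f (at x) v))"

definition smooth_on :: "'a::real_normed_vector set \<Rightarrow> ('a \<Rightarrow> 'b::real_normed_vector) \<Rightarrow> bool" where
  "smooth_on S f \<longleftrightarrow> (\<forall>k. Ck_on k S f)"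


section \<open>Closed Riemannian manifolds\<close>

text \<open>
  The underlying set of the manifold is the whole type \<open>'m\<close>; the dimension is \<open>CARD('n)\<close>, hence
  positive. A chart is a pair of an open domain and a coordinate map, which is only relevant
  on that domain. The metric tensor is given by its component matrix \<open>g\<^sub>i\<^sub>j\<close> in each chart, as a
  function of the point. The component \<open>vol\<close> is required below to be the Riemannian density,
  so it is determined by the other two.
\<close>

type_synonym ('m, 'n) chart = "'m set \<times> ('m \<Rightarrow> real ^ 'n)"

record ('m, 'n) riem_mfd =
  atlas :: "('m, 'n) chart set"
  metric :: "('m, 'n) chart \<Rightarrow> 'm \<Rightarrow> real ^ 'n ^ 'n"
  vol :: "'m measure"

definition chart_inv :: "('m, 'n::finite) chart \<Rightarrow> real ^ 'n \<Rightarrow> 'm" where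
  "chart_inv c = inv_into (fst c) (snd c)"

definition smooth_atlas :: "('m::topological_space, 'n::finite) chart set \<Rightarrow> bool" where
  "smooth_atlas A \<longleftrightarrow>
     (\<Union>c\<in>A. fst c) = UNIV \<and>
     (\<forall>c\<in>A. open (fst c) \<and> open (snd c ` fst c) \<and>
        homeomorphism (fst c) (snd c ` fst c) (snd c) (chart_inv c)) \<and>
     (\<forall>c\<in>A. \<forall>d\<in>A. smooth_on (snd c ` (fst c \<inter> fst d)) (snd d \<circ> chart_inv c))"

text \<open>The coordinate partial derivative \<open>\<partial>\<^sub>i f\<close> in the chart \<open>c\<close>, as a function of the point.\<close>

definition pd :: "('m, 'n::finite) chart \<Rightarrow> 'n \<Rightarrow> ('m \<Rightarrow> real) \<Rightarrow> 'm \<Rightarrow> real" where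
  "pd c i f p = frechet_derivative (f \<circ> chart_inv c) (at (snd c p)) (axis i 1)"

definition riemannian_metric ::
  "('m, 'n::finite) chart set \<Rightarrow> (('m, 'n) chart \<Rightarrow> 'm \<Rightarrow> real ^ 'n ^ 'n) \<Rightarrow> bool" where
  "riemannian_metric A g \<longleftrightarrow>
     (\<forall>c\<in>A. smooth_on (snd c ` fst c) (g c \<circ> chart_inv c) \<and>
        (\<forall>p\<in>fst c. transpose (g c p) = g c p \<and> (\<forall>v. v \<noteq> 0 \<longrightarrow> 0 < v \<bullet> (g c p *v v)))) \<and>
     (\<forall>c\<in>A. \<forall>d\<in>A. \<forall>p\<in>fst c \<inter> fst d. \<forall>i j.
        g c p $ i $ j =
          (\<Sum>k\<in>UNIV. \<Sum>l\<in>UNIV.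
             pd c i (\<lambda>q. snd d q $ k) p * pd c j (\<lambda>q. snd d q $ l) p * g d p $ k $ l))"

text \<open>In every chart the Riemannian density is \<open>sqrt (det g) dx\<close>.\<close>

definition riemannian_density ::
  "('m::topological_space, 'n::finite) chart set \<Rightarrow> (('m, 'n) chart \<Rightarrow> 'm \<Rightarrow> real ^ 'n ^ 'n) \<Rightarrow>
     'm measure \<Rightarrow> bool" where
  "riemannian_density A g \<mu> \<longleftrightarrow>
     sets \<mu> = sets borel \<and>
     (\<forall>c\<in>A. \<forall>B\<in>sets borel. B \<subseteq> fst c \<longrightarrow>
        emeasure \<mu> B =
          (\<integral>\<^sup>+x\<in>snd c ` B. ennreal (sqrt (det (g c (chart_inv c x)))) \<partial>lborel))"

definition closed_riemannian_manifold :: "('m::t2_space, 'n::finite) riem_mfd \<Rightarrow> bool" where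
  "closed_riemannian_manifold M \<longleftrightarrow>
     compact (UNIV :: 'm set) \<and>
     smooth_atlas (atlas M) \<and>
     riemannian_metric (atlas M) (metric M) \<and>
     riemannian_density (atlas M) (metric M) (vol M)"


section \<open>Calculus on the manifold\<close>

definition smooth_fun :: "('m, 'n::finite) riem_mfd \<Rightarrow> ('m \<Rightarrow> real) \<Rightarrow> bool" where
  "smooth_fun M f \<longleftrightarrow> (\<forall>c\<in>atlas M. smooth_on (snd c ` fst c) (f \<circ> chart_inv c))"

text \<open>
  A smooth curve in \<open>C\<^sup>\<infinity>(M)\<close> over an open set \<open>I\<close> of times: smoothness in the sense of Kriegl and
  Michor amounts to joint smoothness on \<open>I \<times> M\<close> (exponential law).
\<close>

definition smooth_curve ::
  "('m, 'n::finite) riem_mfd \<Rightarrow> real set \<Rightarrow> (real \<Rightarrow> 'm \<Rightarrow> real) \<Rightarrow> bool" where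
  "smooth_curve M I f \<longleftrightarrow>
     (\<forall>c\<in>atlas M. smooth_on (I \<times> snd c ` fst c) (\<lambda>(t, x). f t (chart_inv c x)))"

text \<open>
  The two operators below are expressed in an arbitrarily chosen chart around the point;
  being tensorial, their values do not depend on the choice.
\<close>

definition chart_at :: "('m, 'n::finite) riem_mfd \<Rightarrow> 'm \<Rightarrow> ('m, 'n) chart" where
  "chart_at M p = (SOME c. c \<in> atlas M \<and> p \<in> fst c)"

text \<open>\<open>g\<^sup>i\<^sup>j\<close>\<close>

definition ginv :: "('m, 'n::finite) riem_mfd \<Rightarrow> ('m, 'n) chart \<Rightarrow> 'm \<Rightarrow> real ^ 'n ^ 'n" where
  "ginv M c p = matrix_inv (metric M c p)"

text \<open>The Christoffel symbol \<open>\<Gamma>\<^sup>k\<^sub>i\<^sub>j\<close> of the Levi-Civita connection of \<open>M\<close>.\<close>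

definition christoffel ::
  "('m, 'n::finite) riem_mfd \<Rightarrow> ('m, 'n) chart \<Rightarrow> 'n \<Rightarrow> 'n \<Rightarrow> 'n \<Rightarrow> 'm \<Rightarrow> real" where
  "christoffel M c k i j p =
     (1/2) * (\<Sum>l\<in>UNIV. ginv M c p $ k $ l *
        (pd c i (\<lambda>q. metric M c q $ j $ l) p + pd c j (\<lambda>q. metric M c q $ i $ l) p
          - pd c l (\<lambda>q. metric M c q $ i $ j) p))"

text \<open>\<open>\<nabla>\<^sub>j \<omega>\<^sub>i = \<partial>\<^sub>j \<omega>\<^sub>i - \<Gamma>\<^sup>k\<^sub>j\<^sub>i \<omega>\<^sub>k\<close> for a one-form with components \<open>\<omega> i\<close> in the chart \<open>c\<close>.\<close>

definition cov_deriv ::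
  "('m, 'n::finite) riem_mfd \<Rightarrow> ('m, 'n) chart \<Rightarrow> 'n \<Rightarrow> ('n \<Rightarrow> 'm \<Rightarrow> real) \<Rightarrow> 'n \<Rightarrow> 'm \<Rightarrow> real" where
  "cov_deriv M c j \<omega> i p = pd c j (\<omega> i) p - (\<Sum>k\<in>UNIV. christoffel M c k j i p * \<omega> k p)"

text \<open>\<open>\<langle>\<nabla>\<phi>, \<nabla>\<psi>\<rangle> = g\<^sup>i\<^sup>j \<partial>\<^sub>i\<phi> \<partial>\<^sub>j\<psi>\<close>\<close>

definition grad_inner ::
  "('m, 'n::finite) riem_mfd \<Rightarrow> ('m \<Rightarrow> real) \<Rightarrow> ('m \<Rightarrow> real) \<Rightarrow> 'm \<Rightarrow> real" where
  "grad_inner M \<phi> \<psi> p =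
     (let c = chart_at M p in
      \<Sum>i\<in>UNIV. \<Sum>j\<in>UNIV. ginv M c p $ i $ j * pd c i \<phi> p * pd c j \<psi> p)"

text \<open>\<open>\<nabla>\<^sup>i(\<rho> \<nabla>\<^sub>i\<phi>)\<close>\<close>

definition div_weighted_grad ::
  "('m, 'n::finite) riem_mfd \<Rightarrow> ('m \<Rightarrow> real) \<Rightarrow> ('m \<Rightarrow> real) \<Rightarrow> 'm \<Rightarrow> real" where
  "div_weighted_grad M \<rho> \<phi> p =
     (let c = chart_at M p in
      \<Sum>i\<in>UNIV. \<Sum>j\<in>UNIV. ginv M c p $ i $ j *
        cov_deriv M c j (\<lambda>k q. \<rho> q * pd c k \<phi> q) i p)"


section \<open>The manifold of smooth positive probability densities\<close>

text \<open>The measure \<open>\<rho> dvol\<close> is represented by its (unique) smooth density \<open>\<rho>\<close>.\<close>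

definition Pinf :: "('m, 'n::finite) riem_mfd \<Rightarrow> ('m \<Rightarrow> real) set" where
  "Pinf M = {\<rho>. smooth_fun M \<rho> \<and> (\<forall>x. 0 < \<rho> x) \<and> (LINT x|vol M. \<rho> x) = 1}"

text \<open>
  \<open>Pinf M\<close> is open in an affine space modelled on the following space, which therefore is the
  tangent space at every point.
\<close>

definition Tinf :: "('m, 'n::finite) riem_mfd \<Rightarrow> ('m \<Rightarrow> real) set" where
  "Tinf M = {u. smooth_fun M u \<and> (LINT x|vol M. u x) = 0}"

definition Pinf_curve ::
  "('m, 'n::finite) riem_mfd \<Rightarrow> real set \<Rightarrow> (real \<Rightarrow> 'm \<Rightarrow> real) \<Rightarrow> bool" where
  "Pinf_curve M I \<gamma> \<longleftrightarrow> smooth_curve M I \<gamma> \<and> (\<forall>t\<in>I. \<gamma> t \<in> Pinf M)"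

text \<open>
  Smoothness on \<open>Pinf M\<close> is that of convenient calculus: smooth curves are mapped to smooth
  curves. Functions and vector fields on \<open>Pinf M\<close> are HOL functions of which only the values
  on \<open>Pinf M\<close> matter.
\<close>

type_synonym 'm functional = "('m \<Rightarrow> real) \<Rightarrow> real"
type_synonym 'm vfield = "('m \<Rightarrow> real) \<Rightarrow> 'm \<Rightarrow> real"

definition smooth_functional :: "('m, 'n::finite) riem_mfd \<Rightarrow> 'm functional \<Rightarrow> bool" where
  "smooth_functional M F \<longleftrightarrow> (\<forall>\<gamma>. Pinf_curve M UNIV \<gamma> \<longrightarrow> smooth_on UNIV (\<lambda>t. F (\<gamma> t)))"

definition vector_field :: "('m, 'n::finite) riem_mfd \<Rightarrow> 'm vfield \<Rightarrow> bool" where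
  "vector_field M X \<longleftrightarrow>
     (\<forall>\<rho>\<in>Pinf M. X \<rho> \<in> Tinf M) \<and>
     (\<forall>\<gamma>. Pinf_curve M UNIV \<gamma> \<longrightarrow> smooth_curve M UNIV (\<lambda>t. X (\<gamma> t)))"

text \<open>The function \<open>X F\<close>; \<open>\<rho> + \<epsilon> X(\<rho>)\<close> lies in \<open>Pinf M\<close> for small \<open>\<epsilon>\<close>.\<close>

definition vf_apply :: "'m vfield \<Rightarrow> 'm functional \<Rightarrow> 'm functional" where
  "vf_apply X F \<rho> = deriv (\<lambda>\<epsilon>. F (\<lambda>x. \<rho> x + \<epsilon> * X \<rho> x)) 0"

definition Vpot :: "('m, 'n::finite) riem_mfd \<Rightarrow> ('m \<Rightarrow> real) \<Rightarrow> 'm vfield" where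
  "Vpot M \<phi> \<rho> = (\<lambda>x. - div_weighted_grad M \<rho> \<phi> x)"


section \<open>Otto's metric and its Levi-Civita connection\<close>

text \<open>
  A potential of the tangent vector \<open>u\<close> at \<open>\<rho>\<close>, i.e. a preimage under the isomorphism
  \<open>\<phi> \<mapsto> V\<^sub>\<phi>(\<rho>)\<close> from \<open>C\<^sup>\<infinity>(M)/\<real>\<close> to the tangent space. On connected \<open>M\<close> it is unique up to an
  additive constant, which does not affect the metric.
\<close>

definition potential :: "('m, 'n::finite) riem_mfd \<Rightarrow> ('m \<Rightarrow> real) \<Rightarrow> ('m \<Rightarrow> real) \<Rightarrow> 'm \<Rightarrow> real" where
  "potential M \<rho> u = (SOME \<phi>. smooth_fun M \<phi> \<and> Vpot M \<phi> \<rho> = u)"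

definition otto_metric ::
  "('m, 'n::finite) riem_mfd \<Rightarrow> ('m \<Rightarrow> real) \<Rightarrow> ('m \<Rightarrow> real) \<Rightarrow> ('m \<Rightarrow> real) \<Rightarrow> real" where
  "otto_metric M \<rho> u v =
     (LINT x|vol M. grad_inner M (potential M \<rho> u) (potential M \<rho> v) x * \<rho> x)"

text \<open>
  Weak Riemannian metrics on \<open>Pinf M\<close>: no completeness of the tangent spaces is required.
\<close>

definition riemannian_metric_Pinf ::
  "('m, 'n::finite) riem_mfd \<Rightarrow> (('m \<Rightarrow> real) \<Rightarrow> ('m \<Rightarrow> real) \<Rightarrow> ('m \<Rightarrow> real) \<Rightarrow> real) \<Rightarrow> bool" where
  "riemannian_metric_Pinf M G \<longleftrightarrow>
     (\<forall>\<rho>\<in>Pinf M. \<forall>u\<in>Tinf M. \<forall>v\<in>Tinf M. G \<rho> u v = G \<rho> v u) \<and>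
     (\<forall>\<rho>\<in>Pinf M. \<forall>u\<in>Tinf M. \<forall>v\<in>Tinf M. \<forall>w\<in>Tinf M. \<forall>r s.
        G \<rho> (\<lambda>x. r * u x + s * v x) w = r * G \<rho> u w + s * G \<rho> v w) \<and>
     (\<forall>\<rho>\<in>Pinf M. \<forall>u\<in>Tinf M. u \<noteq> (\<lambda>x. 0) \<longrightarrow> 0 < G \<rho> u u) \<and>
     (\<forall>X Y. vector_field M X \<longrightarrow> vector_field M Y \<longrightarrow>
        smooth_functional M (\<lambda>\<rho>. G \<rho> (X \<rho>) (Y \<rho>)))"

definition affine_connection ::
  "('m, 'n::finite) riem_mfd \<Rightarrow> ('m vfield \<Rightarrow> 'm vfield \<Rightarrow> 'm vfield) \<Rightarrow> bool" where
  "affine_connection M D \<longleftrightarrow>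
     (\<forall>X Y. vector_field M X \<longrightarrow> vector_field M Y \<longrightarrow> vector_field M (D X Y)) \<and>
     (\<forall>X X' Y. vector_field M X \<longrightarrow> vector_field M X' \<longrightarrow> vector_field M Y \<longrightarrow>
        (\<forall>\<rho>\<in>Pinf M. \<forall>x. D (\<lambda>\<sigma> y. X \<sigma> y + X' \<sigma> y) Y \<rho> x = D X Y \<rho> x + D X' Y \<rho> x)) \<and>
     (\<forall>f X Y. smooth_functional M f \<longrightarrow> vector_field M X \<longrightarrow> vector_field M Y \<longrightarrow>
        (\<forall>\<rho>\<in>Pinf M. \<forall>x. D (\<lambda>\<sigma> y. f \<sigma> * X \<sigma> y) Y \<rho> x = f \<rho> * D X Y \<rho> x)) \<and>
     (\<forall>X Y Y'. vector_field M X \<longrightarrow> vector_field M Y \<longrightarrow> vector_field M Y' \<longrightarrow>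
        (\<forall>\<rho>\<in>Pinf M. \<forall>x. D X (\<lambda>\<sigma> y. Y \<sigma> y + Y' \<sigma> y) \<rho> x = D X Y \<rho> x + D X Y' \<rho> x)) \<and>
     (\<forall>f X Y. smooth_functional M f \<longrightarrow> vector_field M X \<longrightarrow> vector_field M Y \<longrightarrow>
        (\<forall>\<rho>\<in>Pinf M. \<forall>x. D X (\<lambda>\<sigma> y. f \<sigma> * Y \<sigma> y) \<rho> x
            = vf_apply X f \<rho> * Y \<rho> x + f \<rho> * D X Y \<rho> x))"

text \<open>\<open>D\<^sub>X Y - D\<^sub>Y X = [X, Y]\<close> as derivations of the smooth functions on \<open>Pinf M\<close>.\<close>

definition torsion_free ::
  "('m, 'n::finite) riem_mfd \<Rightarrow> ('m vfield \<Rightarrow> 'm vfield \<Rightarrow> 'm vfield) \<Rightarrow> bool" where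
  "torsion_free M D \<longleftrightarrow>
     (\<forall>X Y F. vector_field M X \<longrightarrow> vector_field M Y \<longrightarrow> smooth_functional M F \<longrightarrow>
        (\<forall>\<rho>\<in>Pinf M. vf_apply (D X Y) F \<rho> - vf_apply (D Y X) F \<rho>
            = vf_apply X (vf_apply Y F) \<rho> - vf_apply Y (vf_apply X F) \<rho>))"

definition metric_compatible ::
  "('m, 'n::finite) riem_mfd \<Rightarrow> (('m \<Rightarrow> real) \<Rightarrow> ('m \<Rightarrow> real) \<Rightarrow> ('m \<Rightarrow> real) \<Rightarrow> real) \<Rightarrow>
     ('m vfield \<Rightarrow> 'm vfield \<Rightarrow> 'm vfield) \<Rightarrow> bool" where
  "metric_compatible M G D \<longleftrightarrow>
     (\<forall>X Y Z. vector_field M X \<longrightarrow> vector_field M Y \<longrightarrow> vector_field M Z \<longrightarrow>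
        (\<forall>\<rho>\<in>Pinf M. vf_apply X (\<lambda>\<sigma>. G \<sigma> (Y \<sigma>) (Z \<sigma>)) \<rho>
            = G \<rho> (D X Y \<rho>) (Z \<rho>) + G \<rho> (Y \<rho>) (D X Z \<rho>)))"

definition levi_civita ::
  "('m, 'n::finite) riem_mfd \<Rightarrow> (('m \<Rightarrow> real) \<Rightarrow> ('m \<Rightarrow> real) \<Rightarrow> ('m \<Rightarrow> real) \<Rightarrow> real) \<Rightarrow>
     ('m vfield \<Rightarrow> 'm vfield \<Rightarrow> 'm vfield) \<Rightarrow> bool" where
  "levi_civita M G D \<longleftrightarrow>
     riemannian_metric_Pinf M G \<and> affine_connection M D \<and> torsion_free M D \<and>
     metric_compatible M G D"


section \<open>Geodesics\<close>

text \<open>\<open>dc/dt = V\<^bsub>\<phi>(t)\<^esub>\<close> for the curve \<open>c(t) = \<rho>(t) dvol\<close>.\<close>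

definition has_velocity_potential ::
  "('m, 'n::finite) riem_mfd \<Rightarrow> real set \<Rightarrow> (real \<Rightarrow> 'm \<Rightarrow> real) \<Rightarrow> (real \<Rightarrow> 'm \<Rightarrow> real) \<Rightarrow> bool" where
  "has_velocity_potential M I \<rho> \<phi> \<longleftrightarrow>
     smooth_curve M I \<phi> \<and>
     (\<forall>t\<in>I. \<forall>x. ((\<lambda>s. \<rho> s x) has_real_derivative Vpot M (\<phi> t) (\<rho> t) x) (at t))"

text \<open>
  The field \<open>V\<^bsub>\<eta>(t)\<^esub>\<close> is parallel along the curve \<open>\<rho>\<close> with velocity \<open>V\<^bsub>\<phi>(t)\<^esub>\<close>. For fixed \<open>t\<close> the
  arguments of \<open>D\<close> are globally defined vector fields.
\<close>

definition parallel_along ::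
  "('m, 'n::finite) riem_mfd \<Rightarrow> ('m vfield \<Rightarrow> 'm vfield \<Rightarrow> 'm vfield) \<Rightarrow> real set \<Rightarrow>
     (real \<Rightarrow> 'm \<Rightarrow> real) \<Rightarrow> (real \<Rightarrow> 'm \<Rightarrow> real) \<Rightarrow> (real \<Rightarrow> 'm \<Rightarrow> real) \<Rightarrow> bool" where
  "parallel_along M D I \<rho> \<phi> \<eta> \<longleftrightarrow>
     (\<forall>t\<in>I. \<forall>x. Vpot M (\<lambda>y. deriv (\<lambda>s. \<eta> s y) t) (\<rho> t) x
                 + D (Vpot M (\<phi> t)) (Vpot M (\<eta> t)) (\<rho> t) x = 0)"

text \<open>
  The velocity potential is unique up to functions of \<open>t\<close> alone, and parallelism is insensitive
  to these, so any choice of potential may be used.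
\<close>

definition geodesic ::
  "('m, 'n::finite) riem_mfd \<Rightarrow> ('m vfield \<Rightarrow> 'm vfield \<Rightarrow> 'm vfield) \<Rightarrow> real set \<Rightarrow>
     (real \<Rightarrow> 'm \<Rightarrow> real) \<Rightarrow> bool" where
  "geodesic M D I \<rho> \<longleftrightarrow>
     (\<exists>\<phi>. has_velocity_potential M I \<rho> \<phi> \<and> parallel_along M D I \<rho> \<phi> \<phi>)"

end

theory Submission
  imports Defs
begin

text \<open>
  The Koszul formula for \<open>V\<^sub>\<phi>, V\<^sub>\<phi>, V\<^sub>\<psi>\<close> and integration by parts show that the covariant derivative of
  \<open>V\<^sub>\<phi>\<close> along itself is \<open>V\<^sub>q\<close> with \<open>q = |\<nabla>\<phi>|\<^sup>2 / 2\<close>. A curve with velocity potential \<open>\<phi>\<close> is therefore a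
  geodesic iff \<open>V\<close> of \<open>\<partial>\<phi>/\<partial>t + |\<nabla>\<phi>|\<^sup>2 / 2\<close> vanishes, i.e. iff this function is constant in space, and the
  constant is absorbed by subtracting its antiderivative in \<open>t\<close> from \<open>\<phi>\<close>. No elliptic theory is needed:
  the existence of potentials is implicit in Otto's metric being a Riemannian metric. The chart
  independence of the divergence follows from that of its weak formulation.
\<close>

section \<open>Functions of class \<open>C\<^sup>k\<close>\<close>

text \<open>The geodesic case is tractable because only
  \<open>D V\<^sub>\<phi> V\<^sub>\<phi>\<close> occurs: \<nabla>\<phi> differentiated along itself
  is again a gradient, whereas two different potentials would bring in a projection onto gradients.
  As the connection is known only through its axioms, this field is identified weakly, by
  integrating against arbitrary smooth \<psi>. The Otto product of \<open>V\<^sub>\<psi>\<close>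
  with a tangent vector \<open>u\<close> is the integral of \<psi> times \<open>u\<close>; hence the
  functionals in the Koszul formula are affine in the density, their derivatives are exact, and no
  Hessian is computed. The integral of \<open>\<langle>\<nabla>\<phi>, \<nabla>\<psi>\<rangle>
  V\<^sub>\<phi>\<close> occurs in the metric and in the torsion identity and cancels. Most of the
  work lies in integration by parts on the manifold. The divergence is written with Christoffel
  symbols in a chart chosen arbitrarily at each point, so its regularity cannot be read off the
  definition. In one fixed chart it is rewritten as a total derivative and integrated against test
  functions supported there; only then is it freed from the chart.\<close>

lemma frechet_cong_open:
  assumes "open S" "x \<in> S" "\<And>y. y \<in> S \<Longrightarrow> f y = g y"
  shows "frechet_derivative f (at x) = frechet_derivative g (at x)"
proof -
  have "(f has_derivative d) (at x) \<longleftrightarrow> (g has_derivative d) (at x)" for d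
    using assms has_derivative_transform_within_open[of f d x UNIV S g]
      has_derivative_transform_within_open[of g d x UNIV S f] by auto
  then show ?thesis by (simp add: frechet_derivative_def)
qed

lemma differentiable_cong_open:
  assumes "open S" "x \<in> S" "\<And>y. y \<in> S \<Longrightarrow> f y = g y" "f differentiable (at x)"
  shows "g differentiable (at x)"
  using assms has_derivative_transform_within_open[of f _ x UNIV S g]
  unfolding differentiable_def by metis

lemma Ck_on_cong:
  assumes "open S" "\<And>x. x \<in> S \<Longrightarrow> f x = g x" "Ck_on k S f"
  shows "Ck_on k S g"
  using assms(2,3)
proof (induction k arbitrary: f g)
  case 0
  then show ?case by (simp cong: continuous_on_cong)
next
  case (Suc k)
  have "g differentiable (at x)" if "x \<in> S" for x
    using differentiable_cong_open[OF \<open>open S\<close> that, of f g] Suc.prems that by simp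
  moreover have "Ck_on k S (\<lambda>x. frechet_derivative g (at x) v)" for v
    using Suc.IH[of "\<lambda>x. frechet_derivative f (at x) v"] Suc.prems
      frechet_cong_open[OF \<open>open S\<close>, of _ f g] by auto
  ultimately show ?case by simp
qed

lemma Ck_on_subset: "Ck_on k S f \<Longrightarrow> T \<subseteq> S \<Longrightarrow> Ck_on k T f"
  by (induction k arbitrary: f) (auto intro: continuous_on_subset)

lemma Ck_on_imp_continuous: "Ck_on k S f \<Longrightarrow> continuous_on S f"
  by (cases k) (auto intro!: continuous_at_imp_continuous_on differentiable_imp_continuous_within)

lemma Ck_on_SucD: "Ck_on (Suc k) S f \<Longrightarrow> Ck_on k S f"
  by (induction k arbitrary: f)
    (auto intro!: continuous_at_imp_continuous_on differentiable_imp_continuous_within)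

lemma Ck_on_le: "Ck_on m S f \<Longrightarrow> k \<le> m \<Longrightarrow> Ck_on k S f"
  by (induction m) (auto simp: le_Suc_eq simp del: Ck_on.simps dest: Ck_on_SucD)

text \<open>\<open>Ck_on\<close> is phrased with the chosen derivative
  \<open>frechet_derivative\<close>; here any derivative known in closed form may take its place.
  The closure properties below are inductions on \<open>k\<close> built on this rule.\<close>

lemma Ck_on_SucI:
  assumes "open S" "\<And>x. x \<in> S \<Longrightarrow> (f has_derivative f' x) (at x)"
    and "\<And>v. Ck_on k S (\<lambda>x. f' x v)"
  shows "Ck_on (Suc k) S f"
proof -
  have "Ck_on k S (\<lambda>x. frechet_derivative f (at x) v)" for v
    by (rule Ck_on_cong[OF \<open>open S\<close> _ assms(3)[of v]])
      (use frechet_derivative_at[OF assms(2)] in auto)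
  then show ?thesis using assms(2) by (auto simp: differentiable_def)
qed

lemma Ck_on_has_derivative:
  "Ck_on (Suc k) S f \<Longrightarrow> x \<in> S \<Longrightarrow> (f has_derivative frechet_derivative f (at x)) (at x)"
  by (simp add: frechet_derivative_works[symmetric])

lemma Ck_on_derivative:
  "Ck_on (Suc k) S f \<Longrightarrow> Ck_on k S (\<lambda>x. frechet_derivative f (at x) v)"
  by simp

lemma Ck_on_open_Un:
  assumes "open S" "open T" "Ck_on k S f" "Ck_on k T f"
  shows "Ck_on k (S \<union> T) f"
  using assms(3,4) by (induction k arbitrary: f) (auto intro!: continuous_on_open_Un[OF assms(1,2)])

lemma Ck_on_const [simp]: "Ck_on k S (\<lambda>x. c)"
  by (induction k arbitrary: c) auto

declare Ck_on.simps(2) [simp del]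

lemma Ck_on_bounded_linear:
  assumes "open S" "bounded_linear L" "Ck_on k S f"
  shows "Ck_on k S (\<lambda>x. L (f x))"
  using assms(3)
proof (induction k arbitrary: f)
  case 0
  then show ?case
    using bounded_linear.continuous_on[OF assms(2)] by auto
next
  case (Suc k)
  show ?case
    by (rule Ck_on_SucI[OF \<open>open S\<close>], rule bounded_linear.has_derivative[OF assms(2)],
        erule Ck_on_has_derivative[OF Suc.prems], rule Suc.IH, rule Ck_on_derivative[OF Suc.prems])
qed

lemma Ck_on_self_linear:
  assumes "open S" "bounded_linear L"
  shows "Ck_on k S L"
proof (cases k)
  case 0
  then show ?thesis using assms linear_continuous_on by auto
next
  case (Suc m)
  show ?thesis unfolding Suc
    by (rule Ck_on_SucI[OF \<open>open S\<close>, where f'="\<lambda>_. L"])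
      (simp_all add: bounded_linear_imp_has_derivative assms)
qed

lemma Ck_on_add:
  assumes "open S" "Ck_on k S f" "Ck_on k S g"
  shows "Ck_on k S (\<lambda>x. f x + g x)"
  using assms(2,3)
proof (induction k arbitrary: f g)
  case (Suc k)
  show ?case
    by (rule Ck_on_SucI[OF \<open>open S\<close>], rule has_derivative_add,
        erule Ck_on_has_derivative[OF Suc.prems(1)], erule Ck_on_has_derivative[OF Suc.prems(2)],
        intro Suc.IH Ck_on_derivative[OF Suc.prems(1)] Ck_on_derivative[OF Suc.prems(2)])
qed (auto intro: continuous_intros)

lemma Ck_on_mult:
  fixes f g :: "'a::real_normed_vector \<Rightarrow> real"
  assumes "open S" "Ck_on k S f" "Ck_on k S g"
  shows "Ck_on k S (\<lambda>x. f x * g x)"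
  using assms(2,3)
proof (induction k arbitrary: f g)
  case (Suc k)
  show ?case
    by (rule Ck_on_SucI[OF \<open>open S\<close>], rule has_derivative_mult,
        erule Ck_on_has_derivative[OF Suc.prems(1)], erule Ck_on_has_derivative[OF Suc.prems(2)],
        intro Ck_on_add Suc.IH assms(1)
          Ck_on_derivative[OF Suc.prems(1)] Ck_on_derivative[OF Suc.prems(2)]
          Ck_on_SucD[OF Suc.prems(1)] Ck_on_SucD[OF Suc.prems(2)])
qed (auto intro: continuous_intros)

lemma Ck_on_minus:
  fixes f :: "'a::real_normed_vector \<Rightarrow> real"
  shows "open S \<Longrightarrow> Ck_on k S f \<Longrightarrow> Ck_on k S (\<lambda>x. - f x)"
  using Ck_on_mult[of S k "\<lambda>_. -1" f] by simp

lemma Ck_on_diff: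
  fixes f g :: "'a::real_normed_vector \<Rightarrow> real"
  shows "open S \<Longrightarrow> Ck_on k S f \<Longrightarrow> Ck_on k S g \<Longrightarrow> Ck_on k S (\<lambda>x. f x - g x)"
  using Ck_on_add[of S k f "\<lambda>x. - g x"] Ck_on_minus[of S k g] by simp

lemma Ck_on_sum:
  assumes "open S" "\<And>i. i \<in> I \<Longrightarrow> Ck_on k S (f i)"
  shows "Ck_on k S (\<lambda>x. \<Sum>i\<in>I. f i x)"
  using assms(2) by (induction I rule: infinite_finite_induct) (auto intro: Ck_on_add assms(1))

lemma Ck_on_prod:
  fixes f :: "'i \<Rightarrow> 'a::real_normed_vector \<Rightarrow> real"
  assumes "open S" "\<And>i. i \<in> I \<Longrightarrow> Ck_on k S (f i)"
  shows "Ck_on k S (\<lambda>x. \<Prod>i\<in>I. f i x)"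
  using assms(2) by (induction I rule: infinite_finite_induct) (auto intro: Ck_on_mult assms(1))

text \<open>The derivative of \<open>1/f\<close> contains \<open>1/f\<close> again, but only order
  \<open>k\<close> of it is asked for, so the induction closes with \<open>f\<close> fixed.\<close>

lemma Ck_on_inverse:
  fixes f :: "'a::real_normed_vector \<Rightarrow> real"
  assumes "open S" "Ck_on k S f" "\<And>x. x \<in> S \<Longrightarrow> f x \<noteq> 0"
  shows "Ck_on k S (\<lambda>x. inverse (f x))"
  using assms(2)
proof (induction k)
  case 0
  then show ?case using assms(3) by (auto intro!: continuous_intros)
next
  case (Suc k)
  note inv = Suc.IH[OF Ck_on_SucD[OF Suc.prems]]
  show ?case
  proof (rule Ck_on_SucI[OF \<open>open S\<close>])
    show "((\<lambda>x. inverse (f x)) has_derivative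
        (\<lambda>v. - (inverse (f x) * frechet_derivative f (at x) v * inverse (f x)))) (at x)" if "x \<in> S" for x
      by (rule Deriv.has_derivative_inverse[OF assms(3)[OF that] Ck_on_has_derivative[OF Suc.prems that]])
  qed (intro Ck_on_minus Ck_on_mult assms(1) inv Ck_on_derivative[OF Suc.prems])
qed

text \<open>The derivative of the composite is expanded over \<open>Basis\<close> into products of
  real functions: partial derivatives of \<open>g\<close> times partial derivatives of
  \<open>f\<close> composed with \<open>g\<close>. The latter are covered by the induction
  hypothesis, which is why \<open>f\<close> is generalised while \<open>g\<close> stays
  fixed.\<close>

lemma Ck_on_compose:
  fixes f :: "'b::euclidean_space \<Rightarrow> real" and g :: "'a::real_normed_vector \<Rightarrow> 'b"
  assumes "open S" "open T" "g ` S \<subseteq> T" "Ck_on k T f" "\<And>b. b \<in> Basis \<Longrightarrow> Ck_on k S (\<lambda>x. g x \<bullet> b)"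
  shows "Ck_on k S (\<lambda>x. f (g x))"
  using assms(4,5)
proof (induction k arbitrary: f)
  case 0
  have "continuous_on S g"
    using 0(2) by (subst continuous_on_componentwise) auto
  then show ?case
    using 0(1) assms(3) continuous_on_compose2[of T f S g] by auto
next
  case (Suc k)
  let ?g' = "\<lambda>x v. \<Sum>b\<in>Basis. frechet_derivative (\<lambda>x. g x \<bullet> b) (at x) v *\<^sub>R b"
  let ?f' = "\<lambda>x. frechet_derivative f (at x)"
  have g': "(g has_derivative ?g' x) (at x)" if "x \<in> S" for x
    by (subst has_derivative_componentwise_within)
      (auto simp: inner_sum_left_Basis Ck_on_has_derivative[OF Suc.prems(2) that])
  have lin: "linear (?f' y)" if "y \<in> T" for y
    using Ck_on_has_derivative[OF Suc.prems(1) that] has_derivative_linear by blast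
  have "Ck_on k S (\<lambda>x. \<Sum>b\<in>Basis. frechet_derivative (\<lambda>x. g x \<bullet> b) (at x) v * ?f' (g x) b)" for v
  proof (intro Ck_on_sum[OF \<open>open S\<close>] Ck_on_mult[OF \<open>open S\<close>])
    fix b :: 'b assume "b \<in> Basis"
    then show "Ck_on k S (\<lambda>x. frechet_derivative (\<lambda>x. g x \<bullet> b) (at x) v)"
      by (intro Ck_on_derivative Suc.prems(2))
    show "Ck_on k S (\<lambda>x. ?f' (g x) b)"
      using Suc.IH[OF Ck_on_derivative[OF Suc.prems(1)]] Ck_on_SucD[OF Suc.prems(2)] by simp
  qed
  moreover have "(\<Sum>b\<in>Basis. frechet_derivative (\<lambda>x. g x \<bullet> b) (at x) v * ?f' (g x) b) = ?f' (g x) (?g' x v)"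
    if "x \<in> S" for x v
    using lin[of "g x"] that assms(3) by (auto simp: linear_sum linear_cmul)
  ultimately have "Ck_on k S (\<lambda>x. ?f' (g x) (?g' x v))" for v
    using Ck_on_cong[OF \<open>open S\<close>, of "\<lambda>x. \<Sum>b\<in>Basis. frechet_derivative (\<lambda>x. g x \<bullet> b) (at x) v * ?f' (g x) b"
        "\<lambda>x. ?f' (g x) (?g' x v)" k] by blast
  moreover have "((\<lambda>x. f (g x)) has_derivative (\<lambda>v. ?f' (g x) (?g' x v))) (at x)" if "x \<in> S" for x
    using has_derivative_compose[OF g'[OF that]  Ck_on_has_derivative[OF Suc.prems(1)]] that assms(3) by auto
  ultimately show ?case
    using Ck_on_SucI[OF \<open>open S\<close>, of "\<lambda>x. f (g x)" "\<lambda>x v. ?f' (g x) (?g' x v)" k] by blast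
qed

lemma Ck_on_case_prod_mult:
  fixes F G :: "'a::real_normed_vector \<Rightarrow> 'b::real_normed_vector \<Rightarrow> real"
  assumes "open S" "Ck_on k S (\<lambda>(t, x). F t x)" "Ck_on k S (\<lambda>(t, x). G t x)"
  shows "Ck_on k S (\<lambda>(t, x). F t x * G t x)"
  using Ck_on_mult[OF assms] by (simp add: case_prod_unfold)

text \<open>Meant for the density \<open>sqrt (det g)\<close>, which is differentiated only once in
  the coordinate formula for the divergence.\<close>

lemma Ck_1_sqrt: "Ck_on (Suc 0) {0<..} sqrt"
proof (rule Ck_on_SucI)
  show "(sqrt has_derivative (*) (inverse (sqrt x) / 2)) (at x)" if "x \<in> {0<..}" for x
    using DERIV_real_sqrt[of x] that by (simp add: has_field_derivative_def)
qed (auto intro!: continuous_intros)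

text \<open>\<open>C\<^sup>1\<close> test functions suffice for integration by parts; this avoids \<open>exp (- 1 / x)\<close>.\<close>

lemma C1_bump:
  fixes x0 :: "'a::euclidean_space"
  shows "Ck_on 1 UNIV (\<lambda>x. (max 0 (r\<^sup>2 - (x - x0) \<bullet> (x - x0)))\<^sup>2)"
proof -
  define q where "q = (\<lambda>x. r\<^sup>2 - (x - x0) \<bullet> (x - x0))"
  have m: "((\<lambda>s::real. (max 0 s)\<^sup>2) has_real_derivative 2 * max 0 s) (at s)" for s
  proof (cases "s = 0")
    case True
    \<comment> \<open>At the kink the difference quotient of the squared positive part is at most
      \<open>\<bar>h\<bar>\<close>; squaring is what makes the function differentiable
      there.\<close>
    have "((\<lambda>h. (max 0 (0 + h))\<^sup>2 / h) \<longlongrightarrow> 0) (at (0::real))"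
    proof (rule Lim_null_comparison[where g="\<lambda>h. \<bar>h\<bar>"])
      show "\<forall>\<^sub>F h in at (0::real). norm ((max 0 (0 + h))\<^sup>2 / h) \<le> \<bar>h\<bar>"
        by (rule always_eventually) (auto simp: max_def power2_eq_square)
    qed (auto intro!: tendsto_eq_intros)
    then show ?thesis using True by (simp add: DERIV_def)
  next
    case False
    then consider "s > 0" | "s < 0" by linarith
    then show ?thesis
    proof cases
      case 1
      have "((\<lambda>s::real. s\<^sup>2) has_real_derivative 2 * max 0 s) (at s)"
        using 1 by (auto intro!: derivative_eq_intros)
      then show ?thesis
        by (rule has_field_derivative_transform_within_open[where S="{0<..}"]) (use 1 in auto)
    next
      case 2
      have "((\<lambda>s::real. 0) has_real_derivative 2 * max 0 s) (at s)"
        using 2 by (auto intro!: derivative_eq_intros)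
      then show ?thesis
        by (rule has_field_derivative_transform_within_open[where S="{..<0}"]) (use 2 in auto)
    qed
  qed
  have q: "(q has_derivative (\<lambda>v. - 2 * ((x - x0) \<bullet> v))) (at x)" for x
    unfolding q_def by (auto intro!: derivative_eq_intros simp: inner_commute)
  have "((\<lambda>x. (max 0 (q x))\<^sup>2) has_derivative (\<lambda>v. - 2 * ((x - x0) \<bullet> v) * (2 * max 0 (q x)))) (at x)" for x
    using DERIV_compose_FDERIV[OF m q] .
  then have "Ck_on (Suc 0) UNIV (\<lambda>x. (max 0 (q x))\<^sup>2)"
    by (rule Ck_on_SucI[OF open_UNIV]) (auto intro!: continuous_intros simp: q_def)
  then show ?thesis by (simp add: q_def)
qed

section \<open>Matrix calculus and the divergence in coordinates\<close>

lemma Ck_on_det: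
  fixes A :: "'a::real_normed_vector \<Rightarrow> real^'n^'n"
  assumes "open S" "\<And>i j. Ck_on k S (\<lambda>x. A x $ i $ j)"
  shows "Ck_on k S (\<lambda>x. det (A x))"
  unfolding det_def by (intro Ck_on_sum Ck_on_mult Ck_on_prod Ck_on_const assms)

lemma matrix_inv_mult:
  fixes A :: "real^'n^'n"
  assumes "det A \<noteq> 0"
  shows "A ** matrix_inv A = mat 1" "matrix_inv A ** A = mat 1"
proof -
  have "\<exists>B. A ** B = mat 1 \<and> B ** A = mat 1"
    using assms invertible_det_nz[of A] by (simp add: invertible_def)
  then have "A ** matrix_inv A = mat 1 \<and> matrix_inv A ** A = mat 1"
    unfolding matrix_inv_def by (rule someI_ex)
  then show "A ** matrix_inv A = mat 1" "matrix_inv A ** A = mat 1" by auto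
qed

text \<open>Cramer's rule for the \<open>j\<close>-th column of the inverse. It exhibits the entries
  as quotients of polynomials in the entries of \<open>A\<close>, so that the inverse is as regular
  as \<open>A\<close>.\<close>

lemma matrix_inv_entry:
  fixes A :: "real^'n^'n"
  assumes "det A \<noteq> 0"
  shows "matrix_inv A $ i $ j = det (\<chi> r s. if s = i then axis j 1 $ r else A $ r $ s) / det A"
proof -
  have "A *v (matrix_inv A *v axis j 1) = axis j 1"
    using matrix_inv_mult(1)[OF assms] by (simp add: matrix_vector_mul_assoc)
  then have "matrix_inv A *v axis j 1 = (\<chi> k. det (\<chi> r s. if s = k then axis j 1 $ r else A $ r $ s) / det A)"
    using cramer[OF assms] by blast
  moreover have "(matrix_inv A *v axis j 1) $ i = matrix_inv A $ i $ j"
    by (simp add: matrix_vector_mult_basis column_def)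
  ultimately show ?thesis by simp
qed

lemma Ck_on_matrix_inv:
  fixes A :: "'a::real_normed_vector \<Rightarrow> real^'n^'n"
  assumes "open S" "\<And>i j. Ck_on k S (\<lambda>x. A x $ i $ j)" "\<And>x. x \<in> S \<Longrightarrow> det (A x) \<noteq> 0"
  shows "Ck_on k S (\<lambda>x. matrix_inv (A x) $ i $ j)"
proof -
  have "Ck_on k S (\<lambda>x. (\<chi> r s. if s = i then axis j 1 $ r else A x $ r $ s) $ r $ s)" for r s
    using assms(2) by (cases "s = i") auto
  then have "Ck_on k S (\<lambda>x. det (\<chi> r s. if s = i then axis j 1 $ r else A x $ r $ s) * inverse (det (A x)))"
    by (intro Ck_on_mult Ck_on_inverse Ck_on_det assms) auto
  then show ?thesis
    by (rule Ck_on_cong[OF \<open>open S\<close>, rotated]) (use assms(3) in \<open>simp add: matrix_inv_entry divide_inverse\<close>)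
qed

lemma transpose_matrix_inv:
  fixes A :: "real^'n^'n"
  assumes "det A \<noteq> 0" "transpose A = A"
  shows "matrix_inv A $ i $ j = matrix_inv A $ j $ i"
proof -
  let ?B = "matrix_inv A"
  have "transpose ?B ** A = transpose (A ** ?B)"
    by (simp add: matrix_transpose_mul assms(2))
  then have "transpose ?B ** A = mat 1"
    by (simp add: matrix_inv_mult(1)[OF assms(1)] transpose_mat)
  then have "?B = (transpose ?B ** A) ** ?B" by simp
  also have "\<dots> = transpose ?B"
    by (simp add: matrix_mul_assoc[symmetric] matrix_inv_mult(1)[OF assms(1)])
  finally have "?B $ i $ j = transpose ?B $ i $ j" by simp
  then show ?thesis by (simp add: transpose_def)
qed

text \<open>Every matrix on the segment from the identity to \<open>A\<close> has a positive
  quadratic form and is therefore invertible. The determinant is continuous along the segment,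
  equals 1 at the start and never vanishes, so it is still positive at the end.\<close>

lemma det_pos_of_pos_def:
  fixes A :: "real^'n^'n"
  assumes pos: "\<And>v. v \<noteq> 0 \<Longrightarrow> 0 < v \<bullet> (A *v v)"
  shows "0 < det A"
proof (rule ccontr)
  assume neg: "\<not> 0 < det A"
  define B where "B t = t *\<^sub>R A + (1 - t) *\<^sub>R mat 1" for t :: real
  have nz: "det (B t) \<noteq> 0" if t: "0 \<le> t" "t \<le> 1" for t
  proof -
    have "v = 0" if "B t *v v = 0" for v
    proof (rule ccontr)
      assume "v \<noteq> 0"
      have "0 = v \<bullet> (B t *v v)" using that by simp
      also have "\<dots> = t * (v \<bullet> (A *v v)) + (1 - t) * (v \<bullet> v)"
        by (simp add: B_def matrix_vector_mult_add_rdistrib scaleR_matrix_vector_assoc[symmetric] inner_add_right)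
      also have "\<dots> > 0"
      proof (cases "t = 0")
        case False
        then show ?thesis using t pos[OF \<open>v \<noteq> 0\<close>] by (intro add_pos_nonneg) auto
      qed (use \<open>v \<noteq> 0\<close> in auto)
      finally show False by simp
    qed
    then show ?thesis
      unfolding invertible_det_nz[symmetric] invertible_left_inverse matrix_left_invertible_ker by blast
  qed
  have "continuous_on {0..1} (\<lambda>t. det (B t))"
    unfolding B_def det_def by (auto intro!: continuous_intros)
  moreover have "det (B 0) = 1" "det (B 1) = det A" by (auto simp: B_def)
  ultimately obtain t where "0 \<le> t" "t \<le> 1" "det (B t) = 0"
    using IVT2'[of "\<lambda>t. det (B t)" 1 0 0] neg by auto
  then show False using nz by blast
qed

text \<open>Jacobi's formula. The product rule on the Leibniz expansion gives a sum of determinants,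
  in each of which one row of \<open>A\<close> is replaced by its derivative.\<close>

lemma has_derivative_det:
  fixes A :: "'a::real_normed_vector \<Rightarrow> real^'n^'n"
  assumes d: "\<And>i j. ((\<lambda>x. A x $ i $ j) has_derivative A' i j) (at x)" and nz: "det (A x) \<noteq> 0"
  shows "((\<lambda>x. det (A x)) has_derivative
           (\<lambda>v. det (A x) * (\<Sum>k\<in>UNIV. \<Sum>l\<in>UNIV. matrix_inv (A x) $ l $ k * A' k l v))) (at x)"
    (is "(_ has_derivative ?D) _")
proof -
  let ?U = "UNIV :: 'n set"
  let ?B = "matrix_inv (A x)"
  let ?P = "{p. p permutes ?U}"
  have "((\<lambda>x. det (A x)) has_derivative
      (\<lambda>v. \<Sum>p\<in>?P. of_int (sign p) * (\<Sum>k\<in>?U. A' k (p k) v * (\<Prod>j\<in>?U - {k}. A x $ j $ p j)))) (at x)"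
    unfolding det_def by (intro has_derivative_sum has_derivative_mult_right has_derivative_prod d)
  moreover have "(\<Sum>p\<in>?P. of_int (sign p) * (\<Sum>k\<in>?U. A' k (p k) v * (\<Prod>j\<in>?U - {k}. A x $ j $ p j))) = ?D v" for v
  proof -
    define R where "R k = (\<chi> l. A' k l v)" for k
    have "(\<Sum>p\<in>?P. of_int (sign p) * (\<Sum>k\<in>?U. A' k (p k) v * (\<Prod>j\<in>?U - {k}. A x $ j $ p j)))
        = (\<Sum>k\<in>?U. \<Sum>p\<in>?P. of_int (sign p) * (A' k (p k) v * (\<Prod>j\<in>?U - {k}. A x $ j $ p j)))"
      by (simp add: sum_distrib_left) (rule sum.swap)
    also have "\<dots> = (\<Sum>k\<in>?U. det (\<chi> i. if i = k then R k else row i (A x)))"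
    proof (rule sum.cong[OF refl])
      fix k
      have "(\<Prod>i\<in>?U. (\<chi> i. if i = k then R k else row i (A x)) $ i $ p i)
          = A' k (p k) v * (\<Prod>j\<in>?U - {k}. A x $ j $ p j)" for p
        by (subst prod.remove[of _ k]) (auto simp: R_def row_def intro!: prod.cong)
      then show "(\<Sum>p\<in>?P. of_int (sign p) * (A' k (p k) v * (\<Prod>j\<in>?U - {k}. A x $ j $ p j)))
          = det (\<chi> i. if i = k then R k else row i (A x))"
        by (simp add: det_def)
    qed
    also have "\<dots> = (\<Sum>k\<in>?U. (\<Sum>l\<in>?U. R k $ l * ?B $ l $ k) * det (A x))"
    proof (rule sum.cong[OF refl])
      fix k
      let ?y = "R k v* ?B"
      \<comment> \<open>The new row is a combination of the rows of \<open>A x\<close> with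
        coefficients \<open>?y\<close>; by Cramer's lemma only the coefficient of row
        \<open>k\<close> survives in the determinant.\<close>
      have "R k = ?y v* A x"
        by (simp add: vector_matrix_mul_assoc matrix_inv_mult[OF nz])
      also have "\<dots> = (\<Sum>i\<in>?U. ?y $ i *s row i (A x))"
        by (simp add: vec_eq_iff vector_matrix_mult_def row_def mult.commute)
      finally have "det (\<chi> i. if i = k then R k else row i (A x)) = ?y $ k * det (A x)"
        using cramer_lemma_transpose[of k ?y "A x"] by (simp only:)
      then show "det (\<chi> i. if i = k then R k else row i (A x)) = (\<Sum>l\<in>?U. R k $ l * ?B $ l $ k) * det (A x)"
        by (simp add: vector_matrix_mult_def mult.commute)
    qed
    also have "\<dots> = det (A x) * (\<Sum>k\<in>?U. \<Sum>l\<in>?U. A' k l v * ?B $ l $ k)"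
      by (simp add: sum_distrib_left sum_distrib_right R_def mult_ac)
    also have "\<dots> = det (A x) * (\<Sum>k\<in>?U. \<Sum>l\<in>?U. ?B $ l $ k * A' k l v)"
      by (simp add: mult_ac)
    finally show ?thesis .
  qed
  ultimately show ?thesis by simp
qed

text \<open>The coordinate expression \<open>\<partial>\<^sub>i (W H\<^sup>i\<^sup>j \<omega>\<^sub>j) = W H\<^sup>i\<^sup>j \<nabla>\<^sub>j \<omega>\<^sub>i\<close> of the divergence, where \<open>H\<close>
  is the inverse metric, \<open>dg\<close> and \<open>\<omega>'\<close> are the partial derivatives of the metric and of the one-form
  and \<open>W\<close> is the square root of the determinant.\<close>

lemma divergence_coordinates:
  fixes H :: "'n::finite \<Rightarrow> 'n \<Rightarrow> real" and dg \<Gamma> :: "'n \<Rightarrow> 'n \<Rightarrow> 'n \<Rightarrow> real"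
  assumes symH: "\<And>i j. H i j = H j i" and symg: "\<And>i j l. dg i j l = dg i l j"
    and W': "\<And>i. W' i = W / 2 * (\<Sum>a\<in>UNIV. \<Sum>b\<in>UNIV. H a b * dg i a b)"
    and H': "\<And>i j k. H' i j k = - (\<Sum>a\<in>UNIV. \<Sum>b\<in>UNIV. H j a * dg i a b * H b k)"
    and \<Gamma>: "\<And>k i j. \<Gamma> k i j = 1/2 * (\<Sum>l\<in>UNIV. H k l * (dg i j l + dg j i l - dg l i j))"
  shows "(\<Sum>i\<in>UNIV. \<Sum>j\<in>UNIV. W' i * H i j * \<omega> j + W * H' i i j * \<omega> j + W * H i j * \<omega>' i j)
       = W * (\<Sum>i\<in>UNIV. \<Sum>j\<in>UNIV. H i j * (\<omega>' j i - (\<Sum>k\<in>UNIV. \<Gamma> k j i * \<omega> k)))"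
proof -
  \<comment> \<open>Up to symmetry, \<open>T1\<close> and \<open>T2\<close> are the only
    contractions of the derivative of the metric that occur below.\<close>
  define T1 where "T1 k = (\<Sum>i\<in>UNIV. \<Sum>a\<in>UNIV. \<Sum>b\<in>UNIV. H i k * (H a b * dg i a b))" for k
  define T2 where "T2 k = (\<Sum>i\<in>UNIV. \<Sum>a\<in>UNIV. \<Sum>b\<in>UNIV. H i a * (H b k * dg i a b))" for k
  \<comment> \<open>In the contracted Christoffel symbol the first two terms agree by symmetry and
    give \<open>T2\<close> each, while the third one traces the differentiated metric and gives
    \<open>T1\<close>.\<close>
  have E: "(\<Sum>i\<in>UNIV. \<Sum>j\<in>UNIV. H i j * \<Gamma> k j i) = T2 k - T1 k / 2" for k
  proof -
    have "(\<Sum>i\<in>UNIV. \<Sum>j\<in>UNIV. \<Sum>l\<in>UNIV. H i j * (H k l * dg j i l))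
        = (\<Sum>j\<in>UNIV. \<Sum>i\<in>UNIV. \<Sum>l\<in>UNIV. H i j * (H k l * dg j i l))"
      by (rule sum.swap)
    also have "\<dots> = T2 k"
      unfolding T2_def
    proof (intro sum.cong refl)
      fix j i l show "H i j * (H k l * dg j i l) = H j i * (H l k * dg j i l)"
        by (simp only: symH[of i j] symH[of k l])
    qed
    finally have 1: "(\<Sum>i\<in>UNIV. \<Sum>j\<in>UNIV. \<Sum>l\<in>UNIV. H i j * (H k l * dg j i l)) = T2 k" .
    have 2: "(\<Sum>i\<in>UNIV. \<Sum>j\<in>UNIV. \<Sum>l\<in>UNIV. H i j * (H k l * dg i j l)) = T2 k"
      unfolding T2_def
    proof (intro sum.cong refl)
      fix i j l show "H i j * (H k l * dg i j l) = H i j * (H l k * dg i j l)"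
        by (simp only: symH[of k l])
    qed
    have "(\<Sum>i\<in>UNIV. \<Sum>j\<in>UNIV. \<Sum>l\<in>UNIV. H i j * (H k l * dg l j i))
        = (\<Sum>i\<in>UNIV. \<Sum>l\<in>UNIV. \<Sum>j\<in>UNIV. H i j * (H k l * dg l j i))"
      by (intro sum.cong[OF refl] sum.swap)
    also have "\<dots> = (\<Sum>l\<in>UNIV. \<Sum>i\<in>UNIV. \<Sum>j\<in>UNIV. H i j * (H k l * dg l j i))"
      by (rule sum.swap)
    also have "\<dots> = T1 k"
      unfolding T1_def
    proof (intro sum.cong refl)
      fix l i j show "H i j * (H k l * dg l j i) = H l k * (H i j * dg l i j)"
        by (simp add: symH[of k l] symg[of l j i])
    qed
    finally have 3: "(\<Sum>i\<in>UNIV. \<Sum>j\<in>UNIV. \<Sum>l\<in>UNIV. H i j * (H k l * dg l j i)) = T1 k" .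
    have "(\<Sum>i\<in>UNIV. \<Sum>j\<in>UNIV. H i j * \<Gamma> k j i) =
      1/2 * ((\<Sum>i\<in>UNIV. \<Sum>j\<in>UNIV. \<Sum>l\<in>UNIV. H i j * (H k l * dg j i l))
       + (\<Sum>i\<in>UNIV. \<Sum>j\<in>UNIV. \<Sum>l\<in>UNIV. H i j * (H k l * dg i j l))
       - (\<Sum>i\<in>UNIV. \<Sum>j\<in>UNIV. \<Sum>l\<in>UNIV. H i j * (H k l * dg l j i)))"
      unfolding \<Gamma> sum.distrib[symmetric] sum_subtractf[symmetric] sum_distrib_left
      by (intro sum.cong refl) (simp add: field_simps)
    then show ?thesis unfolding 1 2 3 by simp
  qed
  have a: "(\<Sum>i\<in>UNIV. \<Sum>j\<in>UNIV. W' i * H i j * \<omega> j) = W * (\<Sum>j\<in>UNIV. T1 j / 2 * \<omega> j)"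
  proof -
    have "(\<Sum>i\<in>UNIV. \<Sum>j\<in>UNIV. W' i * H i j * \<omega> j) = (\<Sum>j\<in>UNIV. \<Sum>i\<in>UNIV. W' i * H i j * \<omega> j)"
      by (rule sum.swap)
    also have "\<dots> = W * (\<Sum>j\<in>UNIV. T1 j / 2 * \<omega> j)"
      unfolding W' T1_def sum_distrib_left sum_distrib_right sum_divide_distrib
      by (intro sum.cong refl) (simp add: field_simps)
    finally show ?thesis .
  qed
  have b: "(\<Sum>i\<in>UNIV. \<Sum>j\<in>UNIV. W * H' i i j * \<omega> j) = - W * (\<Sum>j\<in>UNIV. T2 j * \<omega> j)"
  proof -
    have "(\<Sum>i\<in>UNIV. \<Sum>j\<in>UNIV. W * H' i i j * \<omega> j) = (\<Sum>j\<in>UNIV. \<Sum>i\<in>UNIV. W * H' i i j * \<omega> j)"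
      by (rule sum.swap)
    also have "\<dots> = - W * (\<Sum>j\<in>UNIV. T2 j * \<omega> j)"
      unfolding H' T2_def sum_distrib_left sum_distrib_right sum_negf[symmetric]
      by (intro sum.cong refl) (simp add: field_simps)
    finally show ?thesis .
  qed
  have c: "(\<Sum>i\<in>UNIV. \<Sum>j\<in>UNIV. W * H i j * \<omega>' i j) = W * (\<Sum>i\<in>UNIV. \<Sum>j\<in>UNIV. H i j * \<omega>' j i)"
  proof -
    have "(\<Sum>i\<in>UNIV. \<Sum>j\<in>UNIV. W * H i j * \<omega>' i j) = (\<Sum>j\<in>UNIV. \<Sum>i\<in>UNIV. W * H i j * \<omega>' i j)"
      by (rule sum.swap)
    also have "\<dots> = W * (\<Sum>i\<in>UNIV. \<Sum>j\<in>UNIV. H i j * \<omega>' j i)"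
      unfolding sum_distrib_left
    proof (intro sum.cong refl)
      fix j i show "W * H i j * \<omega>' i j = W * (H j i * \<omega>' i j)"
        by (simp add: symH[of i j])
    qed
    finally show ?thesis .
  qed
  have d: "(\<Sum>i\<in>UNIV. \<Sum>j\<in>UNIV. H i j * (\<Sum>k\<in>UNIV. \<Gamma> k j i * \<omega> k)) = (\<Sum>k\<in>UNIV. (T2 k - T1 k / 2) * \<omega> k)"
  proof -
    have "(\<Sum>i\<in>UNIV. \<Sum>j\<in>UNIV. H i j * (\<Sum>k\<in>UNIV. \<Gamma> k j i * \<omega> k))
        = (\<Sum>i\<in>UNIV. \<Sum>k\<in>UNIV. \<Sum>j\<in>UNIV. H i j * \<Gamma> k j i * \<omega> k)"
      unfolding sum_distrib_left mult.assoc[symmetric] by (intro sum.cong[OF refl] sum.swap)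
    also have "\<dots> = (\<Sum>k\<in>UNIV. \<Sum>i\<in>UNIV. \<Sum>j\<in>UNIV. H i j * \<Gamma> k j i * \<omega> k)"
      by (rule sum.swap)
    finally show ?thesis unfolding E[symmetric] sum_distrib_right .
  qed
  \<comment> \<open>The derivative of \<open>W\<close> contributes \<open>T1 / 2\<close> and that of
    the inverse metric \<open>- T2\<close>; together they are the negative of the contracted
    Christoffel symbol, as the covariant derivative demands.\<close>
  show ?thesis
    unfolding sum.distrib a b c right_diff_distrib sum_subtractf d left_diff_distrib
    by (simp add: algebra_simps)
qed

text \<open>Differentiating \<open>A B = 1\<close> gives \<open>A dB + dA B = 0\<close>, which is
  solved for \<open>dB\<close> by multiplying with \<open>B\<close> from the left. That
  \<open>B\<close> is differentiable at all comes from Cramer's rule.\<close>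

lemma frechet_matrix_inv:
  fixes A :: "'a::real_normed_vector \<Rightarrow> real^'n^'n"
  assumes "open S" "x \<in> S" "\<And>i j. Ck_on (Suc 0) S (\<lambda>x. A x $ i $ j)" "\<And>x. x \<in> S \<Longrightarrow> det (A x) \<noteq> 0"
  shows "frechet_derivative (\<lambda>x. matrix_inv (A x) $ i $ j) (at x) v =
    - (\<Sum>a\<in>UNIV. \<Sum>b\<in>UNIV. matrix_inv (A x) $ i $ a *
        frechet_derivative (\<lambda>x. A x $ a $ b) (at x) v * matrix_inv (A x) $ b $ j)"
proof -
  define B where "B = (\<lambda>x. matrix_inv (A x))"
  define dA where "dA = (\<chi> a b. frechet_derivative (\<lambda>x. A x $ a $ b) (at x) v)"
  define dB where "dB = (\<chi> a b. frechet_derivative (\<lambda>x. B x $ a $ b) (at x) v)"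
  have A': "((\<lambda>x. A x $ a $ b) has_derivative frechet_derivative (\<lambda>x. A x $ a $ b) (at x)) (at x)" for a b
    by (rule Ck_on_has_derivative[OF assms(3,2)])
  have B': "((\<lambda>x. B x $ a $ b) has_derivative frechet_derivative (\<lambda>x. B x $ a $ b) (at x)) (at x)" for a b
    unfolding B_def by (rule Ck_on_has_derivative[OF Ck_on_matrix_inv[OF assms(1,3,4)] assms(2)])
  have AB: "A y ** B y = mat 1" if "y \<in> S" for y
    unfolding B_def by (rule matrix_inv_mult(1)[OF assms(4)[OF that]])
  have "(A x ** dB + dA ** B x) $ a $ b = 0" for a b
  proof -
    have "((\<lambda>y. \<Sum>k\<in>UNIV. A y $ a $ k * B y $ k $ b) has_derivative
        (\<lambda>v. \<Sum>k\<in>UNIV. A x $ a $ k * frechet_derivative (\<lambda>x. B x $ k $ b) (at x) v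
          + frechet_derivative (\<lambda>x. A x $ a $ k) (at x) v * B x $ k $ b)) (at x)"
      by (intro has_derivative_sum has_derivative_mult A' B')
    moreover have "((\<lambda>y. \<Sum>k\<in>UNIV. A y $ a $ k * B y $ k $ b) has_derivative (\<lambda>_. 0)) (at x)"
    proof (rule has_derivative_transform_within_open[OF _ assms(1,2)])
      show "((\<lambda>_. mat 1 $ a $ b) has_derivative (\<lambda>_. 0)) (at x)" by simp
      show "(mat 1 :: real^'n^'n) $ a $ b = (\<Sum>k\<in>UNIV. A y $ a $ k * B y $ k $ b)" if "y \<in> S" for y
        using AB[OF that] by (simp add: matrix_matrix_mult_def vec_eq_iff)
    qed
    ultimately have "(\<lambda>v. \<Sum>k\<in>UNIV. A x $ a $ k * frechet_derivative (\<lambda>x. B x $ k $ b) (at x) v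
          + frechet_derivative (\<lambda>x. A x $ a $ k) (at x) v * B x $ k $ b) = (\<lambda>_. 0)"
      by (rule has_derivative_unique)
    from fun_cong[OF this, of v] show ?thesis
      by (simp add: matrix_matrix_mult_def dA_def dB_def sum.distrib)
  qed
  then have "A x ** dB + dA ** B x = 0" by (simp add: vec_eq_iff)
  then have "A x ** dB = - (dA ** B x)" by (simp add: eq_neg_iff_add_eq_0)
  then have "B x ** (A x ** dB) = B x ** (- (dA ** B x))" by simp
  then have "dB = B x ** (- (dA ** B x))"
    by (simp add: matrix_mul_assoc B_def matrix_inv_mult(2)[OF assms(4)[OF assms(2)]])
  then have "dB $ i $ j = (B x ** (- (dA ** B x))) $ i $ j" by simp
  then show ?thesis
    by (simp add: dB_def B_def dA_def matrix_matrix_mult_def sum_negf sum_distrib_left mult.assoc)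
qed

section \<open>Integrals of compactly supported functions on Euclidean space\<close>

lemma integrable_compact_support:
  fixes u :: "'a::euclidean_space \<Rightarrow> real"
  assumes "continuous_on UNIV u" "compact K" "\<And>x. x \<notin> K \<Longrightarrow> u x = 0"
  shows "integrable lborel u"
proof -
  have "integrable lborel (\<lambda>x. indicator K x *\<^sub>R u x)"
    using borel_integrable_compact assms(1,2) continuous_on_subset by blast
  moreover have "(\<lambda>x. indicator K x *\<^sub>R u x) = u"
    by (auto simp: fun_eq_iff indicator_def intro: assms(3))
  ultimately show ?thesis by simp
qed

text \<open>By translation invariance of Lebesgue measure every difference quotient of
  \<open>u\<close> has integral zero; dominated convergence carries this over to the derivative. Any
  direction \<open>v\<close> is treated at once, without iterated integrals.\<close>

lemma integral_partial_derivative_zero: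
  fixes u :: "'a::euclidean_space \<Rightarrow> real"
  assumes u: "Ck_on 1 UNIV u" and K: "compact K" "\<And>x. x \<notin> K \<Longrightarrow> u x = 0"
  shows "integrable lborel (\<lambda>x. frechet_derivative u (at x) v)"
    and "(LINT x|lborel. frechet_derivative u (at x) v) = 0"
proof -
  let ?u' = "\<lambda>x. frechet_derivative u (at x) v"
  have du: "(u has_derivative frechet_derivative u (at x)) (at x)" for x
    using u Ck_on_has_derivative[of 0 UNIV u x] by simp
  have line: "((\<lambda>t. u (x + t *\<^sub>R v)) has_real_derivative ?u' (x + t *\<^sub>R v)) (at t)" for x t
  proof -
    have "((\<lambda>t. u (x + t *\<^sub>R v)) has_derivative (\<lambda>r. frechet_derivative u (at (x + t *\<^sub>R v)) (r *\<^sub>R v))) (at t)"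
      by (rule has_derivative_compose[where g=u and f="\<lambda>t. x + t *\<^sub>R v"])
        (auto intro!: derivative_eq_intros du)
    moreover have "frechet_derivative u (at (x + t *\<^sub>R v)) (r *\<^sub>R v) = ?u' (x + t *\<^sub>R v) * r" for r
      using linear_cmul[OF has_derivative_linear[OF du]] by simp
    ultimately show ?thesis by (simp add: has_field_derivative_def)
  qed
  have cu': "continuous_on UNIV ?u'"
    using u by (simp add: Ck_on.simps)
  have cu: "continuous_on UNIV u" using u by (rule Ck_on_imp_continuous)
  have u'0: "?u' x = 0" if "x \<notin> K" for x
    using frechet_cong_open[of "- K" x u "\<lambda>_. 0"] K(2) that compact_imp_closed[OF K(1)] by (simp add: open_closed)
  obtain C where C: "\<And>x. \<bar>?u' x\<bar> \<le> C" "C \<ge> 0"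
  proof -
    have "compact (?u' ` K)" using K(1) cu' continuous_on_subset by (intro compact_continuous_image) auto
    then obtain C where "\<forall>x\<in>K. \<bar>?u' x\<bar> \<le> C"
      using compact_imp_bounded[of "?u' ` K"] by (auto simp: bounded_iff)
    then have "\<bar>?u' x\<bar> \<le> \<bar>C\<bar>" for x using u'0[of x] by (cases "x \<in> K") auto
    then show ?thesis using that[of "\<bar>C\<bar>"] by simp
  qed
  obtain R where R: "\<And>x. x \<in> K \<Longrightarrow> norm x \<le> R"
    using compact_imp_bounded[OF K(1)] by (auto simp: bounded_iff)
  \<comment> \<open>Increments of at most 1 keep the supports of all shifted functions within the
    ball of radius \<open>R + norm v\<close>, so that \<open>w\<close> is a common integrable bound;
    inside the ball the mean value theorem supplies the constant \<open>C\<close>.\<close>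
  define h where "h n = 1 / real (Suc n)" for n
  have h: "0 < h n" "h n \<le> 1" for n by (auto simp: h_def)
  define s where "s n x = (u (x + h n *\<^sub>R v) - u x) / h n" for n x
  define w where "w x = C * indicator (cball (0::'a) (R + norm v)) x" for x
  have int_u: "integrable lborel u" by (rule integrable_compact_support[OF cu K])
  have trans: "integrable lborel (\<lambda>x. u (x + c))" "(LINT x|lborel. u (x + c)) = (LINT x|lborel. u x)" for c
  proof -
    have "integrable (distr lborel borel ((+) c)) u" using int_u by (simp add: lborel_distr_plus)
    then show "integrable lborel (\<lambda>x. u (x + c))"
      by (subst (asm) integrable_distr_eq) (use int_u in \<open>auto simp: add.commute\<close>)
    have "(LINT x|distr lborel borel ((+) c). u x) = (LINT x|lborel. u (x + c))"
      by (subst integral_distr) (use int_u in \<open>auto simp: add.commute\<close>)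
    then show "(LINT x|lborel. u (x + c)) = (LINT x|lborel. u x)" by (simp add: lborel_distr_plus)
  qed
  have s0: "(LINT x|lborel. s n x) = 0" for n
    unfolding s_def using trans int_u by simp
  have "(\<lambda>n. LINT x|lborel. s n x) \<longlonglongrightarrow> (LINT x|lborel. ?u' x)"
  proof (rule integral_dominated_convergence[where w=w])
    show "?u' \<in> borel_measurable lborel" using cu' by (simp add: borel_measurable_continuous_onI)
    show "s n \<in> borel_measurable lborel" for n
      unfolding s_def using trans(1)[of "h n *\<^sub>R v"] int_u by (intro borel_measurable_divide borel_measurable_diff) auto
    show "integrable lborel w"
      unfolding w_def by (intro integrable_mult_right integrable_real_indicator) (use emeasure_lborel_cball_finite[of "0::'a"] in auto)
    have "(\<lambda>n. s n x) \<longlonglongrightarrow> ?u' x" for x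
    proof -
      have "((\<lambda>t. u (x + t *\<^sub>R v)) has_real_derivative ?u' x) (at 0)"
        using line[of x 0] by simp
      then have "((\<lambda>t. (u (x + t *\<^sub>R v) - u x) / t) \<longlongrightarrow> ?u' x) (at 0)"
        by (simp add: DERIV_def)
      moreover have "filterlim h (at 0) sequentially"
        unfolding h_def 
        using LIMSEQ_Suc[OF lim_inverse_n'] by (intro filterlim_atI) auto
      ultimately show ?thesis unfolding s_def by (rule filterlim_compose)
    qed
    then show "AE x in lborel. (\<lambda>n. s n x) \<longlonglongrightarrow> ?u' x" by simp
    have "norm (s n x) \<le> w x" for n x
    proof (cases "x \<in> cball 0 (R + norm v)")
      case True
      have "\<exists>z. 0 < z \<and> z < h n \<and> u (x + h n *\<^sub>R v) - u (x + 0 *\<^sub>R v) = (h n - 0) * ?u' (x + z *\<^sub>R v)"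
        by (rule MVT2[OF h(1)]) (rule line)
      then obtain z where "u (x + h n *\<^sub>R v) - u x = h n * ?u' (x + z *\<^sub>R v)" by auto
      then have "s n x = ?u' (x + z *\<^sub>R v)" using h(1)[of n] by (simp add: s_def)
      then show ?thesis using C True by (simp add: w_def)
    next
      case False
      have "norm (h n *\<^sub>R v) \<le> norm v" using h[of n] by (simp add: mult_left_le_one_le)
      then have "norm x \<le> norm (x + h n *\<^sub>R v) + norm v"
        using norm_triangle_ineq4[of "x + h n *\<^sub>R v" "h n *\<^sub>R v"] by simp
      moreover have "0 \<le> norm v" by simp
      ultimately have "x \<notin> K" "x + h n *\<^sub>R v \<notin> K" using False R[of x] R[of "x + h n *\<^sub>R v"] unfolding mem_cball dist_0_norm by linarith+
      then show ?thesis using K(2) C(2) by (simp add: s_def w_def)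
    qed
    then show "AE x in lborel. norm (s n x) \<le> w x" for n by simp
  qed
  then show "(LINT x|lborel. ?u' x) = 0" using s0 by (simp add: LIMSEQ_const_iff)
  show "integrable lborel ?u'" by (rule integrable_compact_support[OF cu' K(1) u'0])
qed

section \<open>Functions on a closed manifold\<close>

lemma Ck_on_compose_affine:
  fixes F :: "'b::euclidean_space \<Rightarrow> real" and L :: "'a::real_normed_vector \<Rightarrow> 'b"
  assumes "open S" "open T" "bounded_linear L" "\<And>x. x \<in> S \<Longrightarrow> a + L x \<in> T" "Ck_on k T F"
  shows "Ck_on k S (\<lambda>x. F (a + L x))"
proof (rule Ck_on_compose[OF assms(1,2) _ assms(5)])
  fix b :: 'b
  have "bounded_linear (\<lambda>x. L x \<bullet> b)"
    using bounded_linear_compose[OF bounded_linear_inner_left assms(3)] .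
  then have "Ck_on k S (\<lambda>x. a \<bullet> b + L x \<bullet> b)"
    by (intro Ck_on_add Ck_on_const Ck_on_self_linear assms(1))
  then show "Ck_on k S (\<lambda>x. (a + L x) \<bullet> b)" by (simp add: inner_add_left)
qed (use assms(4) in auto)

lemma Ck_on_slice_left:
  fixes F :: "'a::euclidean_space \<Rightarrow> 'b::euclidean_space \<Rightarrow> real"
  assumes "open I" "open S" "x \<in> S" "Ck_on k (I \<times> S) (\<lambda>(t, x). F t x)"
  shows "Ck_on k I (\<lambda>t. F t x)"
proof -
  have "Ck_on k I (\<lambda>t. (\<lambda>(t, x). F t x) ((0, x) + (t, 0)))"
    by (rule Ck_on_compose_affine[where T="I \<times> S"]) (use assms in \<open>auto intro: open_Times bounded_linear_Pair bounded_linear_ident bounded_linear_zero\<close>)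
  then show ?thesis by simp
qed

lemma Ck_on_slice_right:
  fixes F :: "'a::euclidean_space \<Rightarrow> 'b::euclidean_space \<Rightarrow> real"
  assumes "open I" "open S" "t \<in> I" "Ck_on k (I \<times> S) (\<lambda>(t, x). F t x)"
  shows "Ck_on k S (\<lambda>x. F t x)"
proof -
  have "Ck_on k S (\<lambda>x. (\<lambda>(t, x). F t x) ((t, 0) + (0, x)))"
    by (rule Ck_on_compose_affine[where T="I \<times> S"]) (use assms in \<open>auto intro: open_Times bounded_linear_Pair bounded_linear_ident bounded_linear_zero\<close>)
  then show ?thesis by simp
qed

lemma Ck_on_extend_right:
  fixes F :: "'b::euclidean_space \<Rightarrow> real" and I :: "'a::euclidean_space set"
  assumes "open I" "open S" "Ck_on k S F"
  shows "Ck_on k (I \<times> S) (\<lambda>(t, x). F x)"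
proof -
  have "Ck_on k (I \<times> S) (\<lambda>z. F (0 + snd z))"
    by (rule Ck_on_compose_affine[where T=S]) (use assms in \<open>auto intro: open_Times bounded_linear_snd\<close>)
  then show ?thesis by (simp add: case_prod_unfold)
qed

lemma Ck_on_extend_left:
  fixes F :: "'a::euclidean_space \<Rightarrow> real" and S :: "'b::euclidean_space set"
  assumes "open I" "open S" "Ck_on k I F"
  shows "Ck_on k (I \<times> S) (\<lambda>(t, x). F t)"
proof -
  have "Ck_on k (I \<times> S) (\<lambda>z. F (0 + fst z))"
    by (rule Ck_on_compose_affine[where T=I]) (use assms in \<open>auto intro: open_Times bounded_linear_fst\<close>)
  then show ?thesis by (simp add: case_prod_unfold)
qed

locale closed_manifold =
  fixes M :: "('m::t2_space, 'n::finite) riem_mfd"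
  assumes closed: "closed_riemannian_manifold M"
begin

lemma compact_manifold: "compact (UNIV :: 'm set)"
  using closed by (simp add: closed_riemannian_manifold_def)

lemma atlas: "smooth_atlas (atlas M)"
  using closed by (simp add: closed_riemannian_manifold_def)

lemma obtain_chart: obtains c where "c \<in> atlas M" "p \<in> fst c"
  using atlas unfolding smooth_atlas_def by blast

lemma chart_at: "chart_at M p \<in> atlas M" "p \<in> fst (chart_at M p)"
proof -
  have "chart_at M p \<in> atlas M \<and> p \<in> fst (chart_at M p)"
    unfolding chart_at_def by (rule someI_ex) (use obtain_chart in blast)
  then show "chart_at M p \<in> atlas M" "p \<in> fst (chart_at M p)" by auto
qed

lemma open_chart [simp]: "c \<in> atlas M \<Longrightarrow> open (fst c)" "c \<in> atlas M \<Longrightarrow> open (snd c ` fst c)"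
  using atlas unfolding smooth_atlas_def by auto

lemma chart_homeomorphism: "c \<in> atlas M \<Longrightarrow> homeomorphism (fst c) (snd c ` fst c) (snd c) (chart_inv c)"
  using atlas unfolding smooth_atlas_def by auto

lemma chart_inv_left [simp]: "c \<in> atlas M \<Longrightarrow> p \<in> fst c \<Longrightarrow> chart_inv c (snd c p) = p"
  using chart_homeomorphism homeomorphism_apply1 by blast

lemma chart_inv_right: "c \<in> atlas M \<Longrightarrow> x \<in> snd c ` fst c \<Longrightarrow> snd c (chart_inv c x) = x"
  using chart_homeomorphism homeomorphism_apply2 by blast

lemma chart_inv_in: "c \<in> atlas M \<Longrightarrow> x \<in> snd c ` fst c \<Longrightarrow> chart_inv c x \<in> fst c"
  by auto

lemma continuous_on_chart: "c \<in> atlas M \<Longrightarrow> continuous_on (fst c) (snd c)"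
  using chart_homeomorphism homeomorphism_cont1 by blast

lemma continuous_on_chart_inv: "c \<in> atlas M \<Longrightarrow> continuous_on (snd c ` fst c) (chart_inv c)"
  using chart_homeomorphism homeomorphism_cont2 by blast

lemma open_chart_image:
  assumes "c \<in> atlas M" "open V" "V \<subseteq> fst c"
  shows "open (snd c ` V)"
proof -
  have "openin (top_of_set (snd c ` fst c)) (snd c ` V)"
    using homeomorphism_imp_open_map[OF chart_homeomorphism[OF assms(1)]] assms open_subset by blast
  then show ?thesis using open_chart(2)[OF assms(1)] openin_open_trans by blast
qed

lemma transition_smooth:
  assumes "c \<in> atlas M" "d \<in> atlas M"
  shows "Ck_on k (snd c ` (fst c \<inter> fst d)) (\<lambda>x. snd d (chart_inv c x) $ i)"
proof -
  have o: "open (snd c ` (fst c \<inter> fst d))"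
    using assms by (intro open_chart_image) auto
  have "Ck_on k (snd c ` (fst c \<inter> fst d)) (snd d \<circ> chart_inv c)"
    using atlas assms unfolding smooth_atlas_def smooth_on_def by blast
  then show ?thesis
    using Ck_on_bounded_linear[OF o bounded_linear_vec_nth[of i]] by (simp add: comp_def)
qed

text \<open>The new coordinate expression is the old one composed with the transition map. This lets
  regularity be checked in whichever chart is convenient.\<close>

lemma Ck_on_transition:
  fixes f :: "'m \<Rightarrow> real"
  assumes cd: "c \<in> atlas M" "d \<in> atlas M" and V: "open V" "V \<subseteq> fst c \<inter> fst d"
    and f: "Ck_on k (snd d ` V) (\<lambda>x. f (chart_inv d x))"
  shows "Ck_on k (snd c ` V) (\<lambda>x. f (chart_inv c x))"
proof -
  have C: "Ck_on k (snd c ` V) (\<lambda>x. (\<lambda>x. f (chart_inv d x)) (snd d (chart_inv c x)))"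
  proof (rule Ck_on_compose[where T="snd d ` V"])
    show "open (snd c ` V)" "open (snd d ` V)"
      using cd V by (auto intro!: open_chart_image)
    have "chart_inv c (snd c p) = p" if "p \<in> V" for p
      using V(2) that cd(1) by auto
    then show "(\<lambda>x. snd d (chart_inv c x)) ` snd c ` V \<subseteq> snd d ` V" by auto
    fix b :: "real^'n" assume "b \<in> Basis"
    then obtain i where "b = axis i 1" by (auto simp: Basis_vec_def)
    then show "Ck_on k (snd c ` V) (\<lambda>x. snd d (chart_inv c x) \<bullet> b)"
      using Ck_on_subset[OF transition_smooth[OF cd, of k i] image_mono[OF V(2)]]
      by (simp add: inner_axis)
  qed (rule f)
  have o: "open (snd c ` V)" using cd V by (auto intro!: open_chart_image)
  have eq: "f (chart_inv d (snd d (chart_inv c x))) = f (chart_inv c x)" if x: "x \<in> snd c ` V" for x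
  proof -
    obtain p where "x = snd c p" "p \<in> V" using x by blast
    moreover have "p \<in> fst c" "p \<in> fst d" using V(2) \<open>p \<in> V\<close> by auto
    ultimately show ?thesis using cd by simp
  qed
  show ?thesis by (rule Ck_on_cong[OF o eq C])
qed

text \<open>A finite order of differentiability is kept track of because the bump functions are only
  \<open>C\<^sup>1\<close>.\<close>

definition Ck_fun :: "nat \<Rightarrow> ('m \<Rightarrow> real) \<Rightarrow> bool" where
  "Ck_fun k f \<longleftrightarrow> (\<forall>c\<in>atlas M. Ck_on k (snd c ` fst c) (\<lambda>x. f (chart_inv c x)))"

lemma smooth_fun_iff: "smooth_fun M f \<longleftrightarrow> (\<forall>k. Ck_fun k f)"
  by (auto simp: smooth_fun_def smooth_on_def Ck_fun_def comp_def)

lemma Ck_funI: "(\<And>c. c \<in> atlas M \<Longrightarrow> Ck_on k (snd c ` fst c) (\<lambda>x. f (chart_inv c x))) \<Longrightarrow> Ck_fun k f"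
  by (simp add: Ck_fun_def)

lemma Ck_funD: "Ck_fun k f \<Longrightarrow> c \<in> atlas M \<Longrightarrow> Ck_on k (snd c ` fst c) (\<lambda>x. f (chart_inv c x))"
  by (simp add: Ck_fun_def)

lemma Ck_fun_smooth: "smooth_fun M f \<Longrightarrow> Ck_fun k f"
  by (simp add: smooth_fun_iff)

lemma Ck_fun_le: "Ck_fun m f \<Longrightarrow> k \<le> m \<Longrightarrow> Ck_fun k f"
  unfolding Ck_fun_def using Ck_on_le by blast

lemma continuous_on_chartwise:
  fixes f :: "'m \<Rightarrow> real"
  assumes "c \<in> atlas M" "continuous_on (snd c ` fst c) (\<lambda>x. f (chart_inv c x))"
  shows "continuous_on (fst c) f"
proof -
  have "continuous_on (fst c) (\<lambda>p. f (chart_inv c (snd c p)))"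
    using continuous_on_compose2[OF assms(2) continuous_on_chart[OF assms(1)]] by blast
  then show ?thesis
    by (rule continuous_on_cong[THEN iffD1, OF refl, rotated]) (simp add: assms(1))
qed

lemma continuous_onI_charts:
  fixes f :: "'m \<Rightarrow> real"
  assumes "\<And>c. c \<in> atlas M \<Longrightarrow> continuous_on (fst c) f"
  shows "continuous_on UNIV f"
proof -
  have "isCont f p" for p
    using assms[OF chart_at(1)[of p]] chart_at(2)[of p] continuous_on_eq_continuous_at[OF open_chart(1)[OF chart_at(1)]]
    by auto
  then show ?thesis by (simp add: continuous_at_imp_continuous_on)
qed

lemma Ck_fun_0_iff: "Ck_fun 0 f \<longleftrightarrow> continuous_on UNIV f"
proof
  show "Ck_fun 0 f \<Longrightarrow> continuous_on UNIV f"
    by (auto simp: Ck_fun_def intro!: continuous_onI_charts continuous_on_chartwise)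
  show "continuous_on UNIV f \<Longrightarrow> Ck_fun 0 f"
    by (auto simp: Ck_fun_def intro!: continuous_on_compose2[of UNIV f] continuous_on_chart_inv)
qed

lemma Ck_fun_continuous: "Ck_fun k f \<Longrightarrow> continuous_on UNIV f"
  using Ck_fun_le[of k f 0] Ck_fun_0_iff by simp

lemma Ck_fun_const [simp]: "Ck_fun k (\<lambda>_. c)"
  by (simp add: Ck_fun_def)

lemma Ck_fun_add: "Ck_fun k f \<Longrightarrow> Ck_fun k g \<Longrightarrow> Ck_fun k (\<lambda>p. f p + g p)"
  by (simp add: Ck_fun_def Ck_on_add)

lemma Ck_fun_diff: "Ck_fun k f \<Longrightarrow> Ck_fun k g \<Longrightarrow> Ck_fun k (\<lambda>p. f p - g p)"
  by (simp add: Ck_fun_def Ck_on_diff)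

lemma Ck_fun_mult: "Ck_fun k f \<Longrightarrow> Ck_fun k g \<Longrightarrow> Ck_fun k (\<lambda>p. f p * g p)"
  by (simp add: Ck_fun_def Ck_on_mult)

lemma Ck_fun_sum: "(\<And>i. i \<in> I \<Longrightarrow> Ck_fun k (f i)) \<Longrightarrow> Ck_fun k (\<lambda>p. \<Sum>i\<in>I. f i p)"
  by (simp add: Ck_fun_def Ck_on_sum)

lemma Ck_fun_inverse: "Ck_fun k f \<Longrightarrow> (\<And>p. f p \<noteq> 0) \<Longrightarrow> Ck_fun k (\<lambda>p. inverse (f p))"
  by (simp add: Ck_fun_def Ck_on_inverse)

lemma smooth_fun_const [simp]: "smooth_fun M (\<lambda>_. c)"
  by (simp add: smooth_fun_iff)

lemma smooth_fun_add: "smooth_fun M f \<Longrightarrow> smooth_fun M g \<Longrightarrow> smooth_fun M (\<lambda>p. f p + g p)"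
  by (simp add: smooth_fun_iff Ck_fun_add)

lemma smooth_fun_diff: "smooth_fun M f \<Longrightarrow> smooth_fun M g \<Longrightarrow> smooth_fun M (\<lambda>p. f p - g p)"
  by (simp add: smooth_fun_iff Ck_fun_diff)

lemma smooth_fun_mult: "smooth_fun M f \<Longrightarrow> smooth_fun M g \<Longrightarrow> smooth_fun M (\<lambda>p. f p * g p)"
  by (simp add: smooth_fun_iff Ck_fun_mult)

text \<open>Differentiability at a point is tested in a single chart; the choice does not matter.\<close>

definition diff_at :: "('m, 'n) chart \<Rightarrow> ('m \<Rightarrow> real) \<Rightarrow> 'm \<Rightarrow> bool" where
  "diff_at c f p \<longleftrightarrow> (\<lambda>x. f (chart_inv c x)) differentiable (at (snd c p))"

lemma diff_at_Ck:
  assumes "Ck_on (Suc k) (snd c ` V) (\<lambda>x. f (chart_inv c x))" "p \<in> V"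
  shows "diff_at c f p"
  using assms by (auto simp: diff_at_def Ck_on.simps)

lemma diff_at_Ck_fun: "Ck_fun (Suc k) f \<Longrightarrow> c \<in> atlas M \<Longrightarrow> p \<in> fst c \<Longrightarrow> diff_at c f p"
  by (rule diff_at_Ck[OF Ck_funD])

lemma pd_chart_inv:
  "c \<in> atlas M \<Longrightarrow> x \<in> snd c ` fst c \<Longrightarrow>
    pd c i f (chart_inv c x) = frechet_derivative (\<lambda>x. f (chart_inv c x)) (at x) (axis i 1)"
  by (simp add: pd_def chart_inv_right comp_def)

lemma pd_cong:
  assumes "c \<in> atlas M" "open V" "p \<in> V" "p \<in> fst c" "\<And>q. q \<in> V \<Longrightarrow> f q = g q"
  shows "pd c i f p = pd c i g p"
proof -
  have "open (snd c ` (V \<inter> fst c))" using assms by (intro open_chart_image) auto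
  then have "frechet_derivative (f \<circ> chart_inv c) (at (snd c p)) = frechet_derivative (g \<circ> chart_inv c) (at (snd c p))"
    by (rule frechet_cong_open) (use assms in auto)
  then show ?thesis by (simp add: pd_def)
qed

lemma frechet_pd:
  assumes "diff_at c f p"
  shows "frechet_derivative (\<lambda>x. f (chart_inv c x)) (at (snd c p)) v = (\<Sum>i\<in>UNIV. v $ i * pd c i f p)"
proof -
  let ?D = "frechet_derivative (\<lambda>x. f (chart_inv c x)) (at (snd c p))"
  have lin: "linear ?D"
    using assms linear_frechet_derivative by (auto simp: diff_at_def)
  have "?D v = ?D (\<Sum>i\<in>UNIV. v $ i *\<^sub>R axis i 1)"
    using basis_expansion[of v] by (simp add: scalar_mult_eq_scaleR)
  then show ?thesis
    using lin by (simp add: linear_sum linear_cmul pd_def comp_def)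
qed

lemma pd_const [simp]: "pd c i (\<lambda>_. a) p = 0"
  by (simp add: pd_def comp_def)

lemma pd_add:
  assumes "diff_at c f p" "diff_at c g p"
  shows "pd c i (\<lambda>q. f q + g q) p = pd c i f p + pd c i g p"
  using frechet_derivative_at[OF has_derivative_add[OF
      frechet_derivative_works[THEN iffD1, OF assms(1)[unfolded diff_at_def]]
      frechet_derivative_works[THEN iffD1, OF assms(2)[unfolded diff_at_def]]], symmetric]
  by (simp add: pd_def comp_def)

lemma pd_mult:
  assumes "diff_at c f p" "diff_at c g p" "c \<in> atlas M" "p \<in> fst c"
  shows "pd c i (\<lambda>q. f q * g q) p = f p * pd c i g p + pd c i f p * g p"
  using frechet_derivative_at[OF has_derivative_mult[OF
      frechet_derivative_works[THEN iffD1, OF assms(1)[unfolded diff_at_def]]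
      frechet_derivative_works[THEN iffD1, OF assms(2)[unfolded diff_at_def]]], symmetric] assms(3,4)
  by (simp add: pd_def comp_def)

lemma diff_at_const [simp]: "diff_at c (\<lambda>_. a) p"
  by (simp add: diff_at_def)

lemma pd_chain:
  assumes cd: "c \<in> atlas M" "d \<in> atlas M" and p: "p \<in> fst c" "p \<in> fst d" and f: "diff_at d f p"
  shows "diff_at c f p"
    and "pd c i f p = (\<Sum>k\<in>UNIV. pd c i (\<lambda>q. snd d q $ k) p * pd d k f p)"
proof -
  let ?x = "snd c p"
  let ?T = "\<lambda>x. snd d (chart_inv c x)"
  let ?T' = "\<lambda>v. \<chi> k. frechet_derivative (\<lambda>x. ?T x $ k) (at ?x) v"
  let ?F = "\<lambda>x. f (chart_inv d x)"
  have "((\<lambda>x. ?T x $ k) has_derivative frechet_derivative (\<lambda>x. ?T x $ k) (at ?x)) (at ?x)" for k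
    using Ck_on_has_derivative[OF transition_smooth[OF cd]] p by blast
  then have T: "(?T has_derivative ?T') (at ?x)"
    by (subst has_derivative_componentwise_within) (auto simp: Basis_vec_def inner_axis)
  have "(?F has_derivative frechet_derivative ?F (at (?T ?x))) (at (?T ?x))"
    using f p cd by (simp add: diff_at_def frechet_derivative_works[symmetric])
  from has_derivative_compose[OF T this]
  have "((\<lambda>x. ?F (?T x)) has_derivative (\<lambda>v. frechet_derivative ?F (at (?T ?x)) (?T' v))) (at ?x)" .
  then have D: "((\<lambda>x. f (chart_inv c x)) has_derivative (\<lambda>v. frechet_derivative ?F (at (?T ?x)) (?T' v))) (at ?x)"
    by (rule has_derivative_transform_within_open[of _ _ _ _ "snd c ` (fst c \<inter> fst d)"])
      (use cd p in \<open>auto intro!: open_chart_image\<close>)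
  then show "diff_at c f p" by (auto simp: diff_at_def differentiable_def)
  have "pd c i f p = frechet_derivative ?F (at (?T ?x)) (?T' (axis i 1))"
    by (simp add: pd_def comp_def frechet_derivative_at[OF D, symmetric])
  also have "\<dots> = (\<Sum>k\<in>UNIV. ?T' (axis i 1) $ k * pd d k f p)"
    using frechet_pd[OF f] cd p by simp
  finally show "pd c i f p = (\<Sum>k\<in>UNIV. pd c i (\<lambda>q. snd d q $ k) p * pd d k f p)"
    by (simp add: pd_def comp_def)
qed

end

section \<open>The metric tensor and the gradient\<close>

context closed_manifold
begin

lemma metric_Ck:
  assumes "c \<in> atlas M"
  shows "Ck_on k (snd c ` fst c) (\<lambda>x. metric M c (chart_inv c x) $ i $ j)"
proof -
  have "Ck_on k (snd c ` fst c) (metric M c \<circ> chart_inv c)"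
    using closed assms unfolding closed_riemannian_manifold_def riemannian_metric_def smooth_on_def by blast
  from Ck_on_bounded_linear[OF open_chart(2)[OF assms]
      bounded_linear_compose[OF bounded_linear_vec_nth[of j] bounded_linear_vec_nth[of i]] this]
  show ?thesis by (simp add: comp_def)
qed

lemma metric_transpose: "c \<in> atlas M \<Longrightarrow> p \<in> fst c \<Longrightarrow> transpose (metric M c p) = metric M c p"
  using closed unfolding closed_riemannian_manifold_def riemannian_metric_def by blast

lemma metric_sym:
  assumes "c \<in> atlas M" "p \<in> fst c"
  shows "metric M c p $ i $ j = metric M c p $ j $ i"
  using arg_cong[OF metric_transpose[OF assms], of "\<lambda>A. A $ j $ i"] by (simp add: transpose_def)

lemma metric_pos: "c \<in> atlas M \<Longrightarrow> p \<in> fst c \<Longrightarrow> v \<noteq> 0 \<Longrightarrow> 0 < v \<bullet> (metric M c p *v v)"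
  using closed unfolding closed_riemannian_manifold_def riemannian_metric_def by blast

lemma det_metric_pos: "c \<in> atlas M \<Longrightarrow> p \<in> fst c \<Longrightarrow> 0 < det (metric M c p)"
  by (intro det_pos_of_pos_def metric_pos)

lemma det_metric_nz: "c \<in> atlas M \<Longrightarrow> p \<in> fst c \<Longrightarrow> det (metric M c p) \<noteq> 0"
  using det_metric_pos[of c p] by simp

lemma metric_ginv:
  assumes "c \<in> atlas M" "p \<in> fst c"
  shows "metric M c p *v (ginv M c p *v b) = b" "ginv M c p *v (metric M c p *v b) = b"
  using det_metric_nz[OF assms] by (simp_all add: ginv_def matrix_vector_mul_assoc matrix_inv_mult)

lemma ginv_sym: "c \<in> atlas M \<Longrightarrow> p \<in> fst c \<Longrightarrow> ginv M c p $ i $ j = ginv M c p $ j $ i"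
  unfolding ginv_def by (intro transpose_matrix_inv metric_transpose det_metric_nz)

lemma ginv_Ck:
  assumes "c \<in> atlas M"
  shows "Ck_on k (snd c ` fst c) (\<lambda>x. ginv M c (chart_inv c x) $ i $ j)"
  unfolding ginv_def
proof (rule Ck_on_matrix_inv[OF open_chart(2)[OF assms] metric_Ck[OF assms]])
  fix x assume "x \<in> snd c ` fst c"
  then show "det (metric M c (chart_inv c x)) \<noteq> 0"
    by (rule det_metric_nz[OF assms chart_inv_in[OF assms]])
qed

lemma metric_transform:
  assumes "c \<in> atlas M" "d \<in> atlas M" "p \<in> fst c" "p \<in> fst d"
  shows "metric M c p $ i $ j = (\<Sum>k\<in>UNIV. \<Sum>l\<in>UNIV.
    pd c i (\<lambda>q. snd d q $ k) p * pd c j (\<lambda>q. snd d q $ l) p * metric M d p $ k $ l)"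
  using closed assms unfolding closed_riemannian_manifold_def riemannian_metric_def by blast

text \<open>\<open>grad_inner\<close> uses the chart selected by \<open>chart_at\<close>, which may
  jump from point to point, so its regularity cannot be seen directly. Here the chart is a
  parameter; the two agree once invariance under a change of charts is known.\<close>

definition ginner :: "('m, 'n) chart \<Rightarrow> ('m \<Rightarrow> real) \<Rightarrow> ('m \<Rightarrow> real) \<Rightarrow> 'm \<Rightarrow> real" where
  "ginner c f g p = (\<Sum>i\<in>UNIV. \<Sum>j\<in>UNIV. ginv M c p $ i $ j * pd c i f p * pd c j g p)"

lemma grad_inner_eq_ginner: "grad_inner M f g p = ginner (chart_at M p) f g p"
  by (simp add: grad_inner_def ginner_def Let_def)

lemma ginner_inner: "ginner c f g p = (\<chi> i. pd c i f p) \<bullet> (ginv M c p *v (\<chi> i. pd c i g p))"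
  by (simp add: ginner_def inner_vec_def matrix_vector_mult_def sum_distrib_left mult_ac)

text \<open>With \<open>J\<close> the Jacobian of the transition map, differentials transform by the
  transpose of \<open>J\<close> and the metric by \<open>g\<^sub>c = J\<^sup>T g\<^sub>d J\<close>.
  Consequently \<open>J\<close> maps the gradient vector \<open>w\<close> of \<open>g\<close>
  computed in \<open>c\<close> to the one computed in \<open>d\<close>, and pairing it with the
  differential of \<open>f\<close> gives the same number in both charts.\<close>

lemma ginner_invariant:
  assumes cd: "c \<in> atlas M" "d \<in> atlas M" and p: "p \<in> fst c" "p \<in> fst d"
    and f: "diff_at d f p" and g: "diff_at d g p"
  shows "ginner c f g p = ginner d f g p"
proof -
  define J where "J = (\<chi> k i. pd c i (\<lambda>q. snd d q $ k) p)"
  define w where "w = ginv M c p *v (\<chi> i. pd c i g p)"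
  have grad: "(\<chi> i. pd c i h p) = transpose J *v (\<chi> k. pd d k h p)" if "diff_at d h p" for h
    by (simp add: vec_eq_iff pd_chain(2)[OF cd p that] J_def transpose_def matrix_vector_mult_def del: transpose_matrix_vector)
  have gc: "metric M c p = transpose J ** (metric M d p ** J)"
  proof -
    have "metric M c p $ i $ j = (transpose J ** (metric M d p ** J)) $ i $ j" for i j
      unfolding metric_transform[OF cd p] matrix_matrix_mult_def transpose_def J_def
      by (simp add: sum_distrib_left mult_ac)
    then show ?thesis by (simp add: vec_eq_iff)
  qed
  \<comment> \<open>Invertibility is read off the transformation law: the positive determinant of
    the metric in \<open>c\<close> has \<open>det (transpose J)\<close> as a factor.\<close>
  have nz: "det (transpose J) \<noteq> 0"
    using det_metric_pos[OF cd(1) p(1)] by (auto simp: gc det_mul)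
  have "transpose J *v (metric M d p *v (J *v w)) = metric M c p *v w"
    by (simp add: gc matrix_vector_mul_assoc matrix_mul_assoc del: transpose_matrix_vector)
  also have "\<dots> = transpose J *v (\<chi> i. pd d i g p)"
    unfolding w_def metric_ginv(1)[OF cd(1) p(1)] by (rule grad[OF g])
  finally have "matrix_inv (transpose J) *v (transpose J *v (metric M d p *v (J *v w)))
      = matrix_inv (transpose J) *v (transpose J *v (\<chi> i. pd d i g p))"
    by simp
  then have "metric M d p *v (J *v w) = (\<chi> i. pd d i g p)"
    unfolding matrix_vector_mul_assoc[of "matrix_inv (transpose J)"] matrix_inv_mult(2)[OF nz] by simp
  then have Jw: "J *v w = ginv M d p *v (\<chi> i. pd d i g p)"
    using metric_ginv(2)[OF cd(2) p(2), of "J *v w"] by simp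
  have "ginner c f g p = (transpose J *v (\<chi> k. pd d k f p)) \<bullet> w"
    by (simp only: ginner_inner w_def grad[OF f])
  also have "\<dots> = (\<chi> k. pd d k f p) \<bullet> (J *v w)"
    by (simp add: dot_lmul_matrix)
  finally show ?thesis by (simp only: Jw ginner_inner)
qed

lemma grad_inner_chart:
  assumes "c \<in> atlas M" "p \<in> fst c" "diff_at c f p" "diff_at c g p"
  shows "grad_inner M f g p = ginner c f g p"
  unfolding grad_inner_eq_ginner
  by (rule ginner_invariant[OF chart_at(1) assms(1) chart_at(2) assms(2-4)])

lemma grad_inner_commute: "grad_inner M f g p = grad_inner M g f p"
  unfolding grad_inner_eq_ginner ginner_def
  by (subst sum.swap, intro sum.cong refl) (simp add: ginv_sym[OF chart_at] mult_ac)

text \<open>In terms of the gradient vector \<open>?w\<close> the expression is the metric applied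
  to \<open>?w\<close> twice, so the inverse metric inherits positivity.\<close>

lemma ginner_pos: "c \<in> atlas M \<Longrightarrow> p \<in> fst c \<Longrightarrow> (\<exists>i. pd c i f p \<noteq> 0) \<Longrightarrow> 0 < ginner c f f p"
proof -
  assume c: "c \<in> atlas M" "p \<in> fst c" and nz: "\<exists>i. pd c i f p \<noteq> 0"
  let ?b = "(\<chi> i. pd c i f p)" and ?g = "metric M c p"
  let ?w = "ginv M c p *v ?b"
  have "?b \<noteq> 0" using nz by (auto simp: vec_eq_iff)
  then have "?w \<noteq> 0" using metric_ginv(1)[OF c, of ?b] by auto
  then have "0 < ?w \<bullet> (?g *v ?w)" by (rule metric_pos[OF c])
  then show "0 < ginner c f f p"
    unfolding metric_ginv(1)[OF c] ginner_inner by (simp add: inner_commute)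
qed

lemma ginner_nonneg: "c \<in> atlas M \<Longrightarrow> p \<in> fst c \<Longrightarrow> 0 \<le> ginner c f f p"
  using ginner_pos[of c p f] by (cases "\<exists>i. pd c i f p \<noteq> 0") (auto simp: ginner_def)

lemma grad_inner_nonneg: "0 \<le> grad_inner M f f p"
  by (simp add: grad_inner_eq_ginner ginner_nonneg chart_at)

lemma ginner_add:
  "diff_at c f p \<Longrightarrow> diff_at c f' p \<Longrightarrow> ginner c (\<lambda>q. f q + f' q) g p = ginner c f g p + ginner c f' g p"
  by (simp add: ginner_def pd_add algebra_simps sum.distrib)

lemma grad_inner_const [simp]: "grad_inner M (\<lambda>_. a) g p = 0"
  by (simp add: grad_inner_eq_ginner ginner_def)

lemma grad_inner_add:
  assumes "Ck_fun 1 f" "Ck_fun 1 f'"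
  shows "grad_inner M (\<lambda>q. f q + f' q) g p = grad_inner M f g p + grad_inner M f' g p"
  unfolding grad_inner_eq_ginner
  by (intro ginner_add diff_at_Ck_fun chart_at) (use assms in auto)

lemma grad_inner_sum:
  assumes "finite I" "\<And>i. i \<in> I \<Longrightarrow> Ck_fun 1 (f i)"
  shows "grad_inner M (\<lambda>q. \<Sum>i\<in>I. f i q) g p = (\<Sum>i\<in>I. grad_inner M (f i) g p)"
  using assms by (induction I) (simp_all add: grad_inner_add Ck_fun_sum)

lemma pd_Ck:
  assumes "c \<in> atlas M" "open V" "V \<subseteq> fst c" "Ck_on (Suc k) (snd c ` V) (\<lambda>x. f (chart_inv c x))"
  shows "Ck_on k (snd c ` V) (\<lambda>x. pd c i f (chart_inv c x))"
proof (rule Ck_on_cong)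
  show "open (snd c ` V)" using assms by (intro open_chart_image)
  show "Ck_on k (snd c ` V) (\<lambda>x. frechet_derivative (\<lambda>x. f (chart_inv c x)) (at x) (axis i 1))"
    by (rule Ck_on_derivative[OF assms(4)])
  fix x assume "x \<in> snd c ` V"
  then have "x \<in> snd c ` fst c" using assms(3) by blast
  then show "frechet_derivative (\<lambda>x. f (chart_inv c x)) (at x) (axis i 1) = pd c i f (chart_inv c x)"
    by (simp only: pd_chart_inv[OF assms(1)])
qed

section \<open>Curves of functions, jointly smooth in time and space\<close>

lemma pd_curve_Ck:
  fixes f :: "real \<Rightarrow> 'm \<Rightarrow> real"
  assumes c: "c \<in> atlas M" and "open I"
    and f: "Ck_on (Suc k) (I \<times> snd c ` fst c) (\<lambda>(t, x). f t (chart_inv c x))"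
  shows "Ck_on k (I \<times> snd c ` fst c) (\<lambda>(t, x). pd c i (f t) (chart_inv c x))"
proof (rule Ck_on_cong)
  let ?F = "\<lambda>(t, x). f t (chart_inv c x)"
  show "open (I \<times> snd c ` fst c)" using assms by (intro open_Times) auto
  \<comment> \<open>The spatial derivative at fixed time is the joint derivative in the direction
    \<open>(0, axis i 1)\<close>, so joint regularity drops by just one order.\<close>
  show "Ck_on k (I \<times> snd c ` fst c) (\<lambda>z. frechet_derivative ?F (at z) (0, axis i 1))"
    by (rule Ck_on_derivative[OF f])
  fix z assume "z \<in> I \<times> snd c ` fst c"
  then obtain t x where z: "z = (t, x)" "t \<in> I" "x \<in> snd c ` fst c" by auto
  have F: "(?F has_derivative frechet_derivative ?F (at (t, x))) (at (t, x))"
    using Ck_on_has_derivative[OF f] z by blast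
  have "((\<lambda>y. (t, y)) has_derivative (\<lambda>v. (0, v))) (at x)"
    by (auto intro!: derivative_eq_intros)
  from has_derivative_compose[OF this F]
  have "((\<lambda>y. f t (chart_inv c y)) has_derivative (\<lambda>v. frechet_derivative ?F (at (t, x)) (0, v))) (at x)"
    by simp
  from frechet_derivative_at[OF this]
  have "frechet_derivative ?F (at (t, x)) (0, axis i 1) = pd c i (f t) (chart_inv c x)"
    unfolding pd_chart_inv[OF c z(3)] by metis
  then show "frechet_derivative ?F (at z) (0, axis i 1) = (case z of (t, x) \<Rightarrow> pd c i (f t) (chart_inv c x))"
    using z by simp
qed

lemma smooth_curve_iff:
  "smooth_curve M I f \<longleftrightarrow> (\<forall>k. \<forall>c\<in>atlas M. Ck_on k (I \<times> snd c ` fst c) (\<lambda>(t, x). f t (chart_inv c x)))"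
  by (auto simp: smooth_curve_def smooth_on_def)

text \<open>In a chart the time derivative is the joint derivative in the direction
  \<open>(1, 0)\<close>, which is jointly smooth.\<close>

lemma smooth_curve_time_derivative:
  fixes f :: "real \<Rightarrow> 'm \<Rightarrow> real"
  assumes "open I" and f: "smooth_curve M I f"
  shows "smooth_curve M I (\<lambda>t p. deriv (\<lambda>s. f s p) t)"
    and "t \<in> I \<Longrightarrow> (\<lambda>s. f s p) differentiable (at t)"
proof -
  have *: "((\<lambda>s. f s (chart_inv c x)) has_real_derivative
      frechet_derivative (\<lambda>(t, x). f t (chart_inv c x)) (at (t, x)) (1, 0)) (at t)"
    if c: "c \<in> atlas M" and z: "t \<in> I" "x \<in> snd c ` fst c" for c t x
  proof -
    let ?F = "\<lambda>(t, x). f t (chart_inv c x)"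
    have F: "(?F has_derivative frechet_derivative ?F (at (t, x))) (at (t, x))"
      using Ck_on_has_derivative[of 0 "I \<times> snd c ` fst c" ?F] f c z by (auto simp: smooth_curve_iff)
    have "((\<lambda>s. (s, x)) has_derivative (\<lambda>v. (v, 0))) (at t)"
      by (auto intro!: derivative_eq_intros)
    from has_derivative_compose[OF this F]
    have "((\<lambda>s. f s (chart_inv c x)) has_derivative (\<lambda>v. frechet_derivative ?F (at (t, x)) (v, 0))) (at t)"
      by simp
    moreover have "(\<lambda>v. frechet_derivative ?F (at (t, x)) (v, 0)) = (*) (frechet_derivative ?F (at (t, x)) (1, 0))"
    proof
      fix v show "frechet_derivative ?F (at (t, x)) (v, 0) = frechet_derivative ?F (at (t, x)) (1, 0) * v"
        using linear_cmul[OF has_derivative_linear[OF F], of v "(1, 0)"] by (simp add: mult.commute)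
    qed
    ultimately show ?thesis unfolding has_field_derivative_def by (simp only:)
  qed
  show "smooth_curve M I (\<lambda>t p. deriv (\<lambda>s. f s p) t)"
    unfolding smooth_curve_iff
  proof (intro allI ballI)
    fix k c assume c: "c \<in> atlas M"
    let ?F = "\<lambda>(t, x). f t (chart_inv c x)"
    show "Ck_on k (I \<times> snd c ` fst c) (\<lambda>(t, x). deriv (\<lambda>s. f s (chart_inv c x)) t)"
    proof (rule Ck_on_cong)
      show "open (I \<times> snd c ` fst c)" using assms c by (intro open_Times) auto
      show "Ck_on k (I \<times> snd c ` fst c) (\<lambda>z. frechet_derivative ?F (at z) (1, 0))"
        by (rule Ck_on_derivative) (use f c in \<open>auto simp: smooth_curve_iff\<close>)
      fix z assume "z \<in> I \<times> snd c ` fst c"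
      then obtain t x where z: "z = (t, x)" "t \<in> I" "x \<in> snd c ` fst c" by blast
      show "frechet_derivative ?F (at z) (1, 0) = (case z of (t, x) \<Rightarrow> deriv (\<lambda>s. f s (chart_inv c x)) t)"
        unfolding z(1) prod.case DERIV_imp_deriv[OF *[OF c z(2,3)]] ..
    qed
  qed
  show "(\<lambda>s. f s p) differentiable (at t)" if "t \<in> I"
    using *[OF chart_at(1)[of p] that, of "snd (chart_at M p) p"] chart_at[of p]
    by (auto simp: real_differentiable_def)
qed

lemma smooth_fun_of_curve:
  assumes "open I" "t \<in> I" "smooth_curve M I f"
  shows "smooth_fun M (f t)"
  unfolding smooth_fun_iff
proof (intro allI Ck_funI)
  fix k c assume "c \<in> atlas M"
  then show "Ck_on k (snd c ` fst c) (\<lambda>x. f t (chart_inv c x))"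
    using Ck_on_slice_right[OF assms(1) open_chart(2) assms(2), of c k "\<lambda>t x. f t (chart_inv c x)"] assms(3)
    by (simp add: smooth_curve_iff)
qed

text \<open>Smoothness facts about single functions are later obtained from those about curves,
  applied to curves that are constant over all of time.\<close>

lemma smooth_curve_const:
  assumes "open I" "smooth_fun M f"
  shows "smooth_curve M I (\<lambda>t. f)"
  unfolding smooth_curve_iff
proof (intro allI ballI)
  fix k c assume c: "c \<in> atlas M"
  show "Ck_on k (I \<times> snd c ` fst c) (\<lambda>(t, x). f (chart_inv c x))"
    by (rule Ck_on_extend_right[OF assms(1) open_chart(2)[OF c]])
      (use assms c in \<open>auto simp: smooth_fun_iff Ck_fun_def\<close>)
qed

lemma smooth_curve_mult:
  assumes "open I" "smooth_curve M I f" "smooth_curve M I g"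
  shows "smooth_curve M I (\<lambda>t p. f t p * g t p)"
  using assms unfolding smooth_curve_iff
  by (intro allI ballI Ck_on_case_prod_mult open_Times open_chart) auto

lemma smooth_curve_add:
  assumes "open I" "smooth_curve M I f" "smooth_curve M I g"
  shows "smooth_curve M I (\<lambda>t p. f t p + g t p)"
  unfolding smooth_curve_iff
proof (intro allI ballI)
  fix k c assume "c \<in> atlas M"
  then show "Ck_on k (I \<times> snd c ` fst c) (\<lambda>(t, x). f t (chart_inv c x) + g t (chart_inv c x))"
    using Ck_on_add[of "I \<times> snd c ` fst c" k "\<lambda>(t, x). f t (chart_inv c x)" "\<lambda>(t, x). g t (chart_inv c x)"]
      assms open_Times[OF assms(1) open_chart(2)] by (simp add: smooth_curve_iff case_prod_unfold)
qed

lemma smooth_curve_time_fun: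
  fixes h :: "real \<Rightarrow> real"
  assumes "open I" "smooth_on I h"
  shows "smooth_curve M I (\<lambda>t p. h t)"
  unfolding smooth_curve_iff
  by (intro allI ballI Ck_on_extend_left[OF assms(1)] open_chart) (use assms in \<open>auto simp: smooth_on_def\<close>)

lemma ginner_curve_Ck:
  fixes f g :: "real \<Rightarrow> 'm \<Rightarrow> real"
  assumes c: "c \<in> atlas M" and I: "open I"
    and f: "Ck_on (Suc k) (I \<times> snd c ` fst c) (\<lambda>(t, x). f t (chart_inv c x))"
    and g: "Ck_on (Suc k) (I \<times> snd c ` fst c) (\<lambda>(t, x). g t (chart_inv c x))"
  shows "Ck_on k (I \<times> snd c ` fst c) (\<lambda>(t, x). ginner c (f t) (g t) (chart_inv c x))"
proof -
  have o: "open (I \<times> snd c ` fst c)" using I c by (intro open_Times) auto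
  have "Ck_on k (I \<times> snd c ` fst c)
     (\<lambda>z. \<Sum>i\<in>UNIV. \<Sum>j\<in>UNIV. (case z of (t, x) \<Rightarrow> ginv M c (chart_inv c x) $ i $ j) *
        (case z of (t, x) \<Rightarrow> pd c i (f t) (chart_inv c x)) *
        (case z of (t, x) \<Rightarrow> pd c j (g t) (chart_inv c x)))"
    by (intro Ck_on_sum[OF o] Ck_on_mult[OF o] pd_curve_Ck[OF c I] f g
        Ck_on_extend_right[OF I open_chart(2)[OF c]] ginv_Ck[OF c])
  then show ?thesis by (simp add: ginner_def case_prod_unfold)
qed

lemma smooth_curve_grad_inner:
  fixes f g :: "real \<Rightarrow> 'm \<Rightarrow> real"
  assumes I: "open I" and f: "smooth_curve M I f" and g: "smooth_curve M I g"
  shows "smooth_curve M I (\<lambda>t. grad_inner M (f t) (g t))"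
  unfolding smooth_curve_iff
proof (intro allI ballI)
  fix k c assume c: "c \<in> atlas M"
  show "Ck_on k (I \<times> snd c ` fst c) (\<lambda>(t, x). grad_inner M (f t) (g t) (chart_inv c x))"
  proof (rule Ck_on_cong)
    show "open (I \<times> snd c ` fst c)" using I c by (intro open_Times) auto
    show "Ck_on k (I \<times> snd c ` fst c) (\<lambda>(t, x). ginner c (f t) (g t) (chart_inv c x))"
      by (rule ginner_curve_Ck[OF c I]) (use f g c in \<open>auto simp: smooth_curve_iff\<close>)
    fix z assume "z \<in> I \<times> snd c ` fst c"
    then obtain t x where z: "z = (t, x)" "t \<in> I" "x \<in> snd c ` fst c" by auto
    have "diff_at c h (chart_inv c x)" if "smooth_fun M h" for h
      using diff_at_Ck_fun[OF Ck_fun_smooth[OF that] c chart_inv_in[OF c z(3)]] .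
    then show "(case z of (t, x) \<Rightarrow> ginner c (f t) (g t) (chart_inv c x)) =
        (case z of (t, x) \<Rightarrow> grad_inner M (f t) (g t) (chart_inv c x))"
      using grad_inner_chart[OF c chart_inv_in[OF c z(3)]] smooth_fun_of_curve[OF I z(2)] f g z(1) by simp
  qed
qed

lemma smooth_fun_grad_inner:
  assumes "smooth_fun M f" "smooth_fun M g"
  shows "smooth_fun M (grad_inner M f g)"
  using smooth_fun_of_curve[OF open_UNIV UNIV_I
      smooth_curve_grad_inner[OF open_UNIV smooth_curve_const smooth_curve_const]] assms by simp

section \<open>Extension by zero and bump functions\<close>

lemma Ck_fun_extend_zero:
  assumes c: "c \<in> atlas M" and V: "open V" "V \<subseteq> fst c" and K: "compact K" "K \<subseteq> V"
    and f: "Ck_on k (snd c ` V) (\<lambda>x. f (chart_inv c x))" and f0: "\<And>p. p \<notin> K \<Longrightarrow> f p = 0"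
  shows "Ck_fun k f"
proof (rule Ck_funI)
  fix d assume d: "d \<in> atlas M"
  \<comment> \<open>Compact sets are closed as the manifold is Hausdorff. Each chart domain is thus
    the union of two open pieces: on one the regularity is transferred from \<open>c\<close>, on the
    other the function vanishes.\<close>
  have cK: "closed K" using K(1) by (rule compact_imp_closed)
  have "Ck_on k (snd d ` (V \<inter> fst d)) (\<lambda>x. f (chart_inv d x))"
  proof (rule Ck_on_transition[OF d c])
    show "Ck_on k (snd c ` (V \<inter> fst d)) (\<lambda>x. f (chart_inv c x))"
      by (rule Ck_on_subset[OF f]) auto
  qed (use V d in auto)
  moreover have "Ck_on k (snd d ` (fst d - K)) (\<lambda>x. f (chart_inv d x))"
  proof (rule Ck_on_cong)
    show "open (snd d ` (fst d - K))"
      using d cK by (intro open_chart_image) auto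
    show "Ck_on k (snd d ` (fst d - K)) (\<lambda>x. 0)" by simp
  qed (use d f0 in auto)
  moreover have "open (snd d ` (V \<inter> fst d))" "open (snd d ` (fst d - K))"
    using d V cK by (auto intro!: open_chart_image open_Int open_Diff)
  moreover have "snd d ` fst d = snd d ` (V \<inter> fst d) \<union> snd d ` (fst d - K)"
    using K(2) by auto
  ultimately show "Ck_on k (snd d ` fst d) (\<lambda>x. f (chart_inv d x))"
    by (metis Ck_on_open_Un)
qed

lemma continuous_extend_zero:
  fixes f :: "'m \<Rightarrow> real"
  assumes "open V" "compact K" "K \<subseteq> V" "continuous_on V f" "\<And>p. p \<notin> K \<Longrightarrow> f p = 0"
  shows "continuous_on UNIV f"
proof -
  have "continuous_on (- K) f"
    by (rule continuous_on_eq[of _ "\<lambda>_. 0"]) (use assms in auto)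
  then have "continuous_on (V \<union> - K) f"
    using assms compact_imp_closed[of K] by (intro continuous_on_open_Un) auto
  moreover have "V \<union> - K = UNIV" using assms by auto
  ultimately show ?thesis by simp
qed

text \<open>The Euclidean bump is transplanted by a chart around \<open>p\<close>, with
  \<open>r\<close> so small that the closed coordinate ball lies in the image of \<open>V\<close>.
  The compact set \<open>K\<close> is the part of the manifold that corresponds to this
  ball.\<close>

lemma obtain_bump:
  assumes "open V" "p \<in> V"
  obtains c \<beta> K where "c \<in> atlas M" "Ck_fun 1 \<beta>" "\<And>q. 0 \<le> \<beta> q" "0 < \<beta> p"
    "compact K" "K \<subseteq> V \<inter> fst c" "\<And>q. q \<notin> K \<Longrightarrow> \<beta> q = 0"
proof -
  obtain c where c: "c \<in> atlas M" "p \<in> fst c" by (rule obtain_chart)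
  let ?W = "V \<inter> fst c" and ?x = "snd c p"
  have "open (snd c ` ?W)" using c assms by (intro open_chart_image) auto
  then obtain r where r: "r > 0" "cball ?x r \<subseteq> snd c ` ?W"
    using open_contains_cball[of "snd c ` ?W"] c(2) assms(2) by blast
  define B where "B x = (max 0 (r\<^sup>2 - (x - ?x) \<bullet> (x - ?x)))\<^sup>2" for x
  define \<beta> where "\<beta> q = (if q \<in> fst c then B (snd c q) else 0)" for q
  define K where "K = chart_inv c ` cball ?x r"
  have K: "compact K"
    unfolding K_def using continuous_on_subset[OF continuous_on_chart_inv[OF c(1)]] r(2)
    by (intro compact_continuous_image) auto
  have KV: "K \<subseteq> ?W"
    using r(2) c(1) unfolding K_def by fastforce
  have B0: "B x = 0" if "x \<notin> cball ?x r" for x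
  proof -
    have "r < norm (x - ?x)" using that by (simp add: dist_norm norm_minus_commute)
    then have "r\<^sup>2 < (norm (x - ?x))\<^sup>2" using r(1) by (intro power_strict_mono) auto
    then show ?thesis by (simp add: B_def power2_norm_eq_inner)
  qed
  have 0: "\<beta> q = 0" if "q \<notin> K" for q
  proof (cases "q \<in> fst c")
    case True
    then have "snd c q \<notin> cball ?x r"
      using that chart_inv_left[OF c(1) True] unfolding K_def by (metis imageI)
    then show ?thesis by (simp add: \<beta>_def B0)
  qed (simp add: \<beta>_def)
  have "Ck_on 1 (snd c ` fst c) (\<lambda>x. \<beta> (chart_inv c x))"
  proof (rule Ck_on_cong)
    show "Ck_on 1 (snd c ` fst c) B"
      unfolding B_def using Ck_on_subset[OF C1_bump] by blast
  qed (use c in \<open>auto simp: \<beta>_def\<close>)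
  then have "Ck_fun 1 \<beta>"
    using Ck_fun_extend_zero[OF c(1) _ _ K _ _ 0, of "fst c" 1] c(1) KV by auto
  moreover have "0 < \<beta> p"
    using c(2) r(1) by (simp add: \<beta>_def B_def max_def)
  ultimately show ?thesis
    using that[of c \<beta> K] c(1) K KV 0 by (auto simp: \<beta>_def B_def)
qed

end

section \<open>The Riemannian density\<close>

context closed_manifold
begin

definition sqrt_det :: "('m, 'n) chart \<Rightarrow> real^'n \<Rightarrow> real" where
  "sqrt_det c x = sqrt (det (metric M c (chart_inv c x)))"

lemma sets_vol [simp, measurable_cong]: "sets (vol M) = sets borel"
  using closed unfolding closed_riemannian_manifold_def riemannian_density_def by blast

lemma space_vol [simp]: "space (vol M) = UNIV"
  using sets_eq_imp_space_eq[OF sets_vol] by simp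

lemma chart_sets: "c \<in> atlas M \<Longrightarrow> fst c \<in> sets borel" "c \<in> atlas M \<Longrightarrow> snd c ` fst c \<in> sets borel"
  by (simp_all add: borel_open)

lemma emeasure_vol_chart:
  "c \<in> atlas M \<Longrightarrow> B \<in> sets borel \<Longrightarrow> B \<subseteq> fst c \<Longrightarrow>
    emeasure (vol M) B = (\<integral>\<^sup>+x\<in>snd c ` B. ennreal (sqrt_det c x) \<partial>lborel)"
  using closed unfolding closed_riemannian_manifold_def riemannian_density_def sqrt_det_def by blast

lemma sqrt_det_pos: "c \<in> atlas M \<Longrightarrow> x \<in> snd c ` fst c \<Longrightarrow> 0 < sqrt_det c x"
  unfolding sqrt_det_def by (simp only: real_sqrt_gt_0_iff det_metric_pos chart_inv_in)

lemma det_Ck: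
  "c \<in> atlas M \<Longrightarrow> Ck_on k (snd c ` fst c) (\<lambda>x. det (metric M c (chart_inv c x)))"
  by (intro Ck_on_det metric_Ck open_chart)

lemma sqrt_det_C1:
  assumes c: "c \<in> atlas M"
  shows "Ck_on (Suc 0) (snd c ` fst c) (sqrt_det c)"
  unfolding sqrt_det_def
proof (rule Ck_on_compose[where T="{0<..}", OF open_chart(2)[OF c] _ _ Ck_1_sqrt])
  show "(\<lambda>x. det (metric M c (chart_inv c x))) ` snd c ` fst c \<subseteq> {0<..}"
    using det_metric_pos[OF c] c by auto
  show "Ck_on (Suc 0) (snd c ` fst c) (\<lambda>x. det (metric M c (chart_inv c x)) \<bullet> b)" if "b \<in> Basis" for b
    using det_Ck[OF c] that by simp
qed simp

lemma sqrt_det_measurable: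
  assumes c: "c \<in> atlas M"
  shows "(\<lambda>x. indicator (snd c ` fst c) x * sqrt_det c x) \<in> borel_measurable borel"
  using borel_measurable_continuous_on_indicator[OF _ Ck_on_imp_continuous[OF sqrt_det_C1[OF c]]] c
  by simp

lemma chart_inv_measurable:
  assumes "c \<in> atlas M" "sets N = sets borel"
  shows "chart_inv c \<in> measurable (restrict_space N (snd c ` fst c)) borel"
  using borel_measurable_continuous_on_restrict[OF continuous_on_chart_inv[OF assms(1)]]
    measurable_cong_sets[OF sets_restrict_space_cong[OF assms(2)] refl] by blast

text \<open>The Riemannian density is specified through the measures of Borel subsets of chart
  domains. Restated as an equality of measures this becomes a pushforward of weighted Lebesgue
  measure, to which the general rule for integrals under \<open>distr\<close> applies. The
  restriction to the chart image is there because \<open>chart_inv c\<close> is under control only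
  on that set.\<close>

lemma density_vol_chart:
  assumes c: "c \<in> atlas M"
  shows "density (vol M) (\<lambda>p. ennreal (indicator (fst c) p)) =
    distr (restrict_space (density lborel (\<lambda>x. ennreal (indicator (snd c ` fst c) x * sqrt_det c x))) (snd c ` fst c))
      borel (chart_inv c)"
    (is "?L = distr (restrict_space ?N ?S) borel _")
proof (rule measure_eqI)
  show "sets ?L = sets (distr (restrict_space ?N ?S) borel (chart_inv c))" by simp
  fix B assume "B \<in> sets ?L"
  then have B: "B \<in> sets borel" by simp
  have S: "?S \<in> sets borel" using c by simp
  have pre: "chart_inv c -` B \<inter> ?S = snd c ` (B \<inter> fst c)" using c by force
  have preS: "chart_inv c -` B \<inter> ?S \<in> sets borel"
    using measurable_sets[OF chart_inv_measurable[OF c, of borel] B] S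
    by (simp add: space_restrict_space sets_restrict_space_iff)
  have "emeasure ?L B = (\<integral>\<^sup>+p. ennreal (indicator (fst c) p) * indicator B p \<partial>vol M)"
    using B chart_sets(1)[OF c] by (subst emeasure_density) auto
  also have "\<dots> = (\<integral>\<^sup>+p. indicator (B \<inter> fst c) p \<partial>vol M)"
    by (intro nn_integral_cong) (auto simp: indicator_def)
  also have "\<dots> = emeasure (vol M) (B \<inter> fst c)"
    using B chart_sets(1)[OF c] by (intro nn_integral_indicator) auto
  also have "\<dots> = (\<integral>\<^sup>+x\<in>snd c ` (B \<inter> fst c). ennreal (sqrt_det c x) \<partial>lborel)"
    using B c chart_sets(1)[OF c] by (intro emeasure_vol_chart) auto
  also have "\<dots> = (\<integral>\<^sup>+x. ennreal (indicator ?S x * sqrt_det c x) * indicator (snd c ` (B \<inter> fst c)) x \<partial>lborel)"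
    by (intro nn_integral_cong) (auto simp: indicator_def)
  also have "\<dots> = emeasure ?N (chart_inv c -` B \<inter> ?S)"
    using sqrt_det_measurable[OF c] preS by (subst emeasure_density) (auto simp: pre)
  also have "\<dots> = emeasure (restrict_space ?N ?S) (chart_inv c -` B \<inter> ?S)"
    using S by (subst emeasure_restrict_space) auto
  also have "\<dots> = emeasure (distr (restrict_space ?N ?S) borel (chart_inv c)) B"
    using B S chart_inv_measurable[OF c, of ?N] by (subst emeasure_distr) (auto simp: space_restrict_space)
  finally show "emeasure ?L B = emeasure (distr (restrict_space ?N ?S) borel (chart_inv c)) B" .
qed

lemma integral_vol_chart:
  fixes f :: "'m \<Rightarrow> real"
  assumes c: "c \<in> atlas M" and f: "f \<in> borel_measurable borel" and f0: "\<And>p. p \<notin> fst c \<Longrightarrow> f p = 0"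
  shows "(LINT p|vol M. f p) =
    (LINT x|lborel. indicator (snd c ` fst c) x * (sqrt_det c x * f (chart_inv c x)))"
proof -
  let ?S = "snd c ` fst c"
  let ?N = "density lborel (\<lambda>x. ennreal (indicator ?S x * sqrt_det c x))"
  have S: "?S \<in> sets borel" using c by simp
  have inv: "chart_inv c \<in> measurable (restrict_space ?N ?S) borel"
    using chart_inv_measurable[OF c, of ?N] by simp
  have fm: "(\<lambda>x. indicator ?S x *\<^sub>R f (chart_inv c x)) \<in> borel_measurable lborel"
    using measurable_compose[OF chart_inv_measurable[OF c, of borel] f] S
    by (simp add: borel_measurable_restrict_space_iff)
  have "(LINT p|vol M. f p) = (LINT p|vol M. indicator (fst c) p *\<^sub>R f p)"
    by (intro Bochner_Integration.integral_cong) (auto simp: indicator_def f0)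
  also have "\<dots> = (LINT p|density (vol M) (\<lambda>p. ennreal (indicator (fst c) p)). f p)"
    using f chart_sets(1)[OF c] measurable_cong_sets[OF sets_vol refl, of borel] by (subst integral_density) auto
  also have "\<dots> = (LINT x|restrict_space ?N ?S. f (chart_inv c x))"
    unfolding density_vol_chart[OF c] by (rule integral_distr[OF inv f])
  also have "\<dots> = (LINT x|?N. indicator ?S x *\<^sub>R f (chart_inv c x))"
    using S by (intro integral_restrict_space) auto
  also have "\<dots> = (LINT x|lborel. (indicator ?S x * sqrt_det c x) *\<^sub>R (indicator ?S x *\<^sub>R f (chart_inv c x)))"
    using sqrt_det_measurable[OF c] fm sqrt_det_pos[OF c]
    by (intro integral_density) (auto simp: indicator_def intro: less_imp_le)
  also have "\<dots> = (LINT x|lborel. indicator ?S x * (sqrt_det c x * f (chart_inv c x)))"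
    by (intro Bochner_Integration.integral_cong) (auto simp: indicator_def)
  finally show ?thesis .
qed

lemma emeasure_vol_compact:
  assumes c: "c \<in> atlas M" and K: "compact K" "K \<subseteq> fst c"
  shows "emeasure (vol M) K < \<infinity>"
proof -
  have "compact (snd c ` K)"
    using K continuous_on_subset[OF continuous_on_chart[OF c]] by (intro compact_continuous_image) auto
  moreover have "continuous_on (snd c ` K) (sqrt_det c)"
    using continuous_on_subset[OF Ck_on_imp_continuous[OF sqrt_det_C1[OF c]] image_mono[OF K(2)]] .
  ultimately have "integrable lborel (\<lambda>x. indicator (snd c ` K) x *\<^sub>R sqrt_det c x)"
    by (rule borel_integrable_compact)
  then have "(\<integral>\<^sup>+x. ennreal (norm (indicator (snd c ` K) x *\<^sub>R sqrt_det c x)) \<partial>lborel) < \<infinity>"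
    by (simp add: integrable_iff_bounded)
  also have "(\<integral>\<^sup>+x. ennreal (norm (indicator (snd c ` K) x *\<^sub>R sqrt_det c x)) \<partial>lborel)
      = (\<integral>\<^sup>+x\<in>snd c ` K. ennreal (sqrt_det c x) \<partial>lborel)"
  proof (intro nn_integral_cong)
    fix x
    show "ennreal (norm (indicator (snd c ` K) x *\<^sub>R sqrt_det c x)) = ennreal (sqrt_det c x) * indicator (snd c ` K) x"
      using sqrt_det_pos[OF c, of x] K(2) by (cases "x \<in> snd c ` K") auto
  qed
  also have "\<dots> = emeasure (vol M) K"
    using K c by (intro emeasure_vol_chart[symmetric]) (auto intro: borel_closed compact_imp_closed)
  finally show ?thesis .
qed

text \<open>A substitute for a partition of unity: the bump functions have a positive sum and are
  normalised only where they are used. The compact sets \<open>K p\<close> serve to bound the total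
  volume.\<close>

lemma obtain_bump_family:
  obtains P :: "'m set" and cc \<beta> K where "finite P"
    "\<And>p. p \<in> P \<Longrightarrow> cc p \<in> atlas M" "\<And>p. p \<in> P \<Longrightarrow> Ck_fun 1 (\<beta> p)"
    "\<And>p. p \<in> P \<Longrightarrow> compact (K p)" "\<And>p. p \<in> P \<Longrightarrow> K p \<subseteq> fst (cc p)"
    "\<And>p q. p \<in> P \<Longrightarrow> q \<notin> K p \<Longrightarrow> \<beta> p q = 0" "\<And>q. 0 < (\<Sum>p\<in>P. \<beta> p q)" "(\<Union>p\<in>P. K p) = UNIV"
proof -
  have "\<exists>c \<beta> K. c \<in> atlas M \<and> Ck_fun 1 \<beta> \<and> (\<forall>q. 0 \<le> \<beta> q) \<and> 0 < \<beta> p \<and>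
      compact K \<and> K \<subseteq> fst c \<and> (\<forall>q. q \<notin> K \<longrightarrow> \<beta> q = 0)" for p
  proof (rule obtain_bump[OF open_UNIV UNIV_I, of p])
    fix c \<beta> K
    assume "c \<in> atlas M" "Ck_fun 1 \<beta>" "\<And>q. 0 \<le> \<beta> q" "0 < \<beta> p"
      "compact K" "K \<subseteq> UNIV \<inter> fst c" "\<And>q. q \<notin> K \<Longrightarrow> \<beta> q = 0"
    then show ?thesis
      by (intro exI[of _ c] exI[of _ \<beta>] exI[of _ K]) simp
  qed
  then obtain cc \<beta> K where b: "\<And>p. cc p \<in> atlas M" "\<And>p. Ck_fun 1 (\<beta> p)" "\<And>p q. 0 \<le> \<beta> p q" "\<And>p. 0 < \<beta> p p"
      "\<And>p. compact (K p)" "\<And>p. K p \<subseteq> fst (cc p)" "\<And>p q. q \<notin> K p \<Longrightarrow> \<beta> p q = 0"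
    by metis
  have "open {q. 0 < \<beta> p q}" for p
    using Ck_fun_continuous[OF b(2)] by (intro open_Collect_less) auto
  moreover have "UNIV \<subseteq> (\<Union>p\<in>UNIV. {q. 0 < \<beta> p q})" using b(4) by auto
  ultimately obtain P where P: "finite P" "UNIV \<subseteq> (\<Union>p\<in>P. {q. 0 < \<beta> p q})"
    using compactE_image[OF compact_manifold, of UNIV "\<lambda>p. {q. 0 < \<beta> p q}"] by auto
  have "0 < (\<Sum>p\<in>P. \<beta> p q)" for q
  proof -
    obtain p where "p \<in> P" "0 < \<beta> p q" using P(2) by auto
    then show ?thesis using P(1) b(3) by (intro sum_pos2) auto
  qed
  moreover have "(\<Union>p\<in>P. K p) = UNIV"
  proof -
    have "q \<in> (\<Union>p\<in>P. K p)" for q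
    proof -
      obtain p where p: "p \<in> P" "0 < \<beta> p q" using P(2) by auto
      then show ?thesis using b(7)[of q p] by (cases "q \<in> K p") auto
    qed
    then show ?thesis by auto
  qed
  ultimately show ?thesis using that[OF P(1), of cc \<beta> K] b by blast
qed

text \<open>\<open>riemannian_density\<close> speaks only of subsets of single charts; finiteness
  comes from a finite cover by compact sets, on each of which \<open>sqrt_det\<close> is
  integrable.\<close>

lemma finite_vol: "finite_measure (vol M)"
proof
  show "emeasure (vol M) (space (vol M)) \<noteq> \<infinity>"
  proof (rule obtain_bump_family)
    fix P :: "'m set" and cc \<beta> K
    assume P: "finite P" "\<And>p. p \<in> P \<Longrightarrow> cc p \<in> atlas M" "\<And>p. p \<in> P \<Longrightarrow> compact (K p)"
      "\<And>p. p \<in> P \<Longrightarrow> K p \<subseteq> fst (cc p)" "(\<Union>p\<in>P. K p) = UNIV"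
    have fin: "emeasure (vol M) (K p) < \<infinity>" if "p \<in> P" for p
      using emeasure_vol_compact[OF P(2)[OF that] P(3)[OF that] P(4)[OF that]] .
    have "emeasure (vol M) (\<Union>p\<in>P. K p) \<le> (\<Sum>p\<in>P. emeasure (vol M) (K p))"
      using P by (intro emeasure_subadditive_finite) (auto intro: borel_closed compact_imp_closed)
    also have "\<dots> < \<infinity>"
      using P(1) fin by (auto simp: less_top[symmetric])
    finally show ?thesis using P(5) by simp
  qed
qed

lemma integrable_vol:
  fixes f :: "'m \<Rightarrow> real"
  assumes "continuous_on UNIV f"
  shows "integrable (vol M) f"
proof -
  have "bounded (range f)"
    using compact_continuous_image[OF assms compact_manifold] compact_imp_bounded by blast
  then obtain B where "\<And>x. norm (f x) \<le> B" unfolding bounded_iff by auto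
  moreover have "f \<in> borel_measurable (vol M)"
    using borel_measurable_continuous_onI[OF assms] by (simp add: measurable_cong_sets[OF sets_vol refl])
  ultimately show ?thesis
    by (intro finite_measure.integrable_const_bound[OF finite_vol]) auto
qed

text \<open>\<open>sqrt_det\<close> is positive and a nonempty open subset of Euclidean space is not
  negligible. This is what turns vanishing integrals into pointwise equations.\<close>

lemma emeasure_vol_open:
  assumes "open V" "p \<in> V"
  shows "emeasure (vol M) V \<noteq> 0"
proof
  assume z: "emeasure (vol M) V = 0"
  obtain c where c: "c \<in> atlas M" "p \<in> fst c" by (rule obtain_chart)
  let ?W = "V \<inter> fst c"
  have o: "open (snd c ` ?W)" using c assms by (intro open_chart_image) auto
  have "emeasure (vol M) ?W = 0"
    using emeasure_mono[of ?W V "vol M"] z assms(1) by auto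
  then have z0: "(\<integral>\<^sup>+x. ennreal (sqrt_det c x) * indicator (snd c ` ?W) x \<partial>lborel) = 0"
    using emeasure_vol_chart[OF c(1), of ?W] assms c by auto
  have eq: "(\<lambda>x. ennreal (sqrt_det c x) * indicator (snd c ` ?W) x) =
      (\<lambda>x. ennreal (indicator (snd c ` fst c) x * sqrt_det c x) * indicator (snd c ` ?W) x)"
    by (intro ext) (auto simp: indicator_def)
  have "(\<lambda>x. ennreal (sqrt_det c x) * indicator (snd c ` ?W) x) \<in> borel_measurable lborel"
    unfolding eq using sqrt_det_measurable[OF c(1)] borel_open[OF o]
    by (intro borel_measurable_times_ennreal measurable_compose[OF _ measurable_ennreal] borel_measurable_indicator) auto
  from nn_integral_0_iff_AE[OF this] z0
  have "AE x in lborel. ennreal (sqrt_det c x) * indicator (snd c ` ?W) x = 0" by (rule iffD1)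
  then have "AE x in lborel. x \<notin> snd c ` ?W"
  proof (rule AE_mp, intro AE_I2 impI notI)
    fix x assume e: "ennreal (sqrt_det c x) * indicator (snd c ` ?W) x = 0" and x: "x \<in> snd c ` ?W"
    then have "0 < sqrt_det c x" using sqrt_det_pos[OF c(1), of x] by blast
    then show False using e x by simp
  qed
  then have "snd c ` ?W \<in> null_sets lborel"
    using o by (subst (asm) AE_iff_null_sets[symmetric]) auto
  then have "negligible (snd c ` ?W)"
    by (simp add: negligible_iff_null_sets null_sets_completionI)
  then show False using open_not_negligible[OF o] c assms by auto
qed

lemma integral_zero_imp_zero:
  fixes f :: "'m \<Rightarrow> real"
  assumes f: "continuous_on UNIV f" "\<And>p. 0 \<le> f p" and z: "(LINT p|vol M. f p) = 0"
  shows "f p = 0"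
proof (rule ccontr)
  assume "f p \<noteq> 0"
  then have p: "p \<in> {q. 0 < f q}" using f(2)[of p] by simp
  have o: "open {q. 0 < f q}" using f(1) by (intro open_Collect_less) auto
  have "AE q in vol M. f q = 0"
    using integral_nonneg_eq_0_iff_AE[OF integrable_vol[OF f(1)]] f(2) z by simp
  then have "AE q in vol M. q \<notin> {q. 0 < f q}" by (rule AE_mp) (intro AE_I2, auto)
  then have "emeasure (vol M) {q. 0 < f q} = 0"
    using o AE_iff_null_sets[of "{q. 0 < f q}" "vol M"] by auto
  then show False using emeasure_vol_open[OF o p] by simp
qed

end

section \<open>Integration by parts\<close>

context closed_manifold
begin

text \<open>As with \<open>ginner\<close>, the chart is a parameter so that regularity can be
  examined. Agreement with \<open>div_weighted_grad\<close> is established only after local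
  integration by parts.\<close>

definition divc :: "('m, 'n) chart \<Rightarrow> ('m \<Rightarrow> real) \<Rightarrow> ('m \<Rightarrow> real) \<Rightarrow> 'm \<Rightarrow> real" where
  "divc c \<rho> \<phi> p = (\<Sum>i\<in>UNIV. \<Sum>j\<in>UNIV. ginv M c p $ i $ j *
     cov_deriv M c j (\<lambda>k q. \<rho> q * pd c k \<phi> q) i p)"

lemma div_weighted_grad_eq_divc: "div_weighted_grad M \<rho> \<phi> p = divc (chart_at M p) \<rho> \<phi> p"
  by (simp add: div_weighted_grad_def divc_def Let_def)

lemma christoffel_Ck:
  assumes c: "c \<in> atlas M"
  shows "Ck_on k (snd c ` fst c) (\<lambda>x. christoffel M c a i j (chart_inv c x))"
proof -
  have "Ck_on k (snd c ` fst c) (\<lambda>x. pd c i (\<lambda>q. metric M c q $ j $ l) (chart_inv c x))" for i j l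
    by (intro pd_Ck metric_Ck c open_chart order_refl)
  then show ?thesis
    unfolding christoffel_def
    by (intro Ck_on_mult Ck_on_sum Ck_on_add Ck_on_diff ginv_Ck Ck_on_const open_chart c)
qed

lemma divc_curve_Ck:
  fixes \<rho> \<phi> :: "real \<Rightarrow> 'm \<Rightarrow> real"
  assumes c: "c \<in> atlas M" and I: "open I"
    and \<rho>: "Ck_on (Suc k) (I \<times> snd c ` fst c) (\<lambda>(t, x). \<rho> t (chart_inv c x))"
    and \<phi>: "Ck_on (Suc (Suc k)) (I \<times> snd c ` fst c) (\<lambda>(t, x). \<phi> t (chart_inv c x))"
  shows "Ck_on k (I \<times> snd c ` fst c) (\<lambda>(t, x). divc c (\<rho> t) (\<phi> t) (chart_inv c x))"
proof -
  have o: "open (I \<times> snd c ` fst c)" using I c by (intro open_Times) auto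
  have \<omega>: "Ck_on (Suc k) (I \<times> snd c ` fst c) (\<lambda>(t, x). \<rho> t (chart_inv c x) * pd c i (\<phi> t) (chart_inv c x))" for i
    by (intro Ck_on_case_prod_mult[OF o \<rho>] pd_curve_Ck[OF c I \<phi>])
  have "Ck_on k (I \<times> snd c ` fst c)
     (\<lambda>z. \<Sum>i\<in>UNIV. \<Sum>j\<in>UNIV. (case z of (t, x) \<Rightarrow> ginv M c (chart_inv c x) $ i $ j) *
        ((case z of (t, x) \<Rightarrow> pd c j (\<lambda>q. \<rho> t q * pd c i (\<phi> t) q) (chart_inv c x)) -
         (\<Sum>l\<in>UNIV. (case z of (t, x) \<Rightarrow> christoffel M c l j i (chart_inv c x)) *
            (case z of (t, x) \<Rightarrow> \<rho> t (chart_inv c x) * pd c l (\<phi> t) (chart_inv c x)))))"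
    by (intro Ck_on_sum[OF o] Ck_on_mult[OF o] Ck_on_diff[OF o] pd_curve_Ck[OF c I] \<omega> Ck_on_SucD[OF \<omega>]
        Ck_on_extend_right[OF I open_chart(2)[OF c]] ginv_Ck[OF c] christoffel_Ck[OF c])
  then show ?thesis by (simp add: divc_def cov_deriv_def case_prod_unfold)
qed

text \<open>After multiplication by the density the divergence is a total derivative:
  \<open>F\<close> is the vector field \<open>\<rho> \<nabla>\<phi>\<close> times
  \<open>sqrt (det g)\<close>. The Christoffel symbols are absorbed, and this form can be integrated
  over the chart image.\<close>

lemma divergence_chart:
  fixes \<rho> \<phi> :: "'m \<Rightarrow> real"
  assumes c: "c \<in> atlas M" and \<rho>: "smooth_fun M \<rho>" and \<phi>: "smooth_fun M \<phi>"
  defines "F \<equiv> \<lambda>i x. \<Sum>j\<in>UNIV. sqrt_det c x * ginv M c (chart_inv c x) $ i $ j *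
      (\<rho> (chart_inv c x) * pd c j \<phi> (chart_inv c x))"
  shows "Ck_on (Suc 0) (snd c ` fst c) (F i)"
    and "x \<in> snd c ` fst c \<Longrightarrow> (\<Sum>i\<in>UNIV. frechet_derivative (F i) (at x) (axis i 1))
      = sqrt_det c x * divc c \<rho> \<phi> (chart_inv c x)"
proof -
  let ?S = "snd c ` fst c"
  have o: "open ?S" using c by simp
  define \<omega> where "\<omega> = (\<lambda>j x. \<rho> (chart_inv c x) * pd c j \<phi> (chart_inv c x))"
  define A where "A = (\<lambda>x. metric M c (chart_inv c x))"
  define W where "W = sqrt_det c"
  have \<omega>C: "Ck_on (Suc 0) ?S (\<omega> j)" for j
    unfolding \<omega>_def
    by (intro Ck_on_mult[OF o] pd_Ck[OF c] Ck_funD[OF Ck_fun_smooth] \<rho> \<phi> c open_chart order_refl)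
  have HC: "Ck_on (Suc 0) ?S (\<lambda>x. matrix_inv (A x) $ i $ j)" for i j
    using ginv_Ck[OF c] by (simp only: ginv_def A_def)
  have AC: "Ck_on (Suc 0) ?S (\<lambda>x. A x $ i $ j)" for i j
    using metric_Ck[OF c] by (simp only: A_def)
  have WC: "Ck_on (Suc 0) ?S W" unfolding W_def by (rule sqrt_det_C1[OF c])
  have F: "F = (\<lambda>i x. \<Sum>j\<in>UNIV. W x * matrix_inv (A x) $ i $ j * \<omega> j x)"
    by (simp add: F_def W_def A_def ginv_def \<omega>_def)
  show "Ck_on (Suc 0) ?S (F i)"
    unfolding F by (intro Ck_on_sum[OF o] Ck_on_mult[OF o] WC HC \<omega>C)
  assume x: "x \<in> ?S"
  let ?p = "chart_inv c x"
  have p: "?p \<in> fst c" by (rule chart_inv_in[OF c x])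
  let ?D = "\<lambda>i f. frechet_derivative f (at x) (axis i 1)"
  have nz: "det (A y) \<noteq> 0" if "y \<in> ?S" for y
    unfolding A_def by (rule det_metric_nz[OF c chart_inv_in[OF c that]])
  have DF: "?D i (F i) = (\<Sum>j\<in>UNIV. ?D i W * matrix_inv (A x) $ i $ j * \<omega> j x
      + W x * ?D i (\<lambda>x. matrix_inv (A x) $ i $ j) * \<omega> j x + W x * matrix_inv (A x) $ i $ j * ?D i (\<omega> j))" for i
  proof -
    have "(F i has_derivative (\<lambda>v. \<Sum>j\<in>UNIV.
        (W x * matrix_inv (A x) $ i $ j) * frechet_derivative (\<omega> j) (at x) v +
        (W x * frechet_derivative (\<lambda>x. matrix_inv (A x) $ i $ j) (at x) v +
          frechet_derivative W (at x) v * matrix_inv (A x) $ i $ j) * \<omega> j x)) (at x)"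
      unfolding F
      by (intro has_derivative_sum has_derivative_mult Ck_on_has_derivative[OF WC x]
          Ck_on_has_derivative[OF HC x] Ck_on_has_derivative[OF \<omega>C x])
    from frechet_derivative_at[OF this, symmetric] show ?thesis
      by (simp add: algebra_simps)
  qed
  have dA: "?D i (\<lambda>x. A x $ a $ b) = pd c i (\<lambda>q. metric M c q $ a $ b) ?p" for i a b
    by (simp only: A_def pd_chart_inv[OF c x])
  have sym: "matrix_inv (A x) $ a $ b = matrix_inv (A x) $ b $ a" for a b
    using ginv_sym[OF c p, of a b] by (simp only: A_def ginv_def)
  \<comment> \<open>Jacobi's formula under the square root: \<open>det (A x)\<close> divided by its
    square root is \<open>W x\<close> itself, which produces the factor
    \<open>W x / 2\<close>.\<close>
  have DW: "?D i W = W x / 2 * (\<Sum>a\<in>UNIV. \<Sum>b\<in>UNIV. matrix_inv (A x) $ a $ b * pd c i (\<lambda>q. metric M c q $ a $ b) ?p)" for i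
  proof -
    have pos: "0 < det (A x)" unfolding A_def by (rule det_metric_pos[OF c p])
    have "((\<lambda>x. det (A x)) has_derivative (\<lambda>v. det (A x) *
        (\<Sum>k\<in>UNIV. \<Sum>l\<in>UNIV. matrix_inv (A x) $ l $ k * frechet_derivative (\<lambda>x. A x $ k $ l) (at x) v))) (at x)"
      by (rule has_derivative_det[OF Ck_on_has_derivative[OF AC x] nz[OF x]])
    from DERIV_compose_FDERIV[OF DERIV_real_sqrt[OF pos] this]
    have "(W has_derivative (\<lambda>v. det (A x) *
        (\<Sum>k\<in>UNIV. \<Sum>l\<in>UNIV. matrix_inv (A x) $ l $ k * frechet_derivative (\<lambda>x. A x $ k $ l) (at x) v)
          * (inverse (sqrt (det (A x))) / 2))) (at x)"
      by (simp add: W_def sqrt_det_def[abs_def] A_def)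
    from frechet_derivative_at[OF this, symmetric]
    have "?D i W = det (A x) * (\<Sum>a\<in>UNIV. \<Sum>b\<in>UNIV. matrix_inv (A x) $ b $ a * pd c i (\<lambda>q. metric M c q $ a $ b) ?p)
          * (inverse (sqrt (det (A x))) / 2)"
      by (simp only: dA)
    also have "\<dots> = (det (A x) / sqrt (det (A x))) / 2 *
        (\<Sum>a\<in>UNIV. \<Sum>b\<in>UNIV. matrix_inv (A x) $ b $ a * pd c i (\<lambda>q. metric M c q $ a $ b) ?p)"
      by (simp only: divide_inverse mult_ac)
    also have "det (A x) / sqrt (det (A x)) = W x"
      using pos by (simp add: real_div_sqrt W_def sqrt_det_def A_def)
    also have "(\<Sum>a\<in>UNIV. \<Sum>b\<in>UNIV. matrix_inv (A x) $ b $ a * pd c i (\<lambda>q. metric M c q $ a $ b) ?p)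
        = (\<Sum>a\<in>UNIV. \<Sum>b\<in>UNIV. matrix_inv (A x) $ a $ b * pd c i (\<lambda>q. metric M c q $ a $ b) ?p)"
      by (intro sum.cong refl arg_cong2[where f="(*)"] sym)
    finally show ?thesis .
  qed
  have DH: "?D i (\<lambda>x. matrix_inv (A x) $ j $ k) = - (\<Sum>a\<in>UNIV. \<Sum>b\<in>UNIV. matrix_inv (A x) $ j $ a *
      pd c i (\<lambda>q. metric M c q $ a $ b) ?p * matrix_inv (A x) $ b $ k)" for i j k
    using frechet_matrix_inv[OF o x AC nz] by (simp only: dA)
  have symg: "pd c i (\<lambda>q. metric M c q $ a $ b) ?p = pd c i (\<lambda>q. metric M c q $ b $ a) ?p" for i a b
    by (rule pd_cong[OF c open_chart(1)[OF c] p p metric_sym[OF c]])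
  have D\<omega>: "?D i (\<omega> j) = pd c i (\<lambda>q. \<rho> q * pd c j \<phi> q) ?p" for i j
    by (simp only: \<omega>_def pd_chart_inv[OF c x])
  have "(\<Sum>i\<in>UNIV. ?D i (F i)) = W x * (\<Sum>i\<in>UNIV. \<Sum>j\<in>UNIV. matrix_inv (A x) $ i $ j *
      (?D j (\<omega> i) - (\<Sum>k\<in>UNIV. christoffel M c k j i ?p * \<omega> k x)))"
    unfolding DF
    by (rule divergence_coordinates[where dg="\<lambda>i a b. pd c i (\<lambda>q. metric M c q $ a $ b) ?p", OF sym symg DW DH])
      (simp add: christoffel_def A_def ginv_def)
  also have "\<dots> = sqrt_det c x * divc c \<rho> \<phi> ?p"
    unfolding D\<omega> by (simp add: W_def A_def divc_def cov_deriv_def ginv_def \<omega>_def)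
  finally show "(\<Sum>i\<in>UNIV. ?D i (F i)) = sqrt_det c x * divc c \<rho> \<phi> ?p" .
qed

lemma continuous_grad_inner:
  assumes f: "Ck_fun 1 f" and g: "Ck_fun 1 g"
  shows "continuous_on UNIV (grad_inner M f g)"
proof (rule continuous_onI_charts)
  fix c assume c: "c \<in> atlas M"
  have *: "Ck_on (Suc 0) (UNIV \<times> snd c ` fst c) (\<lambda>(t::real, x). h (chart_inv c x))" if "Ck_fun 1 h" for h
    by (rule Ck_on_extend_right[OF open_UNIV open_chart(2)[OF c]]) (use Ck_funD[OF that c] in simp)
  have "Ck_on 0 (snd c ` fst c) (\<lambda>x. ginner c f g (chart_inv c x))"
    by (rule Ck_on_slice_right[OF open_UNIV open_chart(2)[OF c] UNIV_I ginner_curve_Ck[OF c open_UNIV *[OF f] *[OF g]]])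
  then have "continuous_on (fst c) (ginner c f g)"
    by (intro continuous_on_chartwise[OF c] Ck_on_imp_continuous)
  then show "continuous_on (fst c) (grad_inner M f g)"
    by (rule continuous_on_cong[THEN iffD1, OF refl, rotated])
      (rule grad_inner_chart[OF c, symmetric], assumption, (rule diff_at_Ck_fun[OF _ c], use f g in auto)+)
qed

lemma continuous_divc:
  assumes c: "c \<in> atlas M" and \<rho>: "smooth_fun M \<rho>" and \<phi>: "smooth_fun M \<phi>"
  shows "continuous_on (fst c) (divc c \<rho> \<phi>)"
proof -
  have *: "Ck_on k (UNIV \<times> snd c ` fst c) (\<lambda>(t::real, x). h (chart_inv c x))" if "smooth_fun M h" for h k
    by (rule Ck_on_extend_right[OF open_UNIV open_chart(2)[OF c] Ck_funD[OF Ck_fun_smooth[OF that] c]])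
  have "Ck_on 0 (snd c ` fst c) (\<lambda>x. divc c \<rho> \<phi> (chart_inv c x))"
    by (rule Ck_on_slice_right[OF open_UNIV open_chart(2)[OF c] UNIV_I divc_curve_Ck[OF c open_UNIV *[OF \<rho>] *[OF \<phi>]]])
  then show ?thesis
    by (intro continuous_on_chartwise[OF c] Ck_on_imp_continuous)
qed

text \<open>The product of \<psi> with each component of \<open>F\<close>, extended by zero, is
  \<open>C\<^sup>1\<close> with compact support, so the integral of its partial derivative is zero;
  the product rule splits the sum of these derivatives into the two integrands. The divergence is
  still the one of the chart \<open>c\<close>, since its invariance is deduced from here.\<close>

lemma local_integration_by_parts:
  assumes c: "c \<in> atlas M" and \<psi>: "Ck_fun 1 \<psi>" and K: "compact K" "K \<subseteq> fst c"
    and 0: "\<And>p. p \<notin> K \<Longrightarrow> \<psi> p = 0" and \<rho>: "smooth_fun M \<rho>" and \<phi>: "smooth_fun M \<phi>"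
  shows "continuous_on UNIV (\<lambda>p. \<psi> p * divc c \<rho> \<phi> p)"
    and "(LINT p|vol M. \<psi> p * divc c \<rho> \<phi> p) = - (LINT p|vol M. grad_inner M \<psi> \<phi> p * \<rho> p)"
proof -
  let ?S = "snd c ` fst c"
  have o: "open ?S" using c by simp
  show cont: "continuous_on UNIV (\<lambda>p. \<psi> p * divc c \<rho> \<phi> p)"
    by (rule continuous_extend_zero[OF open_chart(1)[OF c] K])
      (use 0 in \<open>auto intro!: continuous_on_mult continuous_divc c \<rho> \<phi>
        continuous_on_subset[OF Ck_fun_continuous[OF \<psi>]]\<close>)
  have cont': "continuous_on UNIV (\<lambda>p. grad_inner M \<psi> \<phi> p * \<rho> p)"
    by (intro continuous_on_mult continuous_grad_inner \<psi> Ck_fun_smooth[OF \<phi>] Ck_fun_continuous[OF Ck_fun_smooth[OF \<rho>]])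
  define F where "F = (\<lambda>i x. \<Sum>j\<in>UNIV. sqrt_det c x * ginv M c (chart_inv c x) $ i $ j *
      (\<rho> (chart_inv c x) * pd c j \<phi> (chart_inv c x)))"
  have FC: "Ck_on (Suc 0) ?S (F i)" for i
    unfolding F_def by (rule divergence_chart(1)[OF c \<rho> \<phi>])
  have divF: "(\<Sum>i\<in>UNIV. frechet_derivative (F i) (at x) (axis i 1)) = sqrt_det c x * divc c \<rho> \<phi> (chart_inv c x)"
    if "x \<in> ?S" for x
    unfolding F_def by (rule divergence_chart(2)[OF c \<rho> \<phi> that])
  define u where "u = (\<lambda>i x. if x \<in> ?S then \<psi> (chart_inv c x) * F i x else 0)"
  have KS: "compact (snd c ` K)"
    using K continuous_on_subset[OF continuous_on_chart[OF c]] by (intro compact_continuous_image) auto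
  have u0: "u i x = 0" if "x \<notin> snd c ` K" for i x
  proof (cases "x \<in> ?S")
    case True
    then obtain p where p: "p \<in> fst c" "x = snd c p" by blast
    then have "p \<notin> K" using that by blast
    then show ?thesis using 0 p c by (simp add: u_def)
  qed (simp add: u_def)
  have \<psi>C: "Ck_on (Suc 0) ?S (\<lambda>x. \<psi> (chart_inv c x))"
    using Ck_funD[OF \<psi> c] by simp
  have uC: "Ck_on 1 UNIV (u i)" for i
  proof -
    have "Ck_on (Suc 0) ?S (u i)"
      by (rule Ck_on_cong[OF o _ Ck_on_mult[OF o \<psi>C FC[of i]]]) (simp add: u_def)
    moreover have o': "open (- snd c ` K)" using KS compact_imp_closed by auto
    moreover have "Ck_on (Suc 0) (- snd c ` K) (u i)"
      by (rule Ck_on_cong[OF o' _ Ck_on_const[of _ _ 0]]) (simp add: u0)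
    moreover have "?S \<union> - snd c ` K = UNIV" using K(2) by auto
    ultimately show ?thesis
      using Ck_on_open_Un[OF o o', of "Suc 0" "u i"] by simp
  qed
  let ?f = "\<lambda>p. grad_inner M \<psi> \<phi> p * \<rho> p + \<psi> p * divc c \<rho> \<phi> p"
  \<comment> \<open>Off \<open>K\<close> the function \<psi> vanishes on an open set, hence so do
    its derivatives, in whichever chart \<open>chart_at\<close> selects.\<close>
  have f0: "?f p = 0" if "p \<notin> fst c" for p
  proof -
    have "p \<notin> K" using that K(2) by blast
    then have "pd (chart_at M p) i \<psi> p = pd (chart_at M p) i (\<lambda>_. 0) p" for i
      using 0 compact_imp_closed[OF K(1)] chart_at[of p]
      by (intro pd_cong[where V="- K"]) auto
    then show ?thesis using 0[OF \<open>p \<notin> K\<close>] by (simp add: grad_inner_eq_ginner ginner_def)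
  qed
  have pt: "(\<Sum>i\<in>UNIV. frechet_derivative (u i) (at x) (axis i 1)) =
      indicator ?S x * (sqrt_det c x * ?f (chart_inv c x))" for x
  proof (cases "x \<in> ?S")
    case True
    let ?p = "chart_inv c x"
    have p: "?p \<in> fst c" by (rule chart_inv_in[OF c True])
    have du: "frechet_derivative (u i) (at x) (axis i 1) =
        \<psi> ?p * frechet_derivative (F i) (at x) (axis i 1) + pd c i \<psi> ?p * F i x" for i
    proof -
      have "frechet_derivative (u i) (at x) = frechet_derivative (\<lambda>x. \<psi> (chart_inv c x) * F i x) (at x)"
        by (rule frechet_cong_open[OF o True]) (simp add: u_def)
      then show ?thesis
        using frechet_derivative_at[OF has_derivative_mult[OF Ck_on_has_derivative[OF \<psi>C True]
              Ck_on_has_derivative[OF FC[of i] True]], symmetric]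
        by (simp add: pd_chart_inv[OF c True])
    qed
    have "(\<Sum>i\<in>UNIV. pd c i \<psi> ?p * F i x) = sqrt_det c x * (ginner c \<psi> \<phi> ?p * \<rho> ?p)"
      by (simp add: F_def ginner_def sum_distrib_left sum_distrib_right mult_ac)
    moreover have "ginner c \<psi> \<phi> ?p = grad_inner M \<psi> \<phi> ?p"
      using grad_inner_chart[OF c p] diff_at_Ck_fun[OF _ c p] \<psi> Ck_fun_smooth[OF \<phi>] by simp
    ultimately show ?thesis
      using True divF[OF True]
      by (simp add: du sum.distrib sum_distrib_left[symmetric] algebra_simps)
  next
    case False
    have "frechet_derivative (u i) (at x) = frechet_derivative (\<lambda>_. 0) (at x)" for i
      by (rule frechet_cong_open[of "- snd c ` K"])
        (use False K KS compact_imp_closed u0 in auto)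
    then show ?thesis using False by simp
  qed
  have "?f \<in> borel_measurable borel"
    using cont cont' by (intro borel_measurable_continuous_onI continuous_on_add)
  from integral_vol_chart[OF c this f0] have "(LINT p|vol M. ?f p) = (LINT x|lborel. (\<Sum>i\<in>UNIV. frechet_derivative (u i) (at x) (axis i 1)))"
    unfolding pt .
  also have "\<dots> = 0"
    using integral_partial_derivative_zero[OF uC KS u0] by (subst Bochner_Integration.integral_sum) auto
  finally show "(LINT p|vol M. \<psi> p * divc c \<rho> \<phi> p) = - (LINT p|vol M. grad_inner M \<psi> \<phi> p * \<rho> p)"
    using integrable_vol[OF cont] integrable_vol[OF cont'] by simp
qed

text \<open>Both sides have the same integrals against bump functions, by the invariance of the first
  order term in the integration by parts.\<close>

lemma divc_invariant:
  assumes cd: "c \<in> atlas M" "d \<in> atlas M" and p: "p \<in> fst c" "p \<in> fst d"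
    and \<rho>: "smooth_fun M \<rho>" and \<phi>: "smooth_fun M \<phi>"
  shows "divc c \<rho> \<phi> p = divc d \<rho> \<phi> p"
proof -
  \<comment> \<open>The strict inequality is excluded for every pair of charts, so that exchanging
    the charts excludes the opposite one.\<close>
  have "\<not> 0 < divc c \<rho> \<phi> p - divc d \<rho> \<phi> p"
    if cd: "c \<in> atlas M" "d \<in> atlas M" and p: "p \<in> fst c" "p \<in> fst d" for c d
  proof
    assume pos: "0 < divc c \<rho> \<phi> p - divc d \<rho> \<phi> p"
    let ?U = "fst c \<inter> fst d" and ?g = "\<lambda>q. divc c \<rho> \<phi> q - divc d \<rho> \<phi> q"
    have "continuous_on ?U ?g"
      by (intro continuous_on_diff continuous_on_subset[OF continuous_divc[OF _ \<rho> \<phi>]] cd) auto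
    then have o: "open (?U \<inter> ?g -` {0<..})"
      using cd by (intro continuous_open_preimage) auto
    show False
    proof (rule obtain_bump[OF o, of p])
      show "p \<in> ?U \<inter> ?g -` {0<..}" using p pos by simp
      fix e \<beta> K assume b: "Ck_fun 1 \<beta>" "\<And>q. 0 \<le> \<beta> q" "0 < \<beta> p" "compact K"
        "K \<subseteq> (?U \<inter> ?g -` {0<..}) \<inter> fst e" "\<And>q. q \<notin> K \<Longrightarrow> \<beta> q = 0"
      have Kcd: "K \<subseteq> fst c" "K \<subseteq> fst d" using b(5) by auto
      note ic = local_integration_by_parts[OF cd(1) b(1,4) Kcd(1) b(6) \<rho> \<phi>]
      note id = local_integration_by_parts[OF cd(2) b(1,4) Kcd(2) b(6) \<rho> \<phi>]
      have "(LINT q|vol M. \<beta> q * divc c \<rho> \<phi> q - \<beta> q * divc d \<rho> \<phi> q) = 0"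
        using integrable_vol[OF ic(1)] integrable_vol[OF id(1)] ic(2) id(2) by simp
      moreover have "0 \<le> \<beta> q * divc c \<rho> \<phi> q - \<beta> q * divc d \<rho> \<phi> q" for q
      proof (cases "q \<in> K")
        case True
        then have "0 < ?g q" using b(5) by auto
        then show ?thesis using b(2)[of q] by (simp flip: right_diff_distrib)
      qed (simp add: b(6))
      moreover have "continuous_on UNIV (\<lambda>q. \<beta> q * divc c \<rho> \<phi> q - \<beta> q * divc d \<rho> \<phi> q)"
        using ic(1) id(1) by (rule continuous_on_diff)
      ultimately have "\<beta> p * divc c \<rho> \<phi> p - \<beta> p * divc d \<rho> \<phi> p = 0"
        using integral_zero_imp_zero by blast
      then show False using pos b(3) by (simp flip: right_diff_distrib)
    qed
  qed
  from this[OF cd p] this[OF cd(2,1) p(2,1)] show ?thesis by linarith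
qed

lemma div_weighted_grad_chart:
  assumes "c \<in> atlas M" "p \<in> fst c" "smooth_fun M \<rho>" "smooth_fun M \<phi>"
  shows "div_weighted_grad M \<rho> \<phi> p = divc c \<rho> \<phi> p"
  unfolding div_weighted_grad_eq_divc by (rule divc_invariant[OF chart_at(1) assms(1) chart_at(2) assms(2-4)])

lemma smooth_curve_Vpot:
  fixes \<rho> \<phi> :: "real \<Rightarrow> 'm \<Rightarrow> real"
  assumes I: "open I" and \<rho>: "smooth_curve M I \<rho>" and \<phi>: "smooth_curve M I \<phi>"
  shows "smooth_curve M I (\<lambda>t. Vpot M (\<phi> t) (\<rho> t))"
  unfolding smooth_curve_iff
proof (intro allI ballI)
  fix k c assume c: "c \<in> atlas M"
  have o: "open (I \<times> snd c ` fst c)" using I c by (intro open_Times) auto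
  show "Ck_on k (I \<times> snd c ` fst c) (\<lambda>(t, x). Vpot M (\<phi> t) (\<rho> t) (chart_inv c x))"
  proof (rule Ck_on_cong[OF o])
    have "Ck_on k (I \<times> snd c ` fst c) (\<lambda>(t, x). divc c (\<rho> t) (\<phi> t) (chart_inv c x))"
      by (rule divc_curve_Ck[OF c I]) (use \<rho> \<phi> c in \<open>auto simp: smooth_curve_iff\<close>)
    then show "Ck_on k (I \<times> snd c ` fst c) (\<lambda>z. - (case z of (t, x) \<Rightarrow> divc c (\<rho> t) (\<phi> t) (chart_inv c x)))"
      by (rule Ck_on_minus[OF o])
    fix z assume "z \<in> I \<times> snd c ` fst c"
    then obtain t x where z: "z = (t, x)" "t \<in> I" "x \<in> snd c ` fst c" by auto
    show "- (case z of (t, x) \<Rightarrow> divc c (\<rho> t) (\<phi> t) (chart_inv c x)) =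
        (case z of (t, x) \<Rightarrow> Vpot M (\<phi> t) (\<rho> t) (chart_inv c x))"
      unfolding z(1) prod.case Vpot_def
      by (simp only: div_weighted_grad_chart[OF c chart_inv_in[OF c z(3)]
            smooth_fun_of_curve[OF I z(2) \<rho>] smooth_fun_of_curve[OF I z(2) \<phi>]])
  qed
qed

lemma smooth_fun_Vpot:
  "smooth_fun M \<rho> \<Longrightarrow> smooth_fun M \<phi> \<Longrightarrow> smooth_fun M (Vpot M \<phi> \<rho>)"
  using smooth_fun_of_curve[OF open_UNIV UNIV_I
      smooth_curve_Vpot[OF open_UNIV smooth_curve_const smooth_curve_const]] by simp

text \<open>Both sides are linear in \<psi>, which is therefore cut into pieces supported in single
  charts. The pieces are only \<open>C\<^sup>1\<close>, as the local version permits. The minus sign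
  in \<open>Vpot\<close> absorbs the one of the local version.\<close>

theorem integration_by_parts:
  assumes \<psi>: "Ck_fun 1 \<psi>" and \<rho>: "smooth_fun M \<rho>" and \<phi>: "smooth_fun M \<phi>"
  shows "(LINT p|vol M. \<psi> p * Vpot M \<phi> \<rho> p) = (LINT p|vol M. grad_inner M \<psi> \<phi> p * \<rho> p)"
proof (rule obtain_bump_family)
  fix P :: "'m set" and cc \<beta> K
  assume P: "finite P" and b: "\<And>p. p \<in> P \<Longrightarrow> cc p \<in> atlas M" "\<And>p. p \<in> P \<Longrightarrow> Ck_fun 1 (\<beta> p)"
    "\<And>p. p \<in> P \<Longrightarrow> compact (K p)" "\<And>p. p \<in> P \<Longrightarrow> K p \<subseteq> fst (cc p)"
    "\<And>p q. p \<in> P \<Longrightarrow> q \<notin> K p \<Longrightarrow> \<beta> p q = 0" and pos: "\<And>q. 0 < (\<Sum>p\<in>P. \<beta> p q)"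
  \<comment> \<open>Division by the positive sum of the bump functions makes the pieces add up to
    \<psi>.\<close>
  define w where "w p q = \<beta> p q * (inverse (\<Sum>p\<in>P. \<beta> p q) * \<psi> q)" for p q
  have wC: "Ck_fun 1 (w p)" if "p \<in> P" for p
  proof -
    have "(\<Sum>p\<in>P. \<beta> p q) \<noteq> 0" for q using pos[of q] by linarith
    then show ?thesis
      unfolding w_def by (intro Ck_fun_mult Ck_fun_inverse Ck_fun_sum b(2) that \<psi>)
  qed
  have sum: "(\<Sum>p\<in>P. w p q) = \<psi> q" for q
    using pos[of q] by (simp add: w_def sum_distrib_right[symmetric])
  have w0: "w p q = 0" if "p \<in> P" "q \<notin> K p" for p q
    using b(5)[OF that] by (simp add: w_def)
  have loc: "continuous_on UNIV (\<lambda>q. w p q * divc (cc p) \<rho> \<phi> q)"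
    "(LINT q|vol M. w p q * divc (cc p) \<rho> \<phi> q) = - (LINT q|vol M. grad_inner M (w p) \<phi> q * \<rho> q)"
    if "p \<in> P" for p
    by (rule local_integration_by_parts[OF b(1)[OF that] wC[OF that] b(3,4)[OF that] _ \<rho> \<phi>],
        erule w0[OF that])+
  have eq: "w p q * divc (cc p) \<rho> \<phi> q = w p q * div_weighted_grad M \<rho> \<phi> q" if "p \<in> P" for p q
  proof (cases "q \<in> K p")
    case True
    then show ?thesis
      using div_weighted_grad_chart[OF b(1)[OF that] _ \<rho> \<phi>, of q] b(4)[OF that] by auto
  qed (simp add: w0[OF that])
  have int: "integrable (vol M) (\<lambda>q. w p q * div_weighted_grad M \<rho> \<phi> q)" if "p \<in> P" for p
    using integrable_vol[OF loc(1)[OF that]] by (simp only: eq[OF that])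
  have int': "integrable (vol M) (\<lambda>q. grad_inner M (w p) \<phi> q * \<rho> q)" if "p \<in> P" for p
    by (intro integrable_vol continuous_on_mult continuous_grad_inner wC that Ck_fun_smooth \<rho> \<phi>
        Ck_fun_continuous[OF Ck_fun_smooth])
  have "(LINT q|vol M. \<psi> q * Vpot M \<phi> \<rho> q) = - (LINT q|vol M. (\<Sum>p\<in>P. w p q * div_weighted_grad M \<rho> \<phi> q))"
    by (simp add: sum sum_distrib_right[symmetric] Vpot_def)
  also have "\<dots> = - (\<Sum>p\<in>P. (LINT q|vol M. w p q * div_weighted_grad M \<rho> \<phi> q))"
    using int by (subst Bochner_Integration.integral_sum) auto
  also have "\<dots> = (\<Sum>p\<in>P. (LINT q|vol M. grad_inner M (w p) \<phi> q * \<rho> q))"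
    using loc(2) by (simp add: eq sum_negf[symmetric])
  also have "\<dots> = (LINT q|vol M. (\<Sum>p\<in>P. grad_inner M (w p) \<phi> q * \<rho> q))"
    using int' by (subst Bochner_Integration.integral_sum) auto
  also have "\<dots> = (LINT q|vol M. grad_inner M (\<lambda>q. \<Sum>p\<in>P. w p q) \<phi> q * \<rho> q)"
    by (simp only: grad_inner_sum[OF P wC] sum_distrib_right)
  also have "\<dots> = (LINT q|vol M. grad_inner M \<psi> \<phi> q * \<rho> q)"
    by (simp only: sum)
  finally show ?thesis .
qed

end

section \<open>Otto's metric and its Levi-Civita connection\<close>

context closed_manifold
begin

lemma integral_add_scaled:
  fixes f g :: "'m \<Rightarrow> real"
  assumes "continuous_on UNIV f" "continuous_on UNIV g"
  shows "(LINT p|vol M. f p + e * g p) = (LINT p|vol M. f p) + e * (LINT p|vol M. g p)"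
  using integrable_vol[OF assms(1)] integrable_vol[OF assms(2)] by simp

lemma continuous_smooth: "smooth_fun M f \<Longrightarrow> continuous_on UNIV f"
  using Ck_fun_continuous[OF Ck_fun_smooth] .

lemma PinfD: "\<rho> \<in> Pinf M \<Longrightarrow> smooth_fun M \<rho>" "\<rho> \<in> Pinf M \<Longrightarrow> 0 < \<rho> x" "\<rho> \<in> Pinf M \<Longrightarrow> (LINT x|vol M. \<rho> x) = 1"
  by (auto simp: Pinf_def)

lemma TinfD: "u \<in> Tinf M \<Longrightarrow> smooth_fun M u" "u \<in> Tinf M \<Longrightarrow> (LINT x|vol M. u x) = 0"
  by (auto simp: Tinf_def)

text \<open>By compactness \<rho> has a positive minimum and \<open>u\<close> is bounded.
  Functionals are constrained only on \<open>Pinf M\<close>; this places the line in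
  \<open>vf_apply\<close> there near its base point.\<close>

lemma eventually_Pinf:
  assumes \<rho>: "\<rho> \<in> Pinf M" and u: "u \<in> Tinf M"
  shows "\<forall>\<^sub>F e in nhds 0. (\<lambda>x. \<rho> x + e * u x) \<in> Pinf M"
proof -
  note sm = PinfD(1)[OF \<rho>] TinfD(1)[OF u]
  obtain m where m: "\<And>x. \<rho> m \<le> \<rho> x"
    using continuous_attains_inf[OF compact_manifold _ continuous_smooth[OF sm(1)]] by auto
  obtain n where n: "\<And>x. \<bar>u x\<bar> \<le> \<bar>u n\<bar>"
    using continuous_attains_sup[OF compact_manifold _ continuous_on_rabs[OF continuous_smooth[OF sm(2)]]] by auto
  have "((\<lambda>e. \<bar>e\<bar> * \<bar>u n\<bar>) \<longlongrightarrow> \<bar>0\<bar> * \<bar>u n\<bar>) (nhds 0)"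
    by (intro tendsto_intros filterlim_ident)
  then have "\<forall>\<^sub>F e in nhds 0. \<bar>e\<bar> * \<bar>u n\<bar> < \<rho> m"
    by (rule order_tendstoD) (use PinfD(2)[OF \<rho>, of m] in simp)
  then show ?thesis
  proof (rule eventually_mono)
    fix e assume e: "\<bar>e\<bar> * \<bar>u n\<bar> < \<rho> m"
    have "0 < \<rho> x + e * u x" for x
    proof -
      have "\<bar>e * u x\<bar> \<le> \<bar>e\<bar> * \<bar>u n\<bar>" using n[of x] by (simp add: abs_mult mult_left_mono)
      then show ?thesis using e m[of x] by linarith
    qed
    moreover have "(LINT x|vol M. \<rho> x + e * u x) = 1"
      using integral_add_scaled[OF continuous_smooth[OF sm(1)] continuous_smooth[OF sm(2)]] PinfD(3)[OF \<rho>] TinfD(2)[OF u]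
      by simp
    ultimately show "(\<lambda>x. \<rho> x + e * u x) \<in> Pinf M"
      by (simp add: Pinf_def smooth_fun_add smooth_fun_mult sm)
  qed
qed

section \<open>Weak identities for the tangent vectors \<open>V\<^sub>\<phi>\<close>\<close>

lemma integration_by_parts_smooth:
  "smooth_fun M \<psi> \<Longrightarrow> smooth_fun M \<rho> \<Longrightarrow> smooth_fun M \<phi> \<Longrightarrow>
    (LINT p|vol M. \<psi> p * Vpot M \<phi> \<rho> p) = (LINT p|vol M. grad_inner M \<psi> \<phi> p * \<rho> p)"
  by (rule integration_by_parts[OF Ck_fun_smooth])

text \<open>The difference \<open>f - g\<close> is itself an admissible test function, so its square
  has integral zero.\<close>

lemma eqI_weak:
  assumes f: "smooth_fun M f" and g: "smooth_fun M g"
    and eq: "\<And>\<eta>. smooth_fun M \<eta> \<Longrightarrow> (LINT p|vol M. \<eta> p * f p) = (LINT p|vol M. \<eta> p * g p)"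
  shows "f = g"
proof
  fix p
  let ?w = "\<lambda>p. f p - g p"
  have w: "smooth_fun M ?w" by (rule smooth_fun_diff[OF f g])
  note int = integrable_vol[OF continuous_smooth[OF smooth_fun_mult[OF w f]]]
    integrable_vol[OF continuous_smooth[OF smooth_fun_mult[OF w g]]]
  have "(LINT p|vol M. ?w p * ?w p) = (LINT p|vol M. ?w p * f p - ?w p * g p)"
    by (intro Bochner_Integration.integral_cong refl) (simp add: algebra_simps)
  also have "\<dots> = 0" using int eq[OF w] by simp
  finally have z: "(LINT p|vol M. ?w p * ?w p) = 0" .
  have "?w p * ?w p = 0"
    by (rule integral_zero_imp_zero[OF continuous_smooth[OF smooth_fun_mult[OF w w]] zero_le_square z])
  then show "f p = g p" by simp
qed

lemma grad_inner_cmult: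
  assumes "smooth_fun M f"
  shows "grad_inner M (\<lambda>q. a * f q) g p = a * grad_inner M f g p"
proof -
  have "diff_at (chart_at M p) f p"
    by (rule diff_at_Ck_fun[OF Ck_fun_smooth[OF assms] chart_at])
  then have "pd (chart_at M p) i (\<lambda>q. a * f q) p = a * pd (chart_at M p) i f p" for i
    using pd_mult[of "chart_at M p" "\<lambda>_. a" p f i] chart_at[of p] by simp
  then show ?thesis by (simp add: grad_inner_eq_ginner ginner_def sum_distrib_left mult_ac)
qed

text \<open>Against a test function both sides become integrals of \<open>grad_inner\<close>, where
  only first derivatives occur; the divergence in coordinates stays untouched.\<close>

lemma Vpot_add:
  assumes \<rho>: "smooth_fun M \<rho>" and fg: "smooth_fun M f" "smooth_fun M g"
  shows "Vpot M (\<lambda>q. f q + g q) \<rho> = (\<lambda>p. Vpot M f \<rho> p + Vpot M g \<rho> p)"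
proof (rule eqI_weak)
  note V = smooth_fun_Vpot[OF \<rho> fg(1)] smooth_fun_Vpot[OF \<rho> fg(2)]
  show "smooth_fun M (Vpot M (\<lambda>q. f q + g q) \<rho>)" by (intro smooth_fun_Vpot \<rho> smooth_fun_add fg)
  show "smooth_fun M (\<lambda>p. Vpot M f \<rho> p + Vpot M g \<rho> p)" by (intro smooth_fun_add V)
  fix \<eta> assume \<eta>: "smooth_fun M \<eta>"
  have "grad_inner M \<eta> (\<lambda>q. f q + g q) p = grad_inner M \<eta> f p + grad_inner M \<eta> g p" for p
    unfolding grad_inner_commute[of \<eta>] by (intro grad_inner_add Ck_fun_smooth fg)
  then have "(LINT p|vol M. \<eta> p * Vpot M (\<lambda>q. f q + g q) \<rho> p)
      = (LINT p|vol M. grad_inner M \<eta> f p * \<rho> p + grad_inner M \<eta> g p * \<rho> p)"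
    by (simp add: integration_by_parts_smooth[OF \<eta> \<rho> smooth_fun_add[OF fg]] distrib_right)
  also have "\<dots> = (LINT p|vol M. grad_inner M \<eta> f p * \<rho> p) + (LINT p|vol M. grad_inner M \<eta> g p * \<rho> p)"
    by (intro Bochner_Integration.integral_add integrable_vol continuous_smooth smooth_fun_mult smooth_fun_grad_inner \<eta> fg \<rho>)
  also have "\<dots> = (LINT p|vol M. \<eta> p * Vpot M f \<rho> p) + (LINT p|vol M. \<eta> p * Vpot M g \<rho> p)"
    by (simp add: integration_by_parts_smooth \<eta> \<rho> fg)
  also have "\<dots> = (LINT p|vol M. \<eta> p * Vpot M f \<rho> p + \<eta> p * Vpot M g \<rho> p)"
    by (intro Bochner_Integration.integral_add[symmetric] integrable_vol continuous_smooth smooth_fun_mult V \<eta>)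
  finally show "(LINT p|vol M. \<eta> p * Vpot M (\<lambda>q. f q + g q) \<rho> p)
      = (LINT p|vol M. \<eta> p * (Vpot M f \<rho> p + Vpot M g \<rho> p))"
    by (simp add: distrib_left)
qed

lemma Vpot_cmult:
  assumes \<rho>: "smooth_fun M \<rho>" and f: "smooth_fun M f"
  shows "Vpot M (\<lambda>q. a * f q) \<rho> = (\<lambda>p. a * Vpot M f \<rho> p)"
proof (rule eqI_weak)
  note af = smooth_fun_mult[OF smooth_fun_const f, of a]
  show "smooth_fun M (Vpot M (\<lambda>q. a * f q) \<rho>)" by (rule smooth_fun_Vpot[OF \<rho> af])
  show "smooth_fun M (\<lambda>p. a * Vpot M f \<rho> p)" by (intro smooth_fun_mult smooth_fun_const smooth_fun_Vpot \<rho> f)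
  fix \<eta> assume \<eta>: "smooth_fun M \<eta>"
  have "(LINT p|vol M. \<eta> p * Vpot M (\<lambda>q. a * f q) \<rho> p) = (LINT p|vol M. a * (grad_inner M \<eta> f p * \<rho> p))"
    by (simp add: integration_by_parts_smooth[OF \<eta> \<rho> af] grad_inner_commute[of \<eta>] grad_inner_cmult[OF f] mult.assoc)
  also have "\<dots> = a * (LINT p|vol M. \<eta> p * Vpot M f \<rho> p)"
    by (simp add: integration_by_parts_smooth \<eta> \<rho> f)
  also have "\<dots> = (LINT p|vol M. \<eta> p * (a * Vpot M f \<rho> p))"
    by (simp add: mult.left_commute[of _ a])
  finally show "(LINT p|vol M. \<eta> p * Vpot M (\<lambda>q. a * f q) \<rho> p) = (LINT p|vol M. \<eta> p * (a * Vpot M f \<rho> p))" .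
qed

lemma Vpot_const [simp]: "Vpot M (\<lambda>_. a) \<rho> = (\<lambda>_. 0)"
  by (simp add: Vpot_def div_weighted_grad_def cov_deriv_def fun_eq_iff)

text \<open>Positivity of the inverse metric forces all partial derivatives to vanish, so
  \<open>f\<close> is constant on coordinate balls; connectedness does the rest.\<close>

lemma grad_zero_imp_const:
  assumes conn: "connected (UNIV :: 'm set)" and f: "smooth_fun M f" and z: "\<And>p. grad_inner M f f p = 0"
  shows "f p = f q"
proof (rule connected_local_const[OF conn UNIV_I UNIV_I])
  show "\<forall>p\<in>UNIV. \<forall>\<^sub>F q in at p. f p = f q"
  proof
    fix p
    obtain c where c: "c \<in> atlas M" "p \<in> fst c" by (rule obtain_chart)
    let ?S = "snd c ` fst c"
    obtain r where r: "r > 0" "ball (snd c p) r \<subseteq> ?S"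
      using open_contains_ball[of ?S] c by auto
    have der: "((\<lambda>x. f (chart_inv c x)) has_derivative (\<lambda>_. 0)) (at x)" if "x \<in> ?S" for x
    proof -
      let ?q = "chart_inv c x"
      have q: "?q \<in> fst c" by (rule chart_inv_in[OF c(1) that])
      have d: "diff_at c f ?q" by (rule diff_at_Ck_fun[OF Ck_fun_smooth[OF f] c(1) q])
      have "ginner c f f ?q = 0" using grad_inner_chart[OF c(1) q d d] z by simp
      then have "pd c i f ?q = 0" for i using ginner_pos[OF c(1) q, of f] by force
      then have "frechet_derivative (\<lambda>x. f (chart_inv c x)) (at x) = (\<lambda>_. 0)"
        using frechet_pd[OF d] chart_inv_right[OF c(1) that] by (simp add: fun_eq_iff)
      then show ?thesis
        using d chart_inv_right[OF c(1) that] by (simp only: diff_at_def frechet_derivative_works)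
    qed
    have "\<exists>k. \<forall>x\<in>ball (snd c p) r. f (chart_inv c x) = k"
    proof (rule has_derivative_zero_constant[OF convex_ball])
      fix x assume "x \<in> ball (snd c p) r"
      then have "x \<in> ?S" using r(2) by blast
      then show "((\<lambda>x. f (chart_inv c x)) has_derivative (\<lambda>_. 0)) (at x within ball (snd c p) r)"
        by (rule has_derivative_at_withinI[OF der])
    qed
    then obtain k where k: "\<And>x. x \<in> ball (snd c p) r \<Longrightarrow> f (chart_inv c x) = k" by blast
    let ?V = "fst c \<inter> snd c -` ball (snd c p) r"
    have "open ?V"
      using continuous_open_preimage[OF continuous_on_chart[OF c(1)]] c(1) by auto
    moreover have "p \<in> ?V" using c r by simp
    moreover have "f q = k" if "q \<in> ?V" for q
      using k[of "snd c q"] that c(1) by auto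
    ultimately show "\<forall>\<^sub>F q in at p. f p = f q"
      unfolding eventually_at_topological by metis
  qed
qed

text \<open>Energy identity: pairing \<open>V\<^sub>f\<close> with \<open>f\<close> itself gives the
  integral of \<open>|\<nabla>f|\<^sup>2 \<rho>\<close>, whose nonnegative integrand must vanish. By
  linearity a tangent vector thus determines its potential up to a constant.\<close>

lemma Vpot_zero_imp_const:
  assumes conn: "connected (UNIV :: 'm set)" and \<rho>: "\<rho> \<in> Pinf M" and f: "smooth_fun M f"
    and z: "Vpot M f \<rho> = (\<lambda>_. 0)"
  shows "f p = f q"
proof (rule grad_zero_imp_const[OF conn f])
  fix p
  have z0: "(LINT p|vol M. grad_inner M f f p * \<rho> p) = 0"
    using integration_by_parts_smooth[OF f PinfD(1)[OF \<rho>] f] z by simp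
  have cont: "continuous_on UNIV (\<lambda>p. grad_inner M f f p * \<rho> p)"
    by (intro continuous_smooth smooth_fun_mult smooth_fun_grad_inner f PinfD(1)[OF \<rho>])
  have "0 \<le> grad_inner M f f p * \<rho> p" for p
    using grad_inner_nonneg PinfD(2)[OF \<rho>, of p] by simp
  then have "grad_inner M f f p * \<rho> p = 0"
    by (rule integral_zero_imp_zero[OF cont _ z0])
  then show "grad_inner M f f p = 0" using PinfD(2)[OF \<rho>, of p] by simp
qed

lemma Vpot_Tinf: "\<rho> \<in> Pinf M \<Longrightarrow> smooth_fun M \<phi> \<Longrightarrow> Vpot M \<phi> \<rho> \<in> Tinf M"
  using integration_by_parts_smooth[of "\<lambda>_. 1" \<rho> \<phi>] by (simp add: Tinf_def smooth_fun_Vpot PinfD(1))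

lemma vector_field_Vpot: "smooth_fun M \<phi> \<Longrightarrow> vector_field M (Vpot M \<phi>)"
  unfolding vector_field_def Pinf_curve_def
  by (auto intro!: Vpot_Tinf smooth_curve_Vpot smooth_curve_const)

text \<open>This is the position vector field with origin \<rho> in the affine space that contains
  \<open>Pinf M\<close>.\<close>

lemma vector_field_diff_const:
  assumes \<rho>: "\<rho> \<in> Pinf M"
  shows "vector_field M (\<lambda>\<sigma> x. \<sigma> x - \<rho> x)"
proof -
  have "(LINT x|vol M. \<sigma> x - \<rho> x) = 0" if "\<sigma> \<in> Pinf M" for \<sigma>
    using integrable_vol[OF continuous_smooth[OF PinfD(1)[OF \<rho>]]]
      integrable_vol[OF continuous_smooth[OF PinfD(1)[OF that]]] PinfD(3) \<rho> that by simp
  moreover have "smooth_curve M UNIV (\<lambda>t x. \<gamma> t x - \<rho> x)" if "Pinf_curve M UNIV \<gamma>" for \<gamma>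
    using smooth_curve_add[OF open_UNIV, of \<gamma> "\<lambda>t x. - 1 * \<rho> x"] that
      smooth_curve_const[OF open_UNIV smooth_fun_mult[OF smooth_fun_const PinfD(1)[OF \<rho>], of "-1"]]
    by (simp add: Pinf_curve_def)
  ultimately show ?thesis
    using PinfD(1) \<rho> by (auto simp: vector_field_def Tinf_def intro: smooth_fun_diff)
qed

text \<open>\<open>F\<close> is known to be affine only on \<open>Pinf M\<close>, but the line in
  \<open>vf_apply\<close> stays there for small parameters, and the derivative at 0 sees nothing
  else. It is the linear part of \<open>F\<close>.\<close>

lemma vf_apply_affine:
  assumes \<rho>: "\<rho> \<in> Pinf M" and U: "U \<rho> \<in> Tinf M" and f: "smooth_fun M f"
    and F: "\<And>\<sigma>. \<sigma> \<in> Pinf M \<Longrightarrow> F \<sigma> = (LINT x|vol M. f x * \<sigma> x) + k"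
  shows "vf_apply U F \<rho> = (LINT x|vol M. f x * U \<rho> x)"
proof -
  let ?I = "\<lambda>g. LINT x|vol M. f x * g x"
  have "\<forall>\<^sub>F e in nhds 0. F (\<lambda>x. \<rho> x + e * U \<rho> x) = ?I \<rho> + e * ?I (U \<rho>) + k"
    using eventually_Pinf[OF \<rho> U]
  proof (rule eventually_mono)
    fix e assume "(\<lambda>x. \<rho> x + e * U \<rho> x) \<in> Pinf M"
    then have "F (\<lambda>x. \<rho> x + e * U \<rho> x) = (LINT x|vol M. f x * \<rho> x + e * (f x * U \<rho> x)) + k"
      by (simp add: F algebra_simps)
    also have "\<dots> = ?I \<rho> + e * ?I (U \<rho>) + k"
      using integral_add_scaled[OF continuous_smooth[OF smooth_fun_mult[OF f PinfD(1)[OF \<rho>]]]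
          continuous_smooth[OF smooth_fun_mult[OF f TinfD(1)[OF U]]]] by simp
    finally show "F (\<lambda>x. \<rho> x + e * U \<rho> x) = ?I \<rho> + e * ?I (U \<rho>) + k" .
  qed
  then have "deriv (\<lambda>e. F (\<lambda>x. \<rho> x + e * U \<rho> x)) 0 = deriv (\<lambda>e. ?I \<rho> + e * ?I (U \<rho>) + k) 0"
    by (intro deriv_cong_ev refl)
  also have "\<dots> = ?I (U \<rho>)"
    by (rule DERIV_imp_deriv) (auto intro!: derivative_eq_intros)
  finally show ?thesis by (simp add: vf_apply_def)
qed

text \<open>Without a potential, \<open>potential\<close> would return one and the same function for \<open>u\<close> and \<open>2 u\<close>, so
  bilinearity would force \<open>u\<close> to have length zero. Hence the existence of potentials, an elliptic
  problem, is implied by Otto's metric being a Riemannian metric.\<close>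

lemma potential_exists:
  assumes G: "riemannian_metric_Pinf M (otto_metric M)" and \<rho>: "\<rho> \<in> Pinf M" and u: "u \<in> Tinf M"
  shows "smooth_fun M (potential M \<rho> u) \<and> Vpot M (potential M \<rho> u) \<rho> = u"
proof -
  have "\<exists>\<phi>. smooth_fun M \<phi> \<and> Vpot M \<phi> \<rho> = u"
  proof (rule ccontr)
    assume none: "\<nexists>\<phi>. smooth_fun M \<phi> \<and> Vpot M \<phi> \<rho> = u"
    let ?u2 = "\<lambda>x. 2 * u x"
    have none2: "\<nexists>\<phi>. smooth_fun M \<phi> \<and> Vpot M \<phi> \<rho> = ?u2"
    proof
      assume "\<exists>\<phi>. smooth_fun M \<phi> \<and> Vpot M \<phi> \<rho> = ?u2"
      then obtain \<phi> where \<phi>: "smooth_fun M \<phi>" "Vpot M \<phi> \<rho> = ?u2" by blast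
      have "Vpot M (\<lambda>q. 1/2 * \<phi> q) \<rho> = u"
        unfolding Vpot_cmult[OF PinfD(1)[OF \<rho>] \<phi>(1)] \<phi>(2) by simp
      moreover have "smooth_fun M (\<lambda>q. 1/2 * \<phi> q)" by (intro smooth_fun_mult smooth_fun_const \<phi>(1))
      ultimately show False using none by blast
    qed
    have "(\<lambda>\<phi>. smooth_fun M \<phi> \<and> Vpot M \<phi> \<rho> = ?u2) = (\<lambda>\<phi>. smooth_fun M \<phi> \<and> Vpot M \<phi> \<rho> = u)"
      using none none2 by blast
    then have "potential M \<rho> ?u2 = potential M \<rho> u"
      by (simp add: potential_def)
    then have "otto_metric M \<rho> ?u2 u = otto_metric M \<rho> u u"
      by (simp add: otto_metric_def)
    moreover have "otto_metric M \<rho> (\<lambda>x. 2 * u x + 0 * u x) u = 2 * otto_metric M \<rho> u u + 0 * otto_metric M \<rho> u u"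
      using G \<rho> u unfolding riemannian_metric_Pinf_def by blast
    ultimately have "\<not> 0 < otto_metric M \<rho> u u" by simp
    moreover have "u \<noteq> (\<lambda>x. 0) \<longrightarrow> 0 < otto_metric M \<rho> u u"
      using G \<rho> u unfolding riemannian_metric_Pinf_def by blast
    ultimately have "u = (\<lambda>x. 0)" by blast
    \<comment> \<open>The zero vector does have a potential, namely a constant function.\<close>
    then show False using none Vpot_const[of 0 \<rho>] smooth_fun_const[of 0] by blast
  qed
  then show ?thesis unfolding potential_def by (rule someI_ex)
qed

lemma otto_metric_commute: "otto_metric M \<rho> u v = otto_metric M \<rho> v u"
  by (simp add: otto_metric_def grad_inner_commute)

text \<open>The potential \<beta> chosen for \<open>V\<^sub>\<psi>\<close> may differ from \<psi>.
  Integration by parts lets \<beta> enter only through its tangent vector, where it can be exchanged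
  for \<psi>; integrating by parts back and then with \<psi> as test function gives the
  claim.\<close>

lemma otto_metric_Vpot:
  assumes G: "riemannian_metric_Pinf M (otto_metric M)" and \<rho>: "\<rho> \<in> Pinf M" and u: "u \<in> Tinf M"
    and \<psi>: "smooth_fun M \<psi>"
  shows "otto_metric M \<rho> (Vpot M \<psi> \<rho>) u = (LINT x|vol M. \<psi> x * u x)"
proof -
  note sm = PinfD(1)[OF \<rho>]
  let ?V = "Vpot M \<psi> \<rho>"
  define \<alpha> where "\<alpha> = potential M \<rho> u"
  define \<beta> where "\<beta> = potential M \<rho> ?V"
  have \<alpha>: "smooth_fun M \<alpha>" "Vpot M \<alpha> \<rho> = u"
    unfolding \<alpha>_def using potential_exists[OF G \<rho> u] by auto
  have \<beta>: "smooth_fun M \<beta>" "Vpot M \<beta> \<rho> = ?V"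
    unfolding \<beta>_def using potential_exists[OF G \<rho> Vpot_Tinf[OF \<rho> \<psi>]] by auto
  have "otto_metric M \<rho> ?V u = (LINT x|vol M. grad_inner M \<alpha> \<beta> x * \<rho> x)"
    by (simp add: otto_metric_def \<alpha>_def \<beta>_def grad_inner_commute)
  also have "\<dots> = (LINT x|vol M. \<alpha> x * Vpot M \<psi> \<rho> x)"
    using integration_by_parts_smooth[OF \<alpha>(1) sm \<beta>(1)] by (simp add: \<beta>(2))
  also have "\<dots> = (LINT x|vol M. grad_inner M \<psi> \<alpha> x * \<rho> x)"
    using integration_by_parts_smooth[OF \<alpha>(1) sm \<psi>] by (simp add: grad_inner_commute)
  also have "\<dots> = (LINT x|vol M. \<psi> x * u x)"
    using integration_by_parts_smooth[OF \<psi> sm \<alpha>(1)] by (simp add: \<alpha>(2))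
  finally show ?thesis .
qed

text \<open>The Koszul formula for \<open>V\<^sub>\<phi>, V\<^sub>\<phi>, V\<^sub>\<psi>\<close>. The torsion enters through the linear functional
  \<open>\<sigma> \<mapsto> \<integral> \<phi> (\<sigma> - \<rho>)\<close>; its smoothness comes from writing it as the scalar product of \<open>V\<^sub>\<phi>\<close> with the
  vector field \<open>\<sigma> \<mapsto> \<sigma> - \<rho>\<close>.\<close>

lemma levi_civita_Vpot_self:
  assumes LC: "levi_civita M (otto_metric M) D" and \<rho>: "\<rho> \<in> Pinf M" and \<phi>: "smooth_fun M \<phi>"
  shows "D (Vpot M \<phi>) (Vpot M \<phi>) \<rho> = Vpot M (\<lambda>x. 1/2 * grad_inner M \<phi> \<phi> x) \<rho>"
proof (rule eqI_weak)
  let ?X = "Vpot M \<phi>" and ?G = "otto_metric M"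
  have G: "riemannian_metric_Pinf M ?G" and aff: "affine_connection M D"
    and tf: "torsion_free M D" and mc: "metric_compatible M ?G D"
    using LC by (auto simp: levi_civita_def)
  note sm = PinfD(1)[OF \<rho>]
  have VX: "vector_field M ?X" by (rule vector_field_Vpot[OF \<phi>])
  have VD: "vector_field M (D U V)" if "vector_field M U" "vector_field M V" for U V
    using conjunct1[OF aff[unfolded affine_connection_def]] that by blast
  have T: "U \<rho> \<in> Tinf M" if "vector_field M U" for U
    using that \<rho> by (simp add: vector_field_def)
  have XT: "?X \<sigma> \<in> Tinf M" if "\<sigma> \<in> Pinf M" for \<sigma> by (rule Vpot_Tinf[OF that \<phi>])
  define q where "q = grad_inner M \<phi> \<phi>"
  have q: "smooth_fun M q" unfolding q_def by (rule smooth_fun_grad_inner[OF \<phi> \<phi>])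
  have q2: "smooth_fun M (\<lambda>x. 1/2 * q x)" by (intro smooth_fun_mult smooth_fun_const q)
  show "smooth_fun M (D ?X ?X \<rho>)" by (rule TinfD(1)[OF T[OF VD[OF VX VX]]])
  show "smooth_fun M (Vpot M (\<lambda>x. 1/2 * grad_inner M \<phi> \<phi> x) \<rho>)"
    using smooth_fun_Vpot[OF sm q2] by (simp add: q_def)
  fix \<psi> assume \<psi>: "smooth_fun M \<psi>"
  let ?Z = "Vpot M \<psi>"
  have VZ: "vector_field M ?Z" by (rule vector_field_Vpot[OF \<psi>])
  have ZT: "?Z \<sigma> \<in> Tinf M" if "\<sigma> \<in> Pinf M" for \<sigma> by (rule Vpot_Tinf[OF that \<psi>])
  define r where "r = grad_inner M \<phi> \<psi>"
  have r: "smooth_fun M r" unfolding r_def by (rule smooth_fun_grad_inner[OF \<phi> \<psi>])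
  let ?F = "\<lambda>\<sigma>. ?G \<sigma> (?X \<sigma>) (\<lambda>x. \<sigma> x - \<rho> x)"
  have F: "?F \<sigma> = (LINT x|vol M. \<phi> x * \<sigma> x) + (- (LINT x|vol M. \<phi> x * \<rho> x))" if "\<sigma> \<in> Pinf M" for \<sigma>
  proof -
    have "(\<lambda>x. \<sigma> x - \<rho> x) \<in> Tinf M"
      using vector_field_diff_const[OF \<rho>] that by (simp add: vector_field_def)
    from otto_metric_Vpot[OF G that this \<phi>]
    have "?F \<sigma> = (LINT x|vol M. \<phi> x * \<sigma> x - \<phi> x * \<rho> x)" by (simp add: right_diff_distrib)
    then show ?thesis
      using integrable_vol[OF continuous_smooth[OF smooth_fun_mult[OF \<phi> PinfD(1)[OF that]]]]
        integrable_vol[OF continuous_smooth[OF smooth_fun_mult[OF \<phi> sm]]] by simp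
  qed
  have "\<forall>X Y. vector_field M X \<longrightarrow> vector_field M Y \<longrightarrow> smooth_functional M (\<lambda>\<sigma>. ?G \<sigma> (X \<sigma>) (Y \<sigma>))"
    using G unfolding riemannian_metric_Pinf_def by (elim conjE)
  from this[rule_format, OF VX vector_field_diff_const[OF \<rho>]]
  have Fs: "smooth_functional M ?F" .
  have DF: "vf_apply U ?F \<sigma> = (LINT x|vol M. \<phi> x * U \<sigma> x)" if "\<sigma> \<in> Pinf M" "U \<sigma> \<in> Tinf M" for U \<sigma>
    by (rule vf_apply_affine[where F="?F" and U=U and f=\<phi>, OF that \<phi> F])
  \<comment> \<open>The derivatives of \<open>?F\<close> along \<open>?Z\<close> and
    \<open>?X\<close> are again affine in the density, so the iterated derivatives in the bracket
    follow by the same rule. The summand \<open>+ 0\<close> fits them to its form.\<close>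
  have DZF: "vf_apply ?Z ?F \<sigma> = (LINT x|vol M. r x * \<sigma> x) + 0" if "\<sigma> \<in> Pinf M" for \<sigma>
    using DF[where U="?Z", OF that ZT[OF that]] integration_by_parts_smooth[OF \<phi> PinfD(1)[OF that] \<psi>] by (simp add: r_def)
  have DXF: "vf_apply ?X ?F \<sigma> = (LINT x|vol M. q x * \<sigma> x) + 0" if "\<sigma> \<in> Pinf M" for \<sigma>
    using DF[where U="?X", OF that XT[OF that]] integration_by_parts_smooth[OF \<phi> PinfD(1)[OF that] \<phi>] by (simp add: q_def)
  have "vf_apply (D ?X ?Z) ?F \<rho> - vf_apply (D ?Z ?X) ?F \<rho>
      = vf_apply ?X (vf_apply ?Z ?F) \<rho> - vf_apply ?Z (vf_apply ?X ?F) \<rho>"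
    using tf VX VZ Fs \<rho> unfolding torsion_free_def by blast
  then have torsion: "(LINT x|vol M. \<phi> x * D ?X ?Z \<rho> x) - (LINT x|vol M. \<phi> x * D ?Z ?X \<rho> x)
      = (LINT x|vol M. r x * ?X \<rho> x) - (LINT x|vol M. q x * ?Z \<rho> x)"
    using DF[where U="D ?X ?Z", OF \<rho> T[OF VD[OF VX VZ]]] DF[where U="D ?Z ?X", OF \<rho> T[OF VD[OF VZ VX]]]
      vf_apply_affine[where U="?X" and F="vf_apply ?Z ?F" and k=0, OF \<rho> XT[OF \<rho>] r DZF] vf_apply_affine[where U="?Z" and F="vf_apply ?X ?F" and k=0, OF \<rho> ZT[OF \<rho>] q DXF] by simp
  have GXZ: "?G \<sigma> (?X \<sigma>) (?Z \<sigma>) = (LINT x|vol M. r x * \<sigma> x) + 0" if "\<sigma> \<in> Pinf M" for \<sigma>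
    using otto_metric_Vpot[OF G that ZT[OF that] \<phi>] integration_by_parts_smooth[OF \<phi> PinfD(1)[OF that] \<psi>] by (simp add: r_def)
  have GXX: "?G \<sigma> (?X \<sigma>) (?X \<sigma>) = (LINT x|vol M. q x * \<sigma> x) + 0" if "\<sigma> \<in> Pinf M" for \<sigma>
    using otto_metric_Vpot[OF G that XT[OF that] \<phi>] integration_by_parts_smooth[OF \<phi> PinfD(1)[OF that] \<phi>] by (simp add: q_def)
  have "vf_apply ?X (\<lambda>\<sigma>. ?G \<sigma> (?X \<sigma>) (?Z \<sigma>)) \<rho> = ?G \<rho> (D ?X ?X \<rho>) (?Z \<rho>) + ?G \<rho> (?X \<rho>) (D ?X ?Z \<rho>)"
    using mc VX VZ \<rho> unfolding metric_compatible_def by blast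
  moreover have "vf_apply ?X (\<lambda>\<sigma>. ?G \<sigma> (?X \<sigma>) (?Z \<sigma>)) \<rho> = (LINT x|vol M. r x * ?X \<rho> x)"
    by (rule vf_apply_affine[where U="?X" and k=0 and F="\<lambda>\<sigma>. ?G \<sigma> (?X \<sigma>) (?Z \<sigma>)", OF \<rho> XT[OF \<rho>] r GXZ])
  ultimately have 1: "(LINT x|vol M. r x * ?X \<rho> x) = (LINT x|vol M. \<psi> x * D ?X ?X \<rho> x) + (LINT x|vol M. \<phi> x * D ?X ?Z \<rho> x)"
    using otto_metric_commute[of \<rho> "D ?X ?X \<rho>"]
      otto_metric_Vpot[OF G \<rho> T[OF VD[OF VX VX]] \<psi>] otto_metric_Vpot[OF G \<rho> T[OF VD[OF VX VZ]] \<phi>] by simp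
  have "vf_apply ?Z (\<lambda>\<sigma>. ?G \<sigma> (?X \<sigma>) (?X \<sigma>)) \<rho> = ?G \<rho> (D ?Z ?X \<rho>) (?X \<rho>) + ?G \<rho> (?X \<rho>) (D ?Z ?X \<rho>)"
    using mc VX VZ \<rho> unfolding metric_compatible_def by blast
  moreover have "vf_apply ?Z (\<lambda>\<sigma>. ?G \<sigma> (?X \<sigma>) (?X \<sigma>)) \<rho> = (LINT x|vol M. q x * ?Z \<rho> x)"
    by (rule vf_apply_affine[where U="?Z" and k=0 and F="\<lambda>\<sigma>. ?G \<sigma> (?X \<sigma>) (?X \<sigma>)", OF \<rho> ZT[OF \<rho>] q GXX])
  ultimately have 2: "(LINT x|vol M. q x * ?Z \<rho> x) = 2 * (LINT x|vol M. \<phi> x * D ?Z ?X \<rho> x)"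
    using otto_metric_commute[of \<rho> "D ?Z ?X \<rho>"] otto_metric_Vpot[OF G \<rho> T[OF VD[OF VZ VX]] \<phi>] by simp
  \<comment> \<open>The integral of \<open>r\<close> against \<open>?X \<rho>\<close> cancels
    between \<open>1\<close> and \<open>torsion\<close>. What remains is the integral of
    \<open>q\<close> against \<open>?Z \<rho>\<close> minus, by \<open>2\<close>, half of
    itself.\<close>
  have "(LINT x|vol M. \<psi> x * D ?X ?X \<rho> x) = 1/2 * (LINT x|vol M. q x * ?Z \<rho> x)"
    using torsion 1 2 by linarith
  \<comment> \<open>Two integrations by parts, passing through the symmetric integral of
    \<open>\<langle>\<nabla>q, \<nabla>\<psi>\<rangle> \<rho>\<close>, exchange the roles of
    \<open>q\<close> and \<psi>.\<close>
  also have "\<dots> = (LINT x|vol M. \<psi> x * Vpot M (\<lambda>x. 1/2 * q x) \<rho> x)"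
  proof -
    have "(LINT x|vol M. \<psi> x * Vpot M (\<lambda>x. 1/2 * q x) \<rho> x) = 1/2 * (LINT x|vol M. \<psi> x * Vpot M q \<rho> x)"
      unfolding Vpot_cmult[OF sm q] mult.left_commute[of _ "1/2"] by (rule integral_mult_right_zero)
    then show ?thesis
      by (simp only: integration_by_parts_smooth[OF q sm \<psi>] integration_by_parts_smooth[OF \<psi> sm q] grad_inner_commute[of q])
  qed
  finally show "(LINT x|vol M. \<psi> x * D ?X ?X \<rho> x) = (LINT x|vol M. \<psi> x * Vpot M (\<lambda>x. 1/2 * grad_inner M \<phi> \<phi> x) \<rho> x)"
    by (simp add: q_def)
qed

end

section \<open>The geodesic equation\<close>

lemma smooth_on_antiderivative:
  fixes h e :: "real \<Rightarrow> real"
  assumes "open I" "\<And>t. t \<in> I \<Longrightarrow> (h has_real_derivative e t) (at t)" "smooth_on I e"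
  shows "smooth_on I h"
  unfolding smooth_on_def
proof
  fix k
  have "Ck_on (Suc k) I h"
  proof (rule Ck_on_SucI[OF assms(1)])
    show "(h has_derivative (\<lambda>v. e t * v)) (at t)" if "t \<in> I" for t
      using assms(2)[OF that] by (simp add: has_field_derivative_def)
    show "Ck_on k I (\<lambda>t. e t * v)" for v
      using assms(3) by (intro Ck_on_mult assms(1) Ck_on_const) (simp add: smooth_on_def)
  qed
  then show "Ck_on k I h" by (rule Ck_on_SucD)
qed

text \<open>\<open>e\<close> may be unbounded near \<open>a\<close> and \<open>b\<close>, hence the
  antiderivative for open intervals with \<open>ereal\<close> end points.\<close>

lemma smooth_on_obtain_antiderivative:
  fixes e :: "real \<Rightarrow> real"
  assumes "a < b" "smooth_on {a<..<b} e"
  obtains h where "smooth_on {a<..<b} h" "\<And>t. t \<in> {a<..<b} \<Longrightarrow> (h has_real_derivative e t) (at t)"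
proof -
  have "continuous_on {a<..<b} e"
    using assms(2) Ck_on_imp_continuous by (auto simp: smooth_on_def)
  then have "isCont e t" if "ereal a < ereal t" "ereal t < ereal b" for t
    using that by (simp add: continuous_on_eq_continuous_at)
  then obtain h where "\<forall>t. ereal a < ereal t \<longrightarrow> ereal t < ereal b \<longrightarrow> (h has_vector_derivative e t) (at t)"
    using einterval_antiderivative[of "ereal a" "ereal b" e] assms(1) by auto
  then have h: "(h has_real_derivative e t) (at t)" if "t \<in> {a<..<b}" for t
    using that by (simp add: has_real_derivative_iff_has_vector_derivative)
  then show ?thesis
    using that smooth_on_antiderivative[OF open_greaterThanLessThan h assms(2)] by blast
qed

context closed_manifold
begin

text \<open>Stated for an arbitrary curve \<eta> of potentials, since it is applied both to a shift
  of the given potential and to the unknown one in the definition of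
  \<open>geodesic\<close>.\<close>

lemma parallel_velocity_iff:
  assumes conn: "connected (UNIV :: 'm set)" and LC: "levi_civita M (otto_metric M) D"
    and I: "open I" and \<rho>: "Pinf_curve M I \<rho>" and \<eta>: "smooth_curve M I \<eta>"
  shows "parallel_along M D I \<rho> \<eta> \<eta> \<longleftrightarrow>
    (\<forall>t\<in>I. \<exists>k. \<forall>x. deriv (\<lambda>s. \<eta> s x) t + 1/2 * grad_inner M (\<eta> t) (\<eta> t) x = k)"
  unfolding parallel_along_def
proof (rule ball_cong[OF refl])
  fix t assume t: "t \<in> I"
  have \<rho>t: "\<rho> t \<in> Pinf M" using \<rho> t by (simp add: Pinf_curve_def)
  have \<eta>t: "smooth_fun M (\<eta> t)" by (rule smooth_fun_of_curve[OF I t \<eta>])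
  have dt: "smooth_fun M (\<lambda>x. deriv (\<lambda>s. \<eta> s x) t)"
    by (rule smooth_fun_of_curve[OF I t smooth_curve_time_derivative(1)[OF I \<eta>]])
  have g: "smooth_fun M (\<lambda>x. 1/2 * grad_inner M (\<eta> t) (\<eta> t) x)"
    by (intro smooth_fun_mult smooth_fun_const smooth_fun_grad_inner \<eta>t)
  let ?E = "\<lambda>x. deriv (\<lambda>s. \<eta> s x) t + 1/2 * grad_inner M (\<eta> t) (\<eta> t) x"
  have E: "smooth_fun M ?E" by (rule smooth_fun_add[OF dt g])
  have V: "Vpot M (\<lambda>y. deriv (\<lambda>s. \<eta> s y) t) (\<rho> t) x + D (Vpot M (\<eta> t)) (Vpot M (\<eta> t)) (\<rho> t) x
      = Vpot M ?E (\<rho> t) x" for x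
    unfolding levi_civita_Vpot_self[OF LC \<rho>t \<eta>t] Vpot_add[OF PinfD(1)[OF \<rho>t] dt g] ..
  show "(\<forall>x. Vpot M (\<lambda>y. deriv (\<lambda>s. \<eta> s y) t) (\<rho> t) x + D (Vpot M (\<eta> t)) (Vpot M (\<eta> t)) (\<rho> t) x = 0)
      \<longleftrightarrow> (\<exists>k. \<forall>x. ?E x = k)"
    unfolding V
  proof
    assume "\<forall>x. Vpot M ?E (\<rho> t) x = 0"
    then have z: "Vpot M ?E (\<rho> t) = (\<lambda>_. 0)" unfolding fun_eq_iff .
    have "?E x = ?E y" for x y
      by (rule Vpot_zero_imp_const[OF conn \<rho>t E z])
    then show "\<exists>k. \<forall>x. ?E x = k" by blast
  next
    assume "\<exists>k. \<forall>x. ?E x = k"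
    then obtain k where "?E = (\<lambda>_. k)" unfolding fun_eq_iff by blast
    then show "\<forall>x. Vpot M ?E (\<rho> t) x = 0" by (simp only: Vpot_const simp_thms)
  qed
qed

text \<open>\<open>geodesic\<close> asks for some velocity potential, not for the given one. The two
  can be compared because both describe the same time derivative of the density.\<close>

lemma velocity_potential_unique:
  assumes conn: "connected (UNIV :: 'm set)" and I: "open I" and \<rho>: "Pinf_curve M I \<rho>"
    and \<phi>: "has_velocity_potential M I \<rho> \<phi>" and \<phi>': "has_velocity_potential M I \<rho> \<phi>'" and t: "t \<in> I"
  shows "\<phi>' t x - \<phi> t x = \<phi>' t y - \<phi> t y"
proof -
  have \<rho>t: "\<rho> t \<in> Pinf M" using \<rho> t by (simp add: Pinf_curve_def)
  have sm: "smooth_fun M (\<phi> t)" "smooth_fun M (\<phi>' t)"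
    using smooth_fun_of_curve[OF I t] \<phi> \<phi>' by (auto simp: has_velocity_potential_def)
  have "Vpot M (\<phi> t) (\<rho> t) x = Vpot M (\<phi>' t) (\<rho> t) x" for x
    using \<phi> \<phi>' t DERIV_unique unfolding has_velocity_potential_def by blast
  then have "Vpot M (\<lambda>q. \<phi>' t q + (- 1) * \<phi> t q) (\<rho> t) = (\<lambda>_. 0)"
    unfolding Vpot_add[OF PinfD(1)[OF \<rho>t] sm(2) smooth_fun_mult[OF smooth_fun_const sm(1)]]
      Vpot_cmult[OF PinfD(1)[OF \<rho>t] sm(1)] by simp
  from Vpot_zero_imp_const[OF conn \<rho>t _ this] show ?thesis
    by (simp add: smooth_fun_diff sm)
qed

lemma grad_inner_shift:
  assumes "smooth_fun M f"
  shows "grad_inner M (\<lambda>y. f y + k) (\<lambda>y. f y + k) x = grad_inner M f f x"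
proof -
  have add: "grad_inner M (\<lambda>y. f y + k) g x = grad_inner M f g x" for g
    using grad_inner_add[OF Ck_fun_smooth[OF assms] Ck_fun_const] by simp
  show ?thesis
    using add[of "\<lambda>y. f y + k"] grad_inner_commute[of f "\<lambda>y. f y + k" x] add[of f] by simp
qed

lemma deriv_shift:
  assumes "open I" "smooth_curve M I \<phi>" "t \<in> I" "(h has_real_derivative h') (at t)"
  shows "deriv (\<lambda>s. \<phi> s x + h s) t = deriv (\<lambda>s. \<phi> s x) t + h'"
proof -
  have "((\<lambda>s. \<phi> s x) has_real_derivative deriv (\<lambda>s. \<phi> s x) t) (at t)"
    using smooth_curve_time_derivative(2)[OF assms(1-3)] DERIV_imp_deriv
    unfolding real_differentiable_def by blast
  then show ?thesis
    by (intro DERIV_imp_deriv DERIV_add assms(4))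
qed

lemma shift_velocity_potential:
  assumes I: "open I" and \<rho>: "Pinf_curve M I \<rho>" and \<phi>: "has_velocity_potential M I \<rho> \<phi>"
    and h: "smooth_on I h"
  shows "has_velocity_potential M I \<rho> (\<lambda>t x. \<phi> t x + h t)"
proof -
  have \<phi>s: "smooth_curve M I \<phi>" using \<phi> by (simp add: has_velocity_potential_def)
  have "Vpot M (\<lambda>x. \<phi> t x + h t) (\<rho> t) = Vpot M (\<phi> t) (\<rho> t)" if "t \<in> I" for t
  proof -
    have "\<rho> t \<in> Pinf M" using \<rho> that by (simp add: Pinf_curve_def)
    then show ?thesis
      using Vpot_add[OF PinfD(1) smooth_fun_of_curve[OF I that \<phi>s] smooth_fun_const] by simp
  qed
  then show ?thesis
    using \<phi> smooth_curve_add[OF I \<phi>s smooth_curve_time_fun[OF I h]]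
    by (simp add: has_velocity_potential_def)
qed

lemma geodesic_iff:
  assumes conn: "connected (UNIV :: 'm set)" and LC: "levi_civita M (otto_metric M) D"
    and ab: "a < b" and \<rho>: "Pinf_curve M {a<..<b} \<rho>" and \<phi>: "has_velocity_potential M {a<..<b} \<rho> \<phi>"
  shows "geodesic M D {a<..<b} \<rho> \<longleftrightarrow>
    (\<exists>h :: real \<Rightarrow> real. smooth_on {a<..<b} h \<and>
      (\<forall>t\<in>{a<..<b}. \<forall>x.
        deriv (\<lambda>s. \<phi> s x + h s) t
          + (1/2) * grad_inner M (\<lambda>y. \<phi> t y + h t) (\<lambda>y. \<phi> t y + h t) x = 0))"
    (is "_ \<longleftrightarrow> (\<exists>h. smooth_on ?I h \<and> ?eq h)")
proof
  have I: "open ?I" by simp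
  note par = parallel_velocity_iff[OF conn LC I \<rho>]
  have \<phi>s: "smooth_curve M ?I \<phi>" using \<phi> by (simp add: has_velocity_potential_def)
  let ?E = "\<lambda>t x. deriv (\<lambda>s. \<phi> s x) t + 1/2 * grad_inner M (\<phi> t) (\<phi> t) x"
  {
    assume "\<exists>h. smooth_on ?I h \<and> ?eq h"
    then obtain h where h: "smooth_on ?I h" "?eq h" by blast
    let ?\<eta> = "\<lambda>t x. \<phi> t x + h t"
    have \<eta>: "has_velocity_potential M ?I \<rho> ?\<eta>" by (rule shift_velocity_potential[OF I \<rho> \<phi> h(1)])
    then have "parallel_along M D ?I \<rho> ?\<eta> ?\<eta>"
      using h(2) by (subst par) (auto simp: has_velocity_potential_def)
    with \<eta> show "geodesic M D ?I \<rho>" unfolding geodesic_def by blast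
  next
    assume "geodesic M D ?I \<rho>"
    then obtain \<phi>' where \<phi>': "has_velocity_potential M ?I \<rho> \<phi>'" "parallel_along M D ?I \<rho> \<phi>' \<phi>'"
      unfolding geodesic_def by blast
    have \<phi>'s: "smooth_curve M ?I \<phi>'" using \<phi>' by (simp add: has_velocity_potential_def)
    have Econst: "?E t x = ?E t y" if t: "t \<in> ?I" for t x y
    proof -
      \<comment> \<open>By uniqueness the difference of the potentials at \<open>y\<close> is their
        difference at every point. Its time derivative only changes the spatial constant in the
        equation for \<open>\<phi>'\<close>.\<close>
      define k where "k s = \<phi> s y - \<phi>' s y" for s
      have eq: "\<phi> s z = \<phi>' s z + k s" if "s \<in> ?I" for s z
        using velocity_potential_unique[OF conn I \<rho> \<phi>'(1) \<phi> that, of z y] by (simp add: k_def)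
      have "k differentiable (at t)"
        unfolding k_def
        by (intro differentiable_diff smooth_curve_time_derivative(2)[OF I] \<phi>s \<phi>'s t)
      then obtain k' where k': "(k has_real_derivative k') (at t)"
        by (auto simp: real_differentiable_def)
      have "deriv (\<lambda>s. \<phi> s z) t = deriv (\<lambda>s. \<phi>' s z + k s) t" for z
        by (rule deriv_cong_ev[OF eventually_mono[OF eventually_nhds_in_open[OF I t]] refl]) (rule eq)
      then have d: "deriv (\<lambda>s. \<phi> s z) t = deriv (\<lambda>s. \<phi>' s z) t + k'" for z
        by (simp only: deriv_shift[OF I \<phi>'s t k'])
      have "\<phi> t = (\<lambda>z. \<phi>' t z + k t)" using eq[OF t] by blast
      then have g: "grad_inner M (\<phi> t) (\<phi> t) z = grad_inner M (\<phi>' t) (\<phi>' t) z" for z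
        using grad_inner_shift[OF smooth_fun_of_curve[OF I t \<phi>'s]] by simp
      obtain c where "\<And>z. deriv (\<lambda>s. \<phi>' s z) t + 1/2 * grad_inner M (\<phi>' t) (\<phi>' t) z = c"
        using iffD1[OF par[OF \<phi>'s] \<phi>'(2)] t by blast
      then have "?E t z = c + k'" for z unfolding d g by (metis add.commute add.left_commute)
      then show ?thesis by simp
    qed
    \<comment> \<open>An arbitrary base point: \<open>?E t\<close> is constant in space, so its
      value at \<open>y\<close> is that constant, and as a slice of a jointly smooth function it is
      smooth in \<open>t\<close>.\<close>
    obtain y :: 'm where True by blast
    obtain c where c: "c \<in> atlas M" "y \<in> fst c" by (rule obtain_chart)
    have "smooth_curve M ?I (\<lambda>t. grad_inner M (\<phi> t) (\<phi> t))"
      by (rule smooth_curve_grad_inner[OF I \<phi>s \<phi>s])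
    then have "smooth_curve M ?I (\<lambda>t x. 1/2 * grad_inner M (\<phi> t) (\<phi> t) x)"
      by (rule smooth_curve_mult[OF I smooth_curve_const[OF I smooth_fun_const]])
    from smooth_curve_mult[OF I smooth_curve_const[OF I smooth_fun_const[of "-1"]]
        smooth_curve_add[OF I smooth_curve_time_derivative(1)[OF I \<phi>s] this]]
    have "smooth_curve M ?I (\<lambda>t x. - 1 * ?E t x)" .
    then have "Ck_on k (?I \<times> snd c ` fst c) (\<lambda>(t, x). - 1 * ?E t (chart_inv c x))" for k
      using c(1) unfolding smooth_curve_iff by blast
    from Ck_on_slice_left[OF I open_chart(2)[OF c(1)] imageI[OF c(2)] this]
    have "smooth_on ?I (\<lambda>t. - 1 * ?E t y)"
      unfolding smooth_on_def chart_inv_left[OF c] by blast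
    from smooth_on_obtain_antiderivative[OF ab this]
    obtain h where h: "smooth_on ?I h" "\<And>t. t \<in> ?I \<Longrightarrow> (h has_real_derivative - 1 * ?E t y) (at t)" by blast
    have "?eq h"
    proof (intro ballI allI)
      fix t x assume t: "t \<in> ?I"
      show "deriv (\<lambda>s. \<phi> s x + h s) t
          + (1/2) * grad_inner M (\<lambda>y. \<phi> t y + h t) (\<lambda>y. \<phi> t y + h t) x = 0"
        unfolding deriv_shift[OF I \<phi>s t h(2)[OF t]] grad_inner_shift[OF smooth_fun_of_curve[OF I t \<phi>s]]
        using Econst[OF t, of x y] by simp
    qed
    with h(1) show "\<exists>h. smooth_on ?I h \<and> ?eq h" by blast
  }
qed

end

theorem proposition4p24:
  fixes M :: "('m::t2_space, 'n::finite) riem_mfd"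
    and D :: "'m vfield \<Rightarrow> 'm vfield \<Rightarrow> 'm vfield"
    and \<rho> \<phi> :: "real \<Rightarrow> 'm \<Rightarrow> real"
    and a b :: real
  assumes "closed_riemannian_manifold M"
    and "connected (UNIV :: 'm set)"
    and "levi_civita M (otto_metric M) D"
    and "a < b"
    and "Pinf_curve M {a<..<b} \<rho>"
    and "has_velocity_potential M {a<..<b} \<rho> \<phi>"
  shows "geodesic M D {a<..<b} \<rho> \<longleftrightarrow>
    (\<exists>h :: real \<Rightarrow> real. smooth_on {a<..<b} h \<and>
      (\<forall>t\<in>{a<..<b}. \<forall>x.
        deriv (\<lambda>s. \<phi> s x + h s) t
          + (1/2) * grad_inner M (\<lambda>y. \<phi> t y + h t) (\<lambda>y. \<phi> t y + h t) x = 0))"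
  using closed_manifold.geodesic_iff[OF closed_manifold.intro[OF assms(1)] assms(2-6)] .

end
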